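(* Let $\mathcal{T}$ be a differential equation on $T^s_nX$ with local form $\mathcal{T}=\mathcal{T}_Adx^A$. In the induced chart $V^t$, $t>2s$, of any chart $V$ of $X$ define $$\mathcal{H}^J_{AB}=\partial^J_B\mathcal{T}_A-(-1)^{|J|}\mathcal{E}^J_A(\mathcal{T}_B),\qquad|J|\le s.$$ Then there exists a globally defined $2$-form $\mathcal{H}(\mathcal{T})$ on $T^t_nX$ such that in any chart $V^t$ $$\mathcal{H}(\mathcal{T})=\sum_{|J|\le s}\mathcal{H}^J_{AB}\,dx^B_J\wedge dx^A .$$
   Context: $X$ is a smooth manifold of dimension $N\ge n\ge1$. $T^s_nX$ is the manifold of $(s,n)$-velocities, i.e. $s$-jets $j^s_0\gamma$ at $0$ of smooth maps (immersions) $\gamma$ from a neighbourhood of $0\in\mathbb{R}^n$ to $X$. A chart $(V,(x^A))$, $A=1,\dots,N$, of $X$ induces the chart $V^s$ with coordinates $x^A_{j_1,\dots,j_k}(j^s_0\gamma)=\partial^k(x^A\circ\gamma)/\partial t^{j_1}\cdots\partial t^{j_k}|_0$, $0\le k\le s$, symmetric in the lower indices. Functions on $T^s_nX$ are pulled back to $T^t_nX$, $t\ge s$, along the canonical projection. A differential equation on $T^s_nX$ is a $1$-form $\mathcal{T}$ on $T^s_nX$ which in every induced chart has the form $\mathcal{T}=\mathcal{T}_Adx^A$ with $\mathcal{T}_A$ smooth functions of the $x^B_J$, $|J|\le s$. Multi-indices are sequences in $\{1,\dots,n\}$; sums over multi-indices run over all sequences; $IJ$ is juxtaposition. $\partial^{j_1,\dots,j_k}_A=\frac{r_1!\cdots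 r_n!}{k!}\frac{\partial}{\partial x^A_{j_1,\dots,j_k}}$, where $r_l$ is the number of occurrences of $l$ in $(j_1,\dots,j_k)$. Formal derivatives on $T^t_nX$: $d_i=\sum_{|J|\le t-1}x^A_{iJ}\partial^J_A$; they commute and $d_J=\prod_{j\in J}d_j$. Lie–Euler operators on functions $f$ of order $s$: $\mathcal{E}^I_A(f)=\sum_{|J|\le s-|I|}(-1)^{|J|}\binom{|I|+|J|}{|I|}d_J\partial^{IJ}_Af$, $|I|\le s$. *)

theory Defs
  imports "HOL-Analysis.Analysis" "HOL-Analysis.Finite_Function_Topology" "HOL-Library.Multiset"
begin

section \<open>Smooth functions\<close>

definition dir_deriv ::
  "'v::real_normed_vector \<Rightarrow> ('v \<Rightarrow> 'w::real_normed_vector) \<Rightarrow> 'v \<Rightarrow> 'w" where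
  "dir_deriv b f x = vector_derivative (\<lambda>h. f (x + h *\<^sub>R b)) (at 0)"

text \<open>
  \<open>D\<close> is a basis of a finite-dimensional coordinate space \<open>span D\<close>, and \<open>U\<close> is meant to be
  (relatively) open in it. The set \<open>D\<close> is a parameter because the coordinate spaces of
  velocities have a dimension depending on the order, which is a term and not a type; they are
  subspaces of one space of finitely supported functions. On a Euclidean space, \<open>D = Basis\<close>.
\<close>

primrec Ck_on ::
  "nat \<Rightarrow> 'v set \<Rightarrow> 'v set \<Rightarrow> ('v::real_normed_vector \<Rightarrow> 'w::real_normed_vector) \<Rightarrow> bool" where
  "Ck_on 0 D U f \<longleftrightarrow> continuous_on U f"
| "Ck_on (Suc k) D U f \<longleftrightarrow> continuous_on U f \<and>
     (\<forall>b\<in>D. (\<forall>x\<in>U. (\<lambda>h. f (x + h *\<^sub>R b)) differentiable (at (0::real))) \<and>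
             Ck_on k D U (dir_deriv b f))"

definition smooth_on ::
  "'v set \<Rightarrow> 'v set \<Rightarrow> ('v::real_normed_vector \<Rightarrow> 'w::real_normed_vector) \<Rightarrow> bool" where
  "smooth_on D U f \<longleftrightarrow> (\<forall>k. Ck_on k D U f)"

definition iter_partial ::
  "'n list \<Rightarrow> (real ^ 'n::finite \<Rightarrow> real) \<Rightarrow> real ^ 'n \<Rightarrow> real" where
  "iter_partial J f = foldr (\<lambda>j. dir_deriv (axis j 1)) J f"


section \<open>Smooth manifolds\<close>

text \<open>A chart is a pair \<open>(V, \<phi>)\<close>; the values of \<open>\<phi>\<close> outside \<open>V\<close> are irrelevant.\<close>

type_synonym ('a, 'N) chart = "'a set \<times> ('a \<Rightarrow> real ^ 'N)"

definition is_chart :: "'a topology \<Rightarrow> ('a, 'N::finite) chart \<Rightarrow> bool" where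
  "is_chart X c \<longleftrightarrow> openin X (fst c) \<and> open (snd c ` fst c) \<and>
     homeomorphic_map (subtopology X (fst c)) (top_of_set (snd c ` fst c)) (snd c)"

definition compatible :: "('a, 'N::finite) chart \<Rightarrow> ('a, 'N) chart \<Rightarrow> bool" where
  "compatible c c' \<longleftrightarrow>
     smooth_on Basis (snd c ` (fst c \<inter> fst c')) (snd c' \<circ> inv_into (fst c) (snd c)) \<and>
     smooth_on Basis (snd c' ` (fst c \<inter> fst c')) (snd c \<circ> inv_into (fst c') (snd c'))"

text \<open>The smooth structure is given by its maximal atlas, so "any chart of \<open>X\<close>" is "any element
  of \<open>\<A>\<close>".\<close>

definition smooth_manifold :: "'a topology \<Rightarrow> ('a, 'N::finite) chart set \<Rightarrow> bool" where
  "smooth_manifold X \<A> \<longleftrightarrow> Hausdorff_space X \<and> second_countable X \<and>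
     (\<forall>c\<in>\<A>. is_chart X c) \<and> (\<Union>c\<in>\<A>. fst c) = topspace X \<and>
     (\<forall>c\<in>\<A>. \<forall>c'\<in>\<A>. compatible c c') \<and>
     (\<forall>c. is_chart X c \<and> (\<forall>c'\<in>\<A>. compatible c c') \<longrightarrow> c \<in> \<A>)"


section \<open>Velocities\<close>

text \<open>
  Smooth maps into the manifold from a neighbourhood of \<open>0\<close>, which may be shrunk so that the map
  takes values in one chart. If \<open>imm\<close> holds, only maps that are immersive at \<open>0\<close> (equivalently,
  near \<open>0\<close>) are admitted. The values of the map away from \<open>0\<close> are irrelevant.
\<close>

definition velocity_germs ::
  "('a, 'N::finite) chart set \<Rightarrow> bool \<Rightarrow> (real ^ 'n::finite \<Rightarrow> 'a) set" where
  "velocity_germs \<A> imm =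
     {\<gamma>. \<exists>c\<in>\<A>. \<exists>U. open U \<and> 0 \<in> U \<and> \<gamma> ` U \<subseteq> fst c \<and> smooth_on Basis U (snd c \<circ> \<gamma>) \<and>
          (imm \<longrightarrow> inj (frechet_derivative (snd c \<circ> \<gamma>) (at 0)))}"

definition jet ::
  "('a, 'N::finite) chart set \<Rightarrow> bool \<Rightarrow> nat \<Rightarrow> (real ^ 'n::finite \<Rightarrow> 'a) \<Rightarrow> (real ^ 'n \<Rightarrow> 'a) set" where
  "jet \<A> imm s \<gamma> =
     {\<delta> \<in> velocity_germs \<A> imm. \<delta> 0 = \<gamma> 0 \<and>
        (\<forall>c\<in>\<A>. \<gamma> 0 \<in> fst c \<longrightarrow>
           (\<forall>A J. length J \<le> s \<longrightarrow>
              iter_partial J (\<lambda>u. snd c (\<delta> u) $ A) 0 = iter_partial J (\<lambda>u. snd c (\<gamma> u) $ A) 0))}"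

type_synonym ('a, 'n) velocity = "(real ^ 'n \<Rightarrow> 'a) set"

definition velocities ::
  "('a, 'N::finite) chart set \<Rightarrow> bool \<Rightarrow> nat \<Rightarrow> ('a, 'n::finite) velocity set" where
  "velocities \<A> imm s = jet \<A> imm s ` velocity_germs \<A> imm"

definition velocity_proj ::
  "('a, 'N::finite) chart set \<Rightarrow> bool \<Rightarrow> nat \<Rightarrow> ('a, 'n::finite) velocity \<Rightarrow> ('a, 'n) velocity" where
  "velocity_proj \<A> imm s p = jet \<A> imm s (SOME \<gamma>. \<gamma> \<in> p)"

text \<open>Domain \<open>V\<^sup>s\<close> of the induced chart, and the coordinate functions \<open>x\<^sup>A\<^sub>J\<close>.\<close>

definition vdom ::
  "('a, 'N::finite) chart set \<Rightarrow> bool \<Rightarrow> nat \<Rightarrow> ('a, 'N) chart \<Rightarrow> ('a, 'n::finite) velocity set" where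
  "vdom \<A> imm s c = {p \<in> velocities \<A> imm s. \<forall>\<gamma>\<in>p. \<gamma> 0 \<in> fst c}"

definition vcoord ::
  "('a, 'N::finite) chart \<Rightarrow> 'N \<Rightarrow> 'n list \<Rightarrow> ('a, 'n::finite) velocity \<Rightarrow> real" where
  "vcoord c A J p = iter_partial J (\<lambda>u. snd c ((SOME \<gamma>. \<gamma> \<in> p) u) $ A) 0"

text \<open>
  Since \<open>x\<^sup>A\<^sub>J\<close> is symmetric in \<open>J\<close>, the independent coordinates are indexed by multisets of size
  at most the order: a point of the coordinate space is a finitely supported function of such
  indices, and the choice of an ordering of the multiset is immaterial.
\<close>

type_synonym ('N, 'n) vcoords = "('N \<times> 'n multiset) \<Rightarrow>\<^sub>0 real"

definition vchart ::
  "nat \<Rightarrow> ('a, 'N::finite) chart \<Rightarrow> ('a, 'n::finite) velocity \<Rightarrow> ('N, 'n) vcoords" where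
  "vchart s c p = Abs_poly_mapping
     (\<lambda>(A, M). if size M \<le> s then vcoord c A (SOME J. mset J = M) p else 0)"

definition vbasis :: "nat \<Rightarrow> ('N, 'n) vcoords set" where
  "vbasis s = {Poly_Mapping.single (A, M) 1 | A M. size M \<le> s}"

definition local_rep ::
  "('a, 'N::finite) chart set \<Rightarrow> bool \<Rightarrow> nat \<Rightarrow> ('a, 'N) chart \<Rightarrow> (('a, 'n::finite) velocity \<Rightarrow> real)
     \<Rightarrow> ('N, 'n) vcoords \<Rightarrow> real" where
  "local_rep \<A> imm s c f = f \<circ> inv_into (vdom \<A> imm s c) (vchart s c)"

definition vsmooth_on ::
  "('a, 'N::finite) chart set \<Rightarrow> bool \<Rightarrow> nat \<Rightarrow> ('a, 'N) chart \<Rightarrow> ('a, 'n::finite) velocity set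
     \<Rightarrow> (('a, 'n) velocity \<Rightarrow> real) \<Rightarrow> bool" where
  "vsmooth_on \<A> imm s c W f \<longleftrightarrow> smooth_on (vbasis s) (vchart s c ` W) (local_rep \<A> imm s c f)"


section \<open>Tangent vectors and differential forms on the velocity manifold\<close>

definition vsmooth_at ::
  "('a, 'N::finite) chart set \<Rightarrow> bool \<Rightarrow> nat \<Rightarrow> ('a, 'n::finite) velocity
     \<Rightarrow> (('a, 'n) velocity \<Rightarrow> real) \<Rightarrow> bool" where
  "vsmooth_at \<A> imm s p f \<longleftrightarrow>
     (\<exists>c\<in>\<A>. \<exists>W \<subseteq> vdom \<A> imm s c. p \<in> W \<and>
        openin (top_of_set (span (vbasis s))) (vchart s c ` W) \<and> vsmooth_on \<A> imm s c W f)"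

definition smooth_curve ::
  "('a, 'N::finite) chart set \<Rightarrow> bool \<Rightarrow> nat \<Rightarrow> (real \<Rightarrow> ('a, 'n::finite) velocity) \<Rightarrow> bool" where
  "smooth_curve \<A> imm s \<kappa> \<longleftrightarrow>
     (\<exists>c\<in>\<A>. \<exists>\<epsilon>>0. \<kappa> ` {-\<epsilon><..<\<epsilon>} \<subseteq> vdom \<A> imm s c \<and>
        smooth_on Basis {-\<epsilon><..<\<epsilon>} (vchart s c \<circ> \<kappa>))"

text \<open>
  Tangent vectors at \<open>p\<close> are the operators of differentiation along smooth curves through \<open>p\<close>,
  acting on functions that are smooth near \<open>p\<close>. The value \<open>0\<close> on other functions is a dummy that
  makes the operator determined by its action on smooth functions. The vector space structure is
  pointwise.
\<close>

type_synonym ('a, 'n) tangent = "(('a, 'n) velocity \<Rightarrow> real) \<Rightarrow> real"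

definition tangent_space ::
  "('a, 'N::finite) chart set \<Rightarrow> bool \<Rightarrow> nat \<Rightarrow> ('a, 'n::finite) velocity \<Rightarrow> ('a, 'n) tangent set" where
  "tangent_space \<A> imm s p =
     {(\<lambda>f. if vsmooth_at \<A> imm s p f then vector_derivative (f \<circ> \<kappa>) (at 0) else 0) | \<kappa>.
        smooth_curve \<A> imm s \<kappa> \<and> \<kappa> 0 = p}"

definition differential :: "(('a, 'n::finite) velocity \<Rightarrow> real) \<Rightarrow> ('a, 'n) tangent \<Rightarrow> real" where
  "differential f v = v f"

definition wedge :: "('v \<Rightarrow> real) \<Rightarrow> ('v \<Rightarrow> real) \<Rightarrow> 'v \<Rightarrow> 'v \<Rightarrow> real" where
  "wedge \<alpha> \<beta> v w = \<alpha> v * \<beta> w - \<alpha> w * \<beta> v"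

definition linear_on_tangent :: "('a, 'n::finite) tangent set \<Rightarrow> (('a, 'n) tangent \<Rightarrow> real) \<Rightarrow> bool" where
  "linear_on_tangent T \<alpha> \<longleftrightarrow>
     (\<forall>v\<in>T. \<forall>w\<in>T. \<forall>a b. \<alpha> (\<lambda>f. a * v f + b * w f) = a * \<alpha> v + b * \<alpha> w)"

text \<open>Forms are families of (multi)linear maps on the tangent spaces whose components in every
  induced chart are smooth; their values on non-tangent arguments are irrelevant.\<close>

definition one_form ::
  "('a, 'N::finite) chart set \<Rightarrow> bool \<Rightarrow> nat
     \<Rightarrow> (('a, 'n::finite) velocity \<Rightarrow> ('a, 'n) tangent \<Rightarrow> real) \<Rightarrow> bool" where
  "one_form \<A> imm s \<omega> \<longleftrightarrow>
     (\<forall>p \<in> velocities \<A> imm s. linear_on_tangent (tangent_space \<A> imm s p) (\<omega> p)) \<and>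
     (\<forall>c\<in>\<A>. \<exists>a. (\<forall>A J. vsmooth_on \<A> imm s c (vdom \<A> imm s c) (a A J)) \<and>
        (\<forall>p \<in> vdom \<A> imm s c. \<forall>v \<in> tangent_space \<A> imm s p.
           \<omega> p v = (\<Sum>A\<in>UNIV. \<Sum>J | length J \<le> s. a A J p * differential (vcoord c A J) v)))"

definition two_form ::
  "('a, 'N::finite) chart set \<Rightarrow> bool \<Rightarrow> nat
     \<Rightarrow> (('a, 'n::finite) velocity \<Rightarrow> ('a, 'n) tangent \<Rightarrow> ('a, 'n) tangent \<Rightarrow> real) \<Rightarrow> bool" where
  "two_form \<A> imm s \<omega> \<longleftrightarrow>
     (\<forall>p \<in> velocities \<A> imm s. \<forall>v \<in> tangent_space \<A> imm s p.
        linear_on_tangent (tangent_space \<A> imm s p) (\<lambda>w. \<omega> p v w) \<and>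
        linear_on_tangent (tangent_space \<A> imm s p) (\<lambda>w. \<omega> p w v) \<and>
        \<omega> p v v = 0) \<and>
     (\<forall>c\<in>\<A>. \<exists>b. (\<forall>A I B J. vsmooth_on \<A> imm s c (vdom \<A> imm s c) (b A I B J)) \<and>
        (\<forall>p \<in> vdom \<A> imm s c. \<forall>v \<in> tangent_space \<A> imm s p. \<forall>w \<in> tangent_space \<A> imm s p.
           \<omega> p v w =
             (\<Sum>A\<in>UNIV. \<Sum>I | length I \<le> s. \<Sum>B\<in>UNIV. \<Sum>J | length J \<le> s.
                b A I B J p * wedge (differential (vcoord c A I)) (differential (vcoord c B J)) v w)))"

definition has_local_form ::
  "('a, 'N::finite) chart set \<Rightarrow> bool \<Rightarrow> nat
     \<Rightarrow> (('a, 'n::finite) velocity \<Rightarrow> ('a, 'n) tangent \<Rightarrow> real)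
     \<Rightarrow> ('a, 'N) chart \<Rightarrow> ('N \<Rightarrow> ('a, 'n) velocity \<Rightarrow> real) \<Rightarrow> bool" where
  "has_local_form \<A> imm s \<T> c T \<longleftrightarrow>
     (\<forall>A. vsmooth_on \<A> imm s c (vdom \<A> imm s c) (T A)) \<and>
     (\<forall>p \<in> vdom \<A> imm s c. \<forall>v \<in> tangent_space \<A> imm s p.
        \<T> p v = (\<Sum>A\<in>UNIV. T A p * differential (vcoord c A []) v))"

definition differential_equation ::
  "('a, 'N::finite) chart set \<Rightarrow> bool \<Rightarrow> nat
     \<Rightarrow> (('a, 'n::finite) velocity \<Rightarrow> ('a, 'n) tangent \<Rightarrow> real) \<Rightarrow> bool" where
  "differential_equation \<A> imm s \<T> \<longleftrightarrow>
     one_form \<A> imm s \<T> \<and> (\<forall>c\<in>\<A>. \<exists>T. has_local_form \<A> imm s \<T> c T)"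


section \<open>Formal derivatives and Lie--Euler operators\<close>

text \<open>
  All operators act on functions on velocities of the fixed order \<open>t\<close>, in the induced chart of
  \<open>c\<close>. They are meaningful at points of \<open>vdom \<A> imm t c\<close> only.
\<close>

definition vpartial ::
  "('a, 'N::finite) chart set \<Rightarrow> bool \<Rightarrow> nat \<Rightarrow> ('a, 'N) chart \<Rightarrow> 'N \<Rightarrow> 'n list
     \<Rightarrow> (('a, 'n::finite) velocity \<Rightarrow> real) \<Rightarrow> ('a, 'n) velocity \<Rightarrow> real" where
  "vpartial \<A> imm t c A J f p =
     (\<Prod>l\<in>UNIV. fact (count (mset J) l)) / fact (length J) *
     dir_deriv (Poly_Mapping.single (A, mset J) 1) (local_rep \<A> imm t c f) (vchart t c p)"

definition formal_deriv ::
  "('a, 'N::finite) chart set \<Rightarrow> bool \<Rightarrow> nat \<Rightarrow> ('a, 'N) chart \<Rightarrow> 'n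
     \<Rightarrow> (('a, 'n::finite) velocity \<Rightarrow> real) \<Rightarrow> ('a, 'n) velocity \<Rightarrow> real" where
  "formal_deriv \<A> imm t c i f p =
     (\<Sum>A\<in>UNIV. \<Sum>J | length J \<le> t - 1. vcoord c A (i # J) p * vpartial \<A> imm t c A J f p)"

definition formal_derivs ::
  "('a, 'N::finite) chart set \<Rightarrow> bool \<Rightarrow> nat \<Rightarrow> ('a, 'N) chart \<Rightarrow> 'n list
     \<Rightarrow> (('a, 'n::finite) velocity \<Rightarrow> real) \<Rightarrow> ('a, 'n) velocity \<Rightarrow> real" where
  "formal_derivs \<A> imm t c J f = foldr (formal_deriv \<A> imm t c) J f"

text \<open>The Lie--Euler operators on functions of order \<open>s\<close>, regarded as functions of order \<open>t\<close>.\<close>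

definition lie_euler ::
  "('a, 'N::finite) chart set \<Rightarrow> bool \<Rightarrow> nat \<Rightarrow> ('a, 'N) chart \<Rightarrow> nat \<Rightarrow> 'n list \<Rightarrow> 'N
     \<Rightarrow> (('a, 'n::finite) velocity \<Rightarrow> real) \<Rightarrow> ('a, 'n) velocity \<Rightarrow> real" where
  "lie_euler \<A> imm t c s I A f p =
     (\<Sum>J | length J \<le> s - length I.
        (-1) ^ length J * real ((length I + length J) choose length I) *
        formal_derivs \<A> imm t c J (vpartial \<A> imm t c A (I @ J) f) p)"

definition helmholtz ::
  "('a, 'N::finite) chart set \<Rightarrow> bool \<Rightarrow> nat \<Rightarrow> ('a, 'N) chart \<Rightarrow> nat
     \<Rightarrow> ('N \<Rightarrow> ('a, 'n::finite) velocity \<Rightarrow> real)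
     \<Rightarrow> 'n list \<Rightarrow> 'N \<Rightarrow> 'N \<Rightarrow> ('a, 'n) velocity \<Rightarrow> real" where
  "helmholtz \<A> imm t c s T J A B p =
     vpartial \<A> imm t c B J (T A \<circ> velocity_proj \<A> imm s) p -
     (-1) ^ length J * lie_euler \<A> imm t c s J A (T B \<circ> velocity_proj \<A> imm s) p"

end

theory Submission
  imports Defs "HOL-Combinatorics.Multiset_Permutations"
begin

text \<open>
  The linearization of \<open>\<T>\<close> along a germ \<open>\<gamma>\<close> is the differential operator
  \<open>(D \<xi>)\<^sub>A = \<Sum> \<partial>\<^sup>J\<^sub>B T\<^sub>A \<cdot> \<partial>\<^sub>J \<xi>\<^sup>B\<close>, and the Lie--Euler operators give the coefficients of its
  formal adjoint \<open>D\<^sup>*\<close>, because formal derivatives become ordinary partial derivatives along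
  \<open>\<gamma>\<close>. Hence \<open>\<Sum> \<H>\<^sup>J\<^sub>A\<^sub>B \<partial>\<^sub>J \<xi>\<^sup>B = (D \<xi> - D\<^sup>* \<xi>)\<^sub>A\<close>, and the Helmholtz form is the alternation of
  \<open>\<Sum> \<eta>\<^sup>A (D \<xi> - D\<^sup>* \<xi>)\<^sub>A\<close>, evaluated on vector fields \<open>\<xi>\<close>, \<open>\<eta>\<close> along \<open>\<gamma>\<close> that represent the
  two tangent vectors. A change of charts with Jacobian matrix \<open>M\<close> along \<open>\<gamma>\<close> turns \<open>D\<close> into
  \<open>M\<^sup>T D M + S\<close>, where \<open>S\<close> has order zero and is symmetric, since it stems from the second
  derivatives of the transition map. The adjoint is \<open>M\<^sup>T D\<^sup>* M + S\<close>, so \<open>D - D\<^sup>*\<close> transforms as a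
  tensor.
\<close>

section \<open>Differential calculus along a finite set of directions\<close>

text \<open>Vector fields along \<open>\<gamma>\<close> arise because a tangent vector at a velocity
  is given only by a curve of velocities. Adding Taylor polynomials in coordinates lifts this curve
  to a curve of germs; its parameter derivative \<open>\<xi>\<close> satisfies
  \<open>v (vcoord c B J) = iter_partial J (\<xi> B) 0\<close>. The adjoint differentiates the
  coefficients of \<open>D\<close>, so the transformation rule is needed along the germ near 0 and
  not just at one velocity; it results from applying the pointwise rule to the translated germs.
  That rule is found for operators, and passing to coefficients rests on their symmetry in the
  multi-index, since sums run over sequences. The bound \<open>2 * s < t\<close> leaves room for up
  to \<open>s\<close> formal derivatives of functions of order \<open>s\<close>: the formal
  derivative is truncated, and it is identified with differentiation along a germ for functions of
  order below \<open>t\<close>. The coordinates of velocities span a finite-dimensional subspace of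
  an infinite-dimensional space, so the calculus is built from directional derivatives along
  finitely many directions.\<close>

text \<open>Openness relative to the directions in \<open>D\<close>: this covers both open subsets of a Euclidean
  space and relatively open subsets of the coordinate spaces of velocities.\<close>

definition open_along :: "'v::real_normed_vector set \<Rightarrow> 'v set \<Rightarrow> bool" where
  "open_along D U \<longleftrightarrow> (\<forall>x\<in>U. \<exists>e>0. \<forall>y. y - x \<in> span D \<longrightarrow> norm (y - x) < e \<longrightarrow> y \<in> U)"

lemma open_alongD:
  assumes "open_along D U" "x \<in> U"
  obtains e where "e > 0" "\<And>y. y - x \<in> span D \<Longrightarrow> norm (y - x) < e \<Longrightarrow> y \<in> U"
  using assms unfolding open_along_def by blast

lemma open_along_open: "open U \<Longrightarrow> open_along D U"
  unfolding open_along_def open_dist by (metis dist_norm)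

lemma openin_open_along:
  assumes "open_along D U" "U \<subseteq> span D"
  shows "openin (top_of_set (span D)) U"
  unfolding openin_euclidean_subtopology_iff
proof (intro conjI ballI)
  fix x assume x: "x \<in> U"
  obtain e where e: "e > 0" "\<And>y. y - x \<in> span D \<Longrightarrow> norm (y - x) < e \<Longrightarrow> y \<in> U"
    using open_alongD[OF assms(1) x] by blast
  have "y \<in> U" if "y \<in> span D" "dist y x < e" for y
    using e(2)[of y] that x assms(2) span_diff[of y D x] by (auto simp: dist_norm)
  then show "\<exists>e>0. \<forall>x'\<in>span D. dist x' x < e \<longrightarrow> x' \<in> U"
    using e(1) by blast
qed (use assms in auto)

lemma open_along_line:
  assumes "open_along D U" "x \<in> U" "b \<in> D"
  shows "eventually (\<lambda>h. x + h *\<^sub>R b \<in> U) (nhds (0::real))"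
proof -
  obtain e where e: "e > 0" "\<And>y. y - x \<in> span D \<Longrightarrow> norm (y - x) < e \<Longrightarrow> y \<in> U"
    using open_alongD[OF assms(1,2)] by blast
  have "((\<lambda>h::real. norm (h *\<^sub>R b)) \<longlongrightarrow> norm (0 *\<^sub>R b)) (nhds 0)"
    by (intro tendsto_intros) (simp add: filterlim_ident)
  then have "eventually (\<lambda>h::real. norm (h *\<^sub>R b) < e) (nhds 0)"
    using e(1) by (intro order_tendstoD(2)[where y="norm (0 *\<^sub>R b)"]) auto
  then show ?thesis
  proof eventually_elim
    case (elim h)
    show ?case
      by (rule e(2)) (use elim assms(3) in \<open>auto intro: span_base span_scale\<close>)
  qed
qed

section \<open>Directional derivatives\<close>

abbreviation has_dir_deriv ::
  "'v::real_normed_vector \<Rightarrow> ('v \<Rightarrow> 'w::real_normed_vector) \<Rightarrow> 'v \<Rightarrow> 'w \<Rightarrow> bool" where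
  "has_dir_deriv b f x d \<equiv> ((\<lambda>h. f (x + h *\<^sub>R b)) has_vector_derivative d) (at 0)"

lemma dir_deriv_eq: "has_dir_deriv b f x d \<Longrightarrow> dir_deriv b f x = d"
  unfolding dir_deriv_def by (rule vector_derivative_at)

lemma differentiable_iff_has_dir_deriv:
  "(\<lambda>h. f (x + h *\<^sub>R b)) differentiable (at (0::real)) \<longleftrightarrow> has_dir_deriv b f x (dir_deriv b f x)"
  unfolding dir_deriv_def vector_derivative_works ..

text \<open>The filter is \<open>nhds x\<close> and not \<open>at x\<close>, because the value at
  the point itself enters the difference quotient.\<close>

lemma has_vector_derivative_cong_nhds:
  assumes "eventually (\<lambda>h. f h = g h) (nhds x)"
  shows "(f has_vector_derivative d) (at x) \<longleftrightarrow> (g has_vector_derivative d) (at x)"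
  using assms by (intro has_vector_derivative_cong_ev)
    (auto intro: eventually_nhds_x_imp_x elim: eventually_mono)

lemma vector_derivative_cong_nhds:
  assumes "eventually (\<lambda>h. f h = g h) (nhds x)"
  shows "vector_derivative f (at x) = vector_derivative g (at x)"
  unfolding vector_derivative_def has_vector_derivative_cong_nhds[OF assms] ..

lemma dir_deriv_cong_on:
  assumes "open_along D U" "b \<in> D" "x \<in> U" "\<And>y. y \<in> U \<Longrightarrow> f y = g y"
  shows "has_dir_deriv b f x d \<longleftrightarrow> has_dir_deriv b g x d" "dir_deriv b f x = dir_deriv b g x"
proof -
  have *: "eventually (\<lambda>h. f (x + h *\<^sub>R b) = g (x + h *\<^sub>R b)) (nhds 0)"
    using open_along_line[OF assms(1,3,2)] by eventually_elim (rule assms(4))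
  show "has_dir_deriv b f x d \<longleftrightarrow> has_dir_deriv b g x d"
    by (rule has_vector_derivative_cong_nhds[OF *])
  show "dir_deriv b f x = dir_deriv b g x"
    unfolding dir_deriv_def by (rule vector_derivative_cong_nhds[OF *])
qed

section \<open>Closure properties of the classes C^k\<close>

lemma Ck_on_continuous: "Ck_on k D U f \<Longrightarrow> continuous_on U f"
  by (cases k) auto

lemma Ck_on_has_dir_deriv:
  assumes "Ck_on (Suc k) D U f" "b \<in> D" "x \<in> U"
  shows "has_dir_deriv b f x (dir_deriv b f x)"
  using assms by (intro differentiable_iff_has_dir_deriv[THEN iffD1]) auto

lemma Ck_on_cong:
  assumes "open_along D U" "\<And>x. x \<in> U \<Longrightarrow> f x = g x" "Ck_on k D U f"
  shows "Ck_on k D U g"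
  using assms(2,3)
proof (induction k arbitrary: f g)
  case 0
  then show ?case by (simp cong: continuous_on_cong)
next
  case (Suc k)
  have "continuous_on U g"
    using Suc.prems by (auto cong: continuous_on_cong)
  moreover have "(\<lambda>h. g (x + h *\<^sub>R b)) differentiable (at (0::real))" if "b \<in> D" "x \<in> U" for b x
  proof -
    have "has_dir_deriv b g x (dir_deriv b f x)"
      using Ck_on_has_dir_deriv[OF Suc.prems(2) that] dir_deriv_cong_on(1)[OF assms(1) that, of f g] Suc.prems(1)
      by simp
    then show ?thesis by (rule differentiableI_vector)
  qed
  moreover have "Ck_on k D U (dir_deriv b g)" if "b \<in> D" for b
    using Suc.IH[of "dir_deriv b f" "dir_deriv b g"] Suc.prems that
      dir_deriv_cong_on(2)[OF assms(1) that _ Suc.prems(1)] by auto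
  ultimately show ?case by simp
qed

text \<open>\<open>Ck_on\<close> refers to the operator \<open>dir_deriv b f\<close> itself. A
  formula \<open>f' b\<close> known on \<open>U\<close> can replace it, because openness along
  \<open>D\<close> makes directional derivatives on \<open>U\<close> depend on values in
  \<open>U\<close> only. The inductions below supply such formulas: sum rule, product rule, chain
  rule.\<close>

lemma Ck_on_SucI:
  assumes "open_along D U" "continuous_on U f" "\<And>b. b \<in> D \<Longrightarrow> Ck_on k D U (f' b)"
    "\<And>b x. b \<in> D \<Longrightarrow> x \<in> U \<Longrightarrow> has_dir_deriv b f x (f' b x)"
  shows "Ck_on (Suc k) D U f"
proof -
  have "Ck_on k D U (dir_deriv b f)" if "b \<in> D" for b
    by (rule Ck_on_cong[OF assms(1) _ assms(3)[OF that]]) (simp add: dir_deriv_eq[OF assms(4)[OF that]])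
  moreover have "(\<lambda>h. f (x + h *\<^sub>R b)) differentiable (at (0::real))" if "b \<in> D" "x \<in> U" for b x
    using assms(4)[OF that] differentiableI_vector by blast
  ultimately show ?thesis
    using assms(2) by auto
qed

lemma Ck_on_Suc_imp: "Ck_on (Suc k) D U f \<Longrightarrow> Ck_on k D U f"
  by (induction k arbitrary: f) auto

lemma Ck_on_subset: "Ck_on k D U f \<Longrightarrow> V \<subseteq> U \<Longrightarrow> Ck_on k D V f"
  by (induction k arbitrary: f) (auto intro: continuous_on_subset)

lemma Ck_on_const: "open_along D U \<Longrightarrow> Ck_on k D U (\<lambda>x. c)"
proof (induction k arbitrary: c)
  case (Suc k)
  show ?case
    by (rule Ck_on_SucI[where f'="\<lambda>b x. 0"]) (use Suc in auto)
qed simp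

lemma Ck_on_bounded_linear:
  assumes "bounded_linear L" "open_along D U" "Ck_on k D U f"
  shows "Ck_on k D U (\<lambda>x. L (f x))"
  using assms(3)
proof (induction k arbitrary: f)
  case 0
  then show ?case
    by (simp add: bounded_linear.continuous_on[OF assms(1)])
next
  case (Suc k)
  show ?case
  proof (rule Ck_on_SucI[where f'="\<lambda>b x. L (dir_deriv b f x)"])
    show "continuous_on U (\<lambda>x. L (f x))"
      using Suc.prems by (auto intro: bounded_linear.continuous_on[OF assms(1)])
    fix b x assume "b \<in> D" "x \<in> U"
    from bounded_linear.has_vector_derivative[OF assms(1) Ck_on_has_dir_deriv[OF Suc.prems this]]
    show "has_dir_deriv b (\<lambda>x. L (f x)) x (L (dir_deriv b f x))" .
  qed (use Suc assms in auto)
qed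

lemma Ck_on_add:
  assumes "open_along D U" "Ck_on k D U f" "Ck_on k D U g"
  shows "Ck_on k D U (\<lambda>x. f x + g x)"
  using assms(2,3)
proof (induction k arbitrary: f g)
  case (Suc k)
  show ?case
  proof (rule Ck_on_SucI[where f'="\<lambda>b x. dir_deriv b f x + dir_deriv b g x"])
    show "continuous_on U (\<lambda>x. f x + g x)"
      using Suc.prems by (auto intro: continuous_on_add)
    fix b x assume "b \<in> D" "x \<in> U"
    then show "has_dir_deriv b (\<lambda>x. f x + g x) x (dir_deriv b f x + dir_deriv b g x)"
      by (intro has_vector_derivative_add Ck_on_has_dir_deriv[OF Suc.prems(1)] Ck_on_has_dir_deriv[OF Suc.prems(2)])
  qed (use Suc assms in auto)
qed (auto intro: continuous_on_add)

lemma Ck_on_sum: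
  assumes "open_along D U" "\<And>i. i \<in> I \<Longrightarrow> Ck_on k D U (f i)"
  shows "Ck_on k D U (\<lambda>x. \<Sum>i\<in>I. f i x)"
  using assms(2) by (induction I rule: infinite_finite_induct)
    (auto intro: Ck_on_const Ck_on_add assms(1))

lemma Ck_on_scaleR:
  assumes "open_along D U" "Ck_on k D U f" "Ck_on k D U g"
  shows "Ck_on k D U (\<lambda>x. f x *\<^sub>R g x)"
  using assms(2,3)
proof (induction k arbitrary: f g)
  case 0
  then show ?case by (auto intro: continuous_on_scaleR)
next
  case (Suc k)
  show ?case
  proof (rule Ck_on_SucI[where f'="\<lambda>b x. f x *\<^sub>R dir_deriv b g x + dir_deriv b f x *\<^sub>R g x"])
    show "continuous_on U (\<lambda>x. f x *\<^sub>R g x)"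
      using Suc.prems by (auto intro: continuous_on_scaleR)
    show "Ck_on k D U (\<lambda>x. f x *\<^sub>R dir_deriv b g x + dir_deriv b f x *\<^sub>R g x)" if "b \<in> D" for b
      using Suc that assms(1) by (auto intro!: Ck_on_add Suc.IH intro: Ck_on_Suc_imp)
    fix b x assume bx: "b \<in> D" "x \<in> U"
    have "((\<lambda>h. f (x + h *\<^sub>R b)) has_real_derivative dir_deriv b f x) (at 0)"
      using Ck_on_has_dir_deriv[OF Suc.prems(1) bx] by (simp add: has_real_derivative_iff_has_vector_derivative)
    from has_vector_derivative_scaleR[OF this Ck_on_has_dir_deriv[OF Suc.prems(2) bx]]
    show "has_dir_deriv b (\<lambda>x. f x *\<^sub>R g x) x (f x *\<^sub>R dir_deriv b g x + dir_deriv b f x *\<^sub>R g x)"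
      by simp
  qed (use assms in auto)
qed

text \<open>Moves from \<open>y0\<close> along one direction of \<open>E\<close> at a time. On each
  segment the mean value inequality applies, and continuity at \<open>y0\<close> keeps the
  directional derivatives within \<open>e\<close> of their values there, so the errors add up to
  \<open>e\<close> times the sum of the absolute coefficients.\<close>

lemma directional_expansion:
  fixes g :: "'v::real_normed_vector \<Rightarrow> 'w::real_normed_vector"
  assumes "finite E" "open_along E W" "Ck_on (Suc 0) E W g" "y0 \<in> W" "e > 0"
  obtains d where "d > 0" "\<And>r. (\<And>b. b \<in> E \<Longrightarrow> \<bar>r b\<bar> < d) \<Longrightarrow>
     norm (g (y0 + (\<Sum>b\<in>E. r b *\<^sub>R b)) - g y0 - (\<Sum>b\<in>E. r b *\<^sub>R dir_deriv b g y0)) \<le> e * (\<Sum>b\<in>E. \<bar>r b\<bar>)"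
proof -
  obtain e0 where e0: "e0 > 0" "\<And>y. y - y0 \<in> span E \<Longrightarrow> norm (y - y0) < e0 \<Longrightarrow> y \<in> W"
    using open_alongD[OF assms(2,4)] by blast
  have "\<forall>b\<in>E. \<exists>\<eta>>0. \<forall>z\<in>W. dist z y0 < \<eta> \<longrightarrow> dist (dir_deriv b g z) (dir_deriv b g y0) < e"
    using assms(3,4,5) by (auto simp: continuous_on_iff)
  then obtain \<eta> where \<eta>: "\<And>b. b \<in> E \<Longrightarrow> \<eta> b > 0"
    "\<And>b z. b \<in> E \<Longrightarrow> z \<in> W \<Longrightarrow> dist z y0 < \<eta> b \<Longrightarrow> dist (dir_deriv b g z) (dir_deriv b g y0) < e"
    by metis
  define m where "m = Min (insert e0 (\<eta> ` E))"
  have m: "m > 0" "m \<le> e0" "\<And>b. b \<in> E \<Longrightarrow> m \<le> \<eta> b"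
    using \<eta>(1) e0(1) assms(1) by (auto simp: m_def)
  \<comment> \<open>Coefficients of size at most \<open>m / K\<close> give an increment of norm
    below \<open>m\<close>; the summand 1 makes this bound strict and \<open>K\<close>
    positive.\<close>
  define K where "K = 1 + (\<Sum>b\<in>E. norm b)"
  have K: "K > 0" unfolding K_def by (simp add: add_pos_nonneg sum_nonneg)
  define d where "d = m / K"
  have d: "d > 0" using m(1) K by (simp add: d_def)
  have small: "norm (\<Sum>b\<in>F. r b *\<^sub>R b) < m" if F: "F \<subseteq> E" and r: "\<And>b. b \<in> F \<Longrightarrow> \<bar>r b\<bar> \<le> d" for F r
  proof -
    have "norm (\<Sum>b\<in>F. r b *\<^sub>R b) \<le> (\<Sum>b\<in>F. \<bar>r b\<bar> * norm b)"
      by (rule order_trans[OF norm_sum]) simp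
    also have "\<dots> \<le> (\<Sum>b\<in>F. d * norm b)"
      using r by (intro sum_mono mult_right_mono) auto
    also have "\<dots> \<le> (\<Sum>b\<in>E. d * norm b)"
      using F d assms(1) by (intro sum_mono2) auto
    also have "\<dots> < d * K"
      using d by (simp add: K_def sum_distrib_left[symmetric] distrib_left)
    also have "\<dots> = m" using K by (simp add: d_def)
    finally show ?thesis .
  qed
  have inW: "y0 + (\<Sum>b\<in>F. r b *\<^sub>R b) \<in> W" if "F \<subseteq> E" "\<And>b. b \<in> F \<Longrightarrow> \<bar>r b\<bar> \<le> d" for F r
  proof (rule e0(2))
    show "y0 + (\<Sum>b\<in>F. r b *\<^sub>R b) - y0 \<in> span E"
      using that(1) by (simp, intro span_sum span_scale span_base) auto
    have "norm (\<Sum>b\<in>F. r b *\<^sub>R b) < m"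
      by (rule small) (use that in auto)
    then show "norm (y0 + (\<Sum>b\<in>F. r b *\<^sub>R b) - y0) < e0"
      using m(2) by simp
  qed
  have main: "norm (g (y0 + (\<Sum>b\<in>F. r b *\<^sub>R b)) - g y0 - (\<Sum>b\<in>F. r b *\<^sub>R dir_deriv b g y0))
      \<le> e * (\<Sum>b\<in>F. \<bar>r b\<bar>)" if "F \<subseteq> E" "\<And>b. b \<in> F \<Longrightarrow> \<bar>r b\<bar> < d" for F r
    using finite_subset[OF that(1) assms(1)] that
  proof (induction F rule: finite_induct)
    case (insert a F)
    define z where "z = y0 + (\<Sum>b\<in>F. r b *\<^sub>R b)"
    \<comment> \<open>Points of the segment in direction \<open>a\<close> are again combinations
      over \<open>insert a F\<close>, with coefficient \<open>t\<close> at \<open>a\<close>; thus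
      \<open>inW\<close> and \<open>small\<close> cover the whole segment.\<close>
    have zt: "z + t *\<^sub>R a = y0 + (\<Sum>b\<in>insert a F. (r(a := t)) b *\<^sub>R b)" for t
    proof -
      have "(\<Sum>b\<in>F. (r(a := t)) b *\<^sub>R b) = (\<Sum>b\<in>F. r b *\<^sub>R b)"
        using insert.hyps by (intro sum.cong) auto
      then show ?thesis using insert.hyps by (simp add: z_def)
    qed
    have tW: "z + t *\<^sub>R a \<in> W" and tm: "norm (z + t *\<^sub>R a - y0) < m" if "\<bar>t\<bar> < d" for t
    proof -
      have le: "\<bar>(r(a := t)) b\<bar> \<le> d" if "b \<in> insert a F" for b
        using that \<open>\<bar>t\<bar> < d\<close> insert.prems(2)[of b] by (cases "b = a") auto
      show "z + t *\<^sub>R a \<in> W"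
        unfolding zt by (rule inW) (use insert.prems le in auto)
      have "norm (\<Sum>b\<in>insert a F. (r(a := t)) b *\<^sub>R b) < m"
        by (rule small) (use insert.prems le in auto)
      then show "norm (z + t *\<^sub>R a - y0) < m"
        unfolding zt by simp
    qed
    have a: "a \<in> E" using insert.prems by auto
    have der: "((\<lambda>t. g (z + t *\<^sub>R a)) has_vector_derivative dir_deriv a g (z + t *\<^sub>R a)) (at t)"
      if "\<bar>t\<bar> < d" for t
    proof -
      have "((\<lambda>h. g (z + t *\<^sub>R a + h *\<^sub>R a)) has_vector_derivative dir_deriv a g (z + t *\<^sub>R a)) (at 0)"
        by (rule Ck_on_has_dir_deriv[OF assms(3) a tW[OF that]])
      then have "((\<lambda>h. g (z + t *\<^sub>R a + h *\<^sub>R a)) \<circ> (\<lambda>u. u - t) has_vector_derivative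
          1 *\<^sub>R dir_deriv a g (z + t *\<^sub>R a)) (at t)"
        by (intro vector_diff_chain_at) (auto intro!: derivative_eq_intros)
      then show ?thesis by (simp add: o_def algebra_simps flip: scaleR_add_left)
    qed
    \<comment> \<open>Subtracting the linear term leaves a function whose derivative is the
      deviation of \<open>dir_deriv a g\<close> from its value at \<open>y0\<close>.\<close>
    let ?h = "\<lambda>t. g (z + t *\<^sub>R a) - t *\<^sub>R dir_deriv a g y0"
    have "norm (?h (r a) - ?h 0) \<le> e * norm (r a - 0)"
    proof (rule differentiable_bound[where S="closed_segment 0 (r a)"
          and f'="\<lambda>t u. u *\<^sub>R (dir_deriv a g (z + t *\<^sub>R a) - dir_deriv a g y0)"])
      fix t assume t: "t \<in> closed_segment 0 (r a)"
      have td: "\<bar>t\<bar> < d"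
        using t insert.prems(2)[of a] by (auto simp: closed_segment_eq_real_ivl split: if_splits)
      have "(?h has_vector_derivative dir_deriv a g (z + t *\<^sub>R a) - 1 *\<^sub>R dir_deriv a g y0) (at t)"
        by (intro has_vector_derivative_diff der[OF td])
          (auto intro!: derivative_eq_intros simp: has_vector_derivative_def)
      then show "(?h has_derivative (\<lambda>u. u *\<^sub>R (dir_deriv a g (z + t *\<^sub>R a) - dir_deriv a g y0)))
          (at t within closed_segment 0 (r a))"
        by (auto simp: has_vector_derivative_def intro: has_derivative_at_withinI)
      have "dist (dir_deriv a g (z + t *\<^sub>R a)) (dir_deriv a g y0) < e"
        using \<eta>(2)[OF a tW[OF td]] tm[OF td] m(3)[OF a] by (simp add: dist_norm)
      then have "norm (u *\<^sub>R (dir_deriv a g (z + t *\<^sub>R a) - dir_deriv a g y0)) \<le> e * norm u" for u :: real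
        by (simp add: dist_norm mult.commute[of e] mult_left_mono)
      then show "onorm (\<lambda>u::real. u *\<^sub>R (dir_deriv a g (z + t *\<^sub>R a) - dir_deriv a g y0)) \<le> e"
        using assms(5) by (intro onorm_bound) auto
    qed auto
    then have 1: "norm (g (z + r a *\<^sub>R a) - g z - r a *\<^sub>R dir_deriv a g y0) \<le> e * \<bar>r a\<bar>"
      by (simp add: algebra_simps)
    have 2: "norm (g z - g y0 - (\<Sum>b\<in>F. r b *\<^sub>R dir_deriv b g y0)) \<le> e * (\<Sum>b\<in>F. \<bar>r b\<bar>)"
      unfolding z_def using insert by auto
    have eq: "g (y0 + (\<Sum>b\<in>insert a F. r b *\<^sub>R b)) - g y0 - (\<Sum>b\<in>insert a F. r b *\<^sub>R dir_deriv b g y0)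
      = (g (z + r a *\<^sub>R a) - g z - r a *\<^sub>R dir_deriv a g y0)
        + (g z - g y0 - (\<Sum>b\<in>F. r b *\<^sub>R dir_deriv b g y0))"
      using insert.hyps by (simp add: z_def algebra_simps)
    show ?case
      unfolding eq using norm_triangle_mono[OF 1 2] by (simp only: sum.insert[OF insert.hyps] distrib_left)
  qed simp
  show thesis
    by (rule that[OF d]) (use main[of E] in auto)
qed

text \<open>The expansion of \<open>g\<close> at \<open>c 0\<close>, divided by \<open>h\<close>,
  misses the expected quotient by at most a small constant times the sum of the absolute quotients
  \<open>r h b / h\<close>, and this sum stays bounded because the coefficient functions are
  differentiable.\<close>

lemma chain_rule_directions:
  fixes g :: "'v::real_normed_vector \<Rightarrow> 'w::real_normed_vector"
  assumes "finite E" "open_along E W" "Ck_on (Suc 0) E W g" "c 0 \<in> W"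
    and c: "eventually (\<lambda>h. c h = (\<Sum>b\<in>E. cb b h *\<^sub>R b)) (nhds 0)"
    and cd: "\<And>b. b \<in> E \<Longrightarrow> (cb b has_real_derivative cd b) (at 0)"
  shows "((\<lambda>h. g (c h)) has_vector_derivative (\<Sum>b\<in>E. cd b *\<^sub>R dir_deriv b g (c 0))) (at (0::real))"
proof -
  define y0 where "y0 = c 0"
  have y0: "y0 = (\<Sum>b\<in>E. cb b 0 *\<^sub>R b)"
    using eventually_nhds_x_imp_x[OF c] by (simp add: y0_def)
  define r where "r = (\<lambda>h b. cb b h - cb b 0)"
  have ch: "eventually (\<lambda>h. c h = y0 + (\<Sum>b\<in>E. r h b *\<^sub>R b)) (nhds 0)"
    using c by eventually_elim (simp add: y0 r_def scaleR_diff_left sum_subtractf)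
  have quot: "((\<lambda>h. r h b / h) \<longlongrightarrow> cd b) (at 0)" if "b \<in> E" for b
    using cd[OF that] by (simp add: has_field_derivative_iff r_def)
  have r0: "((\<lambda>h. r h b) \<longlongrightarrow> 0) (at 0)" if "b \<in> E" for b
    using DERIV_isCont[OF cd[OF that]] by (simp add: isCont_def r_def LIM_zero_iff)
  let ?S = "\<lambda>h. (\<Sum>b\<in>E. (r h b / h) *\<^sub>R dir_deriv b g y0)"
  have "((\<lambda>h. (g (c h) - g y0) /\<^sub>R h - ?S h) \<longlongrightarrow> 0) (at 0)"
  proof (rule tendstoI)
    fix e :: real assume "e > 0"
    \<comment> \<open>\<open>M\<close> exceeds the limit of the sum of the absolute quotients and
      hence bounds it near 0; the error is then below \<open>e' * M\<close>, which is at most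
      \<open>e\<close>.\<close>
    define M where "M = (\<Sum>b\<in>E. \<bar>cd b\<bar>) + 1"
    have M: "M > 0" by (simp add: M_def add_nonneg_pos sum_nonneg)
    define e' where "e' = e / (2 * M)"
    have e': "e' > 0" using \<open>e > 0\<close> M by (simp add: e'_def)
    obtain d where d: "d > 0" "\<And>r. (\<And>b. b \<in> E \<Longrightarrow> \<bar>r b\<bar> < d) \<Longrightarrow>
     norm (g (y0 + (\<Sum>b\<in>E. r b *\<^sub>R b)) - g y0 - (\<Sum>b\<in>E. r b *\<^sub>R dir_deriv b g y0)) \<le> e' * (\<Sum>b\<in>E. \<bar>r b\<bar>)"
      using directional_expansion[OF assms(1-3) _ e', of y0] assms(4) by (auto simp: y0_def)
    have ev1: "eventually (\<lambda>h. \<forall>b\<in>E. \<bar>r h b\<bar> < d) (at 0)"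
      using assms(1) tendstoD[OF r0 d(1)]
      by (intro eventually_ball_finite ballI) (simp_all add: dist_real_def)
    have "((\<lambda>h. \<Sum>b\<in>E. \<bar>r h b / h\<bar>) \<longlongrightarrow> (\<Sum>b\<in>E. \<bar>cd b\<bar>)) (at 0)"
      by (intro tendsto_sum tendsto_rabs quot)
    then have ev2: "eventually (\<lambda>h. (\<Sum>b\<in>E. \<bar>r h b / h\<bar>) < M) (at 0)"
      by (rule order_tendstoD) (simp add: M_def)
    have ev3: "eventually (\<lambda>h. c h = y0 + (\<Sum>b\<in>E. r h b *\<^sub>R b)) (at 0)"
      using ch by (auto simp: eventually_at_filter elim: eventually_mono)
    have ev4: "eventually (\<lambda>h::real. h \<noteq> 0) (at 0)"
      by (simp add: eventually_at_filter)
    show "eventually (\<lambda>h. dist ((g (c h) - g y0) /\<^sub>R h - ?S h) 0 < e) (at 0)"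
      using ev1 ev2 ev3 ev4
    proof eventually_elim
      case (elim h)
      have eq: "(g (c h) - g y0) /\<^sub>R h - ?S h
        = (g (y0 + (\<Sum>b\<in>E. r h b *\<^sub>R b)) - g y0 - (\<Sum>b\<in>E. r h b *\<^sub>R dir_deriv b g y0)) /\<^sub>R h"
        using elim by (simp add: scaleR_diff_right scaleR_sum_right divide_inverse mult.commute)
      have "norm ((g (c h) - g y0) /\<^sub>R h - ?S h) \<le> e' * (\<Sum>b\<in>E. \<bar>r h b\<bar>) / \<bar>h\<bar>"
        unfolding eq using d(2)[of "r h"] elim(1)
        by (simp add: divide_inverse_commute mult_left_mono)
      also have "\<dots> = e' * (\<Sum>b\<in>E. \<bar>r h b / h\<bar>)"
        by (simp add: sum_divide_distrib sum_distrib_left)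
      also have "\<dots> < e' * M" using elim(2) e' by simp
      also have "\<dots> \<le> e" using \<open>e > 0\<close> M by (simp add: e'_def)
      finally show ?case by simp
    qed
  qed
  moreover have "(?S \<longlongrightarrow> (\<Sum>b\<in>E. cd b *\<^sub>R dir_deriv b g y0)) (at 0)"
    by (intro tendsto_sum tendsto_scaleR quot tendsto_const)
  ultimately have "((\<lambda>h. (g (c h) - g y0) /\<^sub>R h) \<longlongrightarrow> (\<Sum>b\<in>E. cd b *\<^sub>R dir_deriv b g y0)) (at 0)"
    by - (drule tendsto_add, assumption, simp)
  then have "((\<lambda>h. (g (c (0 + h)) - g (c 0)) /\<^sub>R h) \<longlongrightarrow> (\<Sum>b\<in>E. cd b *\<^sub>R dir_deriv b g (c 0))) (at 0)"
    by (simp add: y0_def)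
  then have lim: "((\<lambda>h. norm ((g (c (0 + h)) - g (c 0)) /\<^sub>R h - (\<Sum>b\<in>E. cd b *\<^sub>R dir_deriv b g (c 0)))) \<longlongrightarrow> 0) (at 0)"
    by (intro tendsto_norm_zero LIM_zero)
  have eq: "norm (y /\<^sub>R h - d) = norm (y - h *\<^sub>R d) / norm h" if "h \<noteq> 0" for y d :: 'w and h :: real
  proof -
    have "y /\<^sub>R h - d = (y - h *\<^sub>R d) /\<^sub>R h"
      using that by (simp add: scaleR_diff_right)
    then show ?thesis
      by (simp only: norm_scaleR) (simp add: divide_inverse mult.commute)
  qed
  have "((\<lambda>h. norm (g (c (0 + h)) - g (c 0) - h *\<^sub>R (\<Sum>b\<in>E. cd b *\<^sub>R dir_deriv b g (c 0))) / norm h) \<longlongrightarrow> 0) (at 0)"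
  proof (rule Lim_transform_eventually[OF lim])
    show "\<forall>\<^sub>F h in at 0. norm ((g (c (0 + h)) - g (c 0)) /\<^sub>R h - (\<Sum>b\<in>E. cd b *\<^sub>R dir_deriv b g (c 0)))
      = norm (g (c (0 + h)) - g (c 0) - h *\<^sub>R (\<Sum>b\<in>E. cd b *\<^sub>R dir_deriv b g (c 0))) / norm h"
      unfolding eventually_at_filter by (intro always_eventually allI impI eq)
  qed
  then show ?thesis
    unfolding has_vector_derivative_def has_derivative_at
    by (simp only: bounded_linear_scaleR_left simp_thms)
qed

lemma has_dir_deriv_compose:
  fixes g :: "'v::real_normed_vector \<Rightarrow> 'w::real_normed_vector"
  assumes "finite E" "open_along E W" "open_along D U"
    and fb: "\<And>b. b \<in> E \<Longrightarrow> Ck_on (Suc 0) D U (fb b)"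
    and g: "Ck_on (Suc 0) E W g"
    and f: "\<And>x. x \<in> U \<Longrightarrow> f x = (\<Sum>b\<in>E. fb b x *\<^sub>R b)" "\<And>x. x \<in> U \<Longrightarrow> f x \<in> W"
    and dx: "d \<in> D" "x \<in> U"
  shows "has_dir_deriv d (\<lambda>x. g (f x)) x (\<Sum>b\<in>E. dir_deriv d (fb b) x *\<^sub>R dir_deriv b g (f x))"
proof -
  have "((\<lambda>h. g (f (x + h *\<^sub>R d))) has_vector_derivative
      (\<Sum>b\<in>E. dir_deriv d (fb b) x *\<^sub>R dir_deriv b g (f (x + 0 *\<^sub>R d)))) (at 0)"
  proof (rule chain_rule_directions[OF assms(1,2) g, where cb="\<lambda>b h. fb b (x + h *\<^sub>R d)"])
    show "f (x + 0 *\<^sub>R d) \<in> W" using f(2) dx by simp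
    show "\<forall>\<^sub>F h in nhds 0. f (x + h *\<^sub>R d) = (\<Sum>b\<in>E. fb b (x + h *\<^sub>R d) *\<^sub>R b)"
      using open_along_line[OF assms(3) dx(2,1)] by eventually_elim (rule f(1))
    show "((\<lambda>h. fb b (x + h *\<^sub>R d)) has_real_derivative dir_deriv d (fb b) x) (at 0)" if "b \<in> E" for b
      using Ck_on_has_dir_deriv[OF fb[OF that] dx] by (simp add: has_real_derivative_iff_has_vector_derivative)
  qed
  then show ?thesis by simp
qed

text \<open>By the chain rule the derivative is a sum of products whose factors
  \<open>dir_deriv b g (f x)\<close> are compositions of the same kind with another outer function;
  therefore \<open>g\<close> is arbitrary in the induction.\<close>

lemma Ck_on_compose:
  fixes g :: "'v::real_normed_vector \<Rightarrow> 'w::real_normed_vector"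
  assumes "finite E" "open_along E W" "open_along D U"
    and f: "\<And>x. x \<in> U \<Longrightarrow> f x = (\<Sum>b\<in>E. fb b x *\<^sub>R b)" "\<And>x. x \<in> U \<Longrightarrow> f x \<in> W"
    and "\<And>b. b \<in> E \<Longrightarrow> Ck_on k D U (fb b)" "Ck_on k E W g"
  shows "Ck_on k D U (\<lambda>x. g (f x))"
  using assms(6,7)
proof (induction k arbitrary: g)
  case 0
  have "continuous_on U (\<lambda>x. \<Sum>b\<in>E. fb b x *\<^sub>R b)"
    using 0 by (intro continuous_intros) auto
  then have "continuous_on U f"
    by (rule continuous_on_eq) (simp add: f(1))
  then show ?case
    using 0 f(2) by (auto intro: continuous_on_compose2)
next
  case (Suc k)
  have lower: "Ck_on k D U (fb b)" if "b \<in> E" for b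
    using Suc.prems(1)[OF that] by (rule Ck_on_Suc_imp)
  have one: "Ck_on (Suc 0) D' U' h" if "Ck_on (Suc k) D' U' h"
    for D' U' and h :: "'b::real_normed_vector \<Rightarrow> 'c::real_normed_vector"
    using that by (auto dest: Ck_on_continuous)
  show ?case
  proof (rule Ck_on_SucI[where f'="\<lambda>d x. \<Sum>b\<in>E. dir_deriv d (fb b) x *\<^sub>R dir_deriv b g (f x)"])
    show "continuous_on U (\<lambda>x. g (f x))"
      using Suc.IH[OF lower Ck_on_Suc_imp[OF Suc.prems(2)]] by (rule Ck_on_continuous)
    show "Ck_on k D U (\<lambda>x. \<Sum>b\<in>E. dir_deriv d (fb b) x *\<^sub>R dir_deriv b g (f x))" if d: "d \<in> D" for d
    proof (intro Ck_on_sum Ck_on_scaleR assms(3))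
      fix b assume b: "b \<in> E"
      show "Ck_on k D U (dir_deriv d (fb b))" using Suc.prems(1)[OF b] d by simp
      show "Ck_on k D U (\<lambda>x. dir_deriv b g (f x))"
        by (rule Suc.IH[OF lower]) (use Suc.prems(2) b in auto)
    qed
    fix d x assume "d \<in> D" "x \<in> U"
    then show "has_dir_deriv d (\<lambda>x. g (f x)) x (\<Sum>b\<in>E. dir_deriv d (fb b) x *\<^sub>R dir_deriv b g (f x))"
      by (intro has_dir_deriv_compose[OF assms(1-3) _ _ f] one Suc.prems) auto
  qed (rule assms(3))
qed

section \<open>Smooth functions along a set of directions\<close>

lemma smooth_on_has_dir_deriv:
  "smooth_on D U f \<Longrightarrow> b \<in> D \<Longrightarrow> x \<in> U \<Longrightarrow> has_dir_deriv b f x (dir_deriv b f x)"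
  unfolding smooth_on_def using Ck_on_has_dir_deriv by blast

lemma smooth_on_continuous: "smooth_on D U f \<Longrightarrow> continuous_on U f"
  unfolding smooth_on_def using Ck_on_continuous by blast

lemma smooth_on_dir_deriv: "smooth_on D U f \<Longrightarrow> b \<in> D \<Longrightarrow> smooth_on D U (dir_deriv b f)"
  unfolding smooth_on_def by (metis Ck_on.simps(2))

lemma smooth_on_cong:
  "open_along D U \<Longrightarrow> (\<And>x. x \<in> U \<Longrightarrow> f x = g x) \<Longrightarrow> smooth_on D U f \<Longrightarrow> smooth_on D U g"
  unfolding smooth_on_def by (metis Ck_on_cong)

lemma smooth_on_subset: "smooth_on D U f \<Longrightarrow> V \<subseteq> U \<Longrightarrow> smooth_on D V f"
  unfolding smooth_on_def by (metis Ck_on_subset)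

lemma smooth_on_const: "open_along D U \<Longrightarrow> smooth_on D U (\<lambda>x. c)"
  unfolding smooth_on_def by (simp add: Ck_on_const)

lemma smooth_on_bounded_linear:
  "bounded_linear L \<Longrightarrow> open_along D U \<Longrightarrow> smooth_on D U f \<Longrightarrow> smooth_on D U (\<lambda>x. L (f x))"
  unfolding smooth_on_def by (simp add: Ck_on_bounded_linear)

lemma smooth_on_add:
  "open_along D U \<Longrightarrow> smooth_on D U f \<Longrightarrow> smooth_on D U g \<Longrightarrow> smooth_on D U (\<lambda>x. f x + g x)"
  unfolding smooth_on_def by (simp add: Ck_on_add)

lemma smooth_on_sum:
  "open_along D U \<Longrightarrow> (\<And>i. i \<in> I \<Longrightarrow> smooth_on D U (f i)) \<Longrightarrow> smooth_on D U (\<lambda>x. \<Sum>i\<in>I. f i x)"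
  unfolding smooth_on_def by (simp add: Ck_on_sum)

lemma smooth_on_scaleR:
  "open_along D U \<Longrightarrow> smooth_on D U f \<Longrightarrow> smooth_on D U g \<Longrightarrow> smooth_on D U (\<lambda>x. f x *\<^sub>R g x)"
  unfolding smooth_on_def by (simp add: Ck_on_scaleR)

lemma smooth_on_mult:
  fixes f g :: "_ \<Rightarrow> real"
  shows "open_along D U \<Longrightarrow> smooth_on D U f \<Longrightarrow> smooth_on D U g \<Longrightarrow> smooth_on D U (\<lambda>x. f x * g x)"
  using smooth_on_scaleR[of D U f g] by simp

lemma smooth_on_diff:
  assumes "open_along D U" "smooth_on D U f" "smooth_on D U g"
  shows "smooth_on D U (\<lambda>x. f x - g x)"
  using smooth_on_add[OF assms(1,2) smooth_on_bounded_linear[OF bounded_linear_minus[OF bounded_linear_ident] assms(1,3)]]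
  by simp

lemma smooth_on_ident: "open_along D U \<Longrightarrow> smooth_on D U (\<lambda>x. x)"
  unfolding smooth_on_def
proof
  fix k assume U: "open_along D U"
  show "Ck_on k D U (\<lambda>x. x)"
  proof (cases k)
    case (Suc m)
    have "has_dir_deriv b (\<lambda>x. x) x b" for b x :: 'a
      by (auto intro!: derivative_eq_intros simp: has_vector_derivative_def)
    then show ?thesis
      unfolding Suc by (intro Ck_on_SucI[where f'="\<lambda>b x. b"] Ck_on_const U) auto
  qed simp
qed

lemma smooth_on_linear: "bounded_linear L \<Longrightarrow> open_along D U \<Longrightarrow> smooth_on D U L"
  using smooth_on_bounded_linear[OF _ _ smooth_on_ident] by fastforce

lemma smooth_on_compose:
  assumes "finite E" "open_along E W" "open_along D U"
    and "\<And>x. x \<in> U \<Longrightarrow> f x = (\<Sum>b\<in>E. fb b x *\<^sub>R b)" "\<And>x. x \<in> U \<Longrightarrow> f x \<in> W"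
    and "\<And>b. b \<in> E \<Longrightarrow> smooth_on D U (fb b)" "smooth_on E W g"
  shows "smooth_on D U (\<lambda>x. g (f x))"
  unfolding smooth_on_def using assms(6,7)
  by (intro allI Ck_on_compose[OF assms(1-5)]) (auto simp: smooth_on_def)

section \<open>Smoothness near a point of a Euclidean space\<close>

text \<open>Hides the neighbourhood, which would otherwise have to be shrunk at every composition
  and change of charts.\<close>

definition smooth_near :: "('v::euclidean_space \<Rightarrow> 'w::real_normed_vector) \<Rightarrow> 'v \<Rightarrow> bool" where
  "smooth_near f x \<longleftrightarrow> (\<exists>U. open U \<and> x \<in> U \<and> smooth_on Basis U f)"

lemma smooth_on_near: "open U \<Longrightarrow> x \<in> U \<Longrightarrow> smooth_on Basis U f \<Longrightarrow> smooth_near f x"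
  unfolding smooth_near_def by blast

lemma eventually_smooth_near: "smooth_near f x \<Longrightarrow> eventually (smooth_near f) (nhds x)"
  unfolding smooth_near_def eventually_nhds by blast

lemma smooth_near_common:
  assumes "finite I" "\<And>i. i \<in> I \<Longrightarrow> smooth_near (f i) x"
  obtains U where "open U" "x \<in> U" "\<And>i. i \<in> I \<Longrightarrow> smooth_on Basis U (f i)"
proof -
  have "\<forall>i\<in>I. \<exists>U. open U \<and> x \<in> U \<and> smooth_on Basis U (f i)"
    using assms(2) by (auto simp: smooth_near_def)
  then obtain U where U: "\<And>i. i \<in> I \<Longrightarrow> open (U i) \<and> x \<in> U i \<and> smooth_on Basis (U i) (f i)"
    by metis
  show thesis
    by (rule that[of "\<Inter>i\<in>I. U i"]) (use assms(1) U in \<open>auto intro: smooth_on_subset\<close>)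
qed

lemma smooth_near_common2:
  assumes "smooth_near f x" "smooth_near g x"
  obtains U where "open U" "x \<in> U" "smooth_on Basis U f" "smooth_on Basis U g"
proof -
  obtain U V where "open U" "x \<in> U" "smooth_on Basis U f" "open V" "x \<in> V" "smooth_on Basis V g"
    using assms unfolding smooth_near_def by blast
  then show thesis
    by (intro that[of "U \<inter> V"]) (auto intro: smooth_on_subset)
qed

lemma smooth_near_has_dir_deriv:
  "smooth_near f x \<Longrightarrow> b \<in> Basis \<Longrightarrow> has_dir_deriv b f x (dir_deriv b f x)"
  unfolding smooth_near_def using smooth_on_has_dir_deriv by blast

lemma smooth_near_dir_deriv: "smooth_near f x \<Longrightarrow> b \<in> Basis \<Longrightarrow> smooth_near (dir_deriv b f) x"
  unfolding smooth_near_def using smooth_on_dir_deriv by blast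

lemma smooth_near_cong:
  assumes "eventually (\<lambda>y. f y = g y) (nhds x)" "smooth_near f x"
  shows "smooth_near g x"
proof -
  obtain U V where "open U" "x \<in> U" "\<And>y. y \<in> U \<Longrightarrow> f y = g y" "open V" "x \<in> V" "smooth_on Basis V f"
    using assms unfolding smooth_near_def eventually_nhds by blast
  then show ?thesis
    by (intro smooth_on_near[of "U \<inter> V"]) (auto intro!: smooth_on_cong[of _ _ f g] open_along_open intro: smooth_on_subset)
qed

lemma smooth_near_const: "smooth_near (\<lambda>x. c) x"
  by (intro smooth_on_near[of UNIV] smooth_on_const open_along_open) auto

lemma smooth_near_linear: "bounded_linear L \<Longrightarrow> smooth_near L x"
  by (intro smooth_on_near[of UNIV] smooth_on_linear open_along_open) auto

lemma smooth_near_bounded_linear: "bounded_linear L \<Longrightarrow> smooth_near f x \<Longrightarrow> smooth_near (\<lambda>x. L (f x)) x"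
  unfolding smooth_near_def by (metis smooth_on_bounded_linear open_along_open)

lemma smooth_near_add: "smooth_near f x \<Longrightarrow> smooth_near g x \<Longrightarrow> smooth_near (\<lambda>x. f x + g x) x"
  by (erule (1) smooth_near_common2) (auto intro!: smooth_on_near smooth_on_add open_along_open)

lemma smooth_near_diff: "smooth_near f x \<Longrightarrow> smooth_near g x \<Longrightarrow> smooth_near (\<lambda>x. f x - g x) x"
  by (erule (1) smooth_near_common2) (auto intro!: smooth_on_near smooth_on_diff open_along_open)

lemma smooth_near_scaleR: "smooth_near f x \<Longrightarrow> smooth_near g x \<Longrightarrow> smooth_near (\<lambda>x. f x *\<^sub>R g x) x"
  by (erule (1) smooth_near_common2) (auto intro!: smooth_on_near smooth_on_scaleR open_along_open)

lemma smooth_near_mult: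
  fixes f g :: "_ \<Rightarrow> real"
  shows "smooth_near f x \<Longrightarrow> smooth_near g x \<Longrightarrow> smooth_near (\<lambda>x. f x * g x) x"
  using smooth_near_scaleR[of f x g] by simp

lemma smooth_near_sum:
  "(\<And>i. i \<in> I \<Longrightarrow> smooth_near (f i) x) \<Longrightarrow> smooth_near (\<lambda>x. \<Sum>i\<in>I. f i x) x"
  by (induction I rule: infinite_finite_induct) (auto intro: smooth_near_add smooth_near_const)

lemma smooth_near_prod:
  fixes f :: "_ \<Rightarrow> _ \<Rightarrow> real"
  shows "(\<And>i. i \<in> I \<Longrightarrow> smooth_near (f i) x) \<Longrightarrow> smooth_near (\<lambda>x. \<Prod>i\<in>I. f i x) x"
  by (induction I rule: infinite_finite_induct) (auto intro: smooth_near_mult smooth_near_const)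

lemma smooth_near_power:
  fixes f :: "_ \<Rightarrow> real"
  shows "smooth_near f x \<Longrightarrow> smooth_near (\<lambda>x. f x ^ k) x"
  by (induction k) (auto intro: smooth_near_mult smooth_near_const)

lemma smooth_near_euclidean:
  fixes f :: "'v::euclidean_space \<Rightarrow> 'w::euclidean_space"
  assumes "\<And>b. b \<in> Basis \<Longrightarrow> smooth_near (\<lambda>y. f y \<bullet> b) x"
  shows "smooth_near f x"
proof -
  have "smooth_near (\<lambda>y. \<Sum>b\<in>Basis. (f y \<bullet> b) *\<^sub>R b) x"
    by (intro smooth_near_sum smooth_near_bounded_linear[OF bounded_linear_scaleR_left] assms)
  then show ?thesis by (simp add: euclidean_representation)
qed

lemma smooth_near_isCont: "smooth_near f x \<Longrightarrow> isCont f x"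
  unfolding smooth_near_def using smooth_on_continuous continuous_on_eq_continuous_at by blast

lemma smooth_near_eventually_in:
  assumes "smooth_near f x" "open W" "f x \<in> W"
  shows "eventually (\<lambda>y. f y \<in> W) (nhds x)"
  using smooth_near_isCont[OF assms(1)] assms(2,3)
  by (simp add: isCont_def tendsto_at_iff_tendsto_nhds topological_tendstoD)

lemma smooth_near_compose_nhd:
  fixes f :: "'v::euclidean_space \<Rightarrow> 'w::euclidean_space"
  assumes f: "smooth_near f x" and g: "smooth_near g (f x)"
  obtains U W where "open U" "x \<in> U" "open W" "\<And>y. y \<in> U \<Longrightarrow> f y \<in> W" "smooth_on Basis U f" "smooth_on Basis W g"
proof -
  obtain V where V: "open V" "x \<in> V" "smooth_on Basis V f" using f by (auto simp: smooth_near_def)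
  obtain W where W: "open W" "f x \<in> W" "smooth_on Basis W g" using g by (auto simp: smooth_near_def)
  have "eventually (\<lambda>y. f y \<in> W) (nhds x)" using smooth_near_eventually_in[OF f W(1,2)] .
  then obtain U where U: "open U" "x \<in> U" "\<And>y. y \<in> U \<Longrightarrow> f y \<in> W" unfolding eventually_nhds by blast
  show thesis
    by (rule that[of "U \<inter> V" W]) (use U V W in \<open>auto intro: smooth_on_subset\<close>)
qed

lemma smooth_near_compose:
  fixes f :: "'v::euclidean_space \<Rightarrow> 'w::euclidean_space"
  assumes "smooth_near f x" "smooth_near g (f x)"
  shows "smooth_near (\<lambda>y. g (f y)) x"
proof -
  obtain U W where *: "open U" "x \<in> U" "open W" "\<And>y. y \<in> U \<Longrightarrow> f y \<in> W" "smooth_on Basis U f" "smooth_on Basis W g"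
    using smooth_near_compose_nhd[OF assms] by blast
  have "smooth_on Basis U (\<lambda>y. g (f y))"
    by (rule smooth_on_compose[where E=Basis and W=W and fb="\<lambda>b y. f y \<bullet> b"])
      (use * in \<open>auto intro!: open_along_open smooth_on_bounded_linear[OF bounded_linear_inner_left]
         simp: euclidean_representation\<close>)
  then show ?thesis by (rule smooth_on_near[OF *(1,2)])
qed

lemma dir_deriv_compose:
  fixes f :: "'v::euclidean_space \<Rightarrow> 'w::euclidean_space"
  assumes "smooth_near f x" "smooth_near g (f x)" "d \<in> Basis"
  shows "dir_deriv d (\<lambda>y. g (f y)) x = (\<Sum>b\<in>Basis. dir_deriv d (\<lambda>y. f y \<bullet> b) x *\<^sub>R dir_deriv b g (f x))"
proof -
  obtain U W where *: "open U" "x \<in> U" "open W" "\<And>y. y \<in> U \<Longrightarrow> f y \<in> W" "smooth_on Basis U f" "smooth_on Basis W g"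
    using smooth_near_compose_nhd[OF assms(1,2)] by blast
  have fb: "smooth_on Basis U (\<lambda>y. f y \<bullet> b)" for b
    by (intro smooth_on_bounded_linear[OF bounded_linear_inner_left] open_along_open *)
  show ?thesis
    by (rule dir_deriv_eq, rule has_dir_deriv_compose[where W=W and U=U and D=Basis])
      (use * assms(3) fb in \<open>auto intro!: open_along_open simp: euclidean_representation simp del: Ck_on.simps
         simp: smooth_on_def\<close>)
qed

section \<open>Rules for directional derivatives at a point\<close>

lemma eventually_nhds_line:
  fixes x b :: "'v::real_normed_vector"
  assumes "eventually P (nhds x)"
  shows "eventually (\<lambda>h::real. P (x + h *\<^sub>R b)) (nhds 0)"
proof -
  have "((\<lambda>h::real. x + h *\<^sub>R b) \<longlongrightarrow> x + 0 *\<^sub>R b) (nhds 0)"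
    by (intro tendsto_intros) (simp add: filterlim_ident)
  then have "filterlim (\<lambda>h::real. x + h *\<^sub>R b) (nhds x) (nhds 0)" by simp
  from eventually_compose_filterlim[OF assms this] show ?thesis .
qed

lemma dir_deriv_cong_nhds:
  "eventually (\<lambda>y. f y = g y) (nhds x) \<Longrightarrow> dir_deriv b f x = dir_deriv b g x"
  unfolding dir_deriv_def by (intro vector_derivative_cong_nhds eventually_nhds_line)

lemma eventually_dir_deriv_cong:
  "eventually (\<lambda>y. f y = g y) (nhds x) \<Longrightarrow> eventually (\<lambda>y. dir_deriv b f y = dir_deriv b g y) (nhds x)"
  by (subst (asm) eventually_eventually[symmetric]) (auto elim!: eventually_mono intro: dir_deriv_cong_nhds)

lemma dir_deriv_bounded_linear:
  "bounded_linear L \<Longrightarrow> smooth_near f x \<Longrightarrow> b \<in> Basis \<Longrightarrow> dir_deriv b (\<lambda>y. L (f y)) x = L (dir_deriv b f x)"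
  by (rule dir_deriv_eq, erule bounded_linear.has_vector_derivative, rule smooth_near_has_dir_deriv)

lemma dir_deriv_add:
  "smooth_near f x \<Longrightarrow> smooth_near g x \<Longrightarrow> b \<in> Basis \<Longrightarrow>
   dir_deriv b (\<lambda>y. f y + g y) x = dir_deriv b f x + dir_deriv b g x"
  by (rule dir_deriv_eq, rule has_vector_derivative_add) (rule smooth_near_has_dir_deriv; assumption)+

lemma dir_deriv_const [simp]: "dir_deriv b (\<lambda>y. c) x = 0"
  by (intro dir_deriv_eq) auto

lemma dir_deriv_sum:
  "(\<And>i. i \<in> I \<Longrightarrow> smooth_near (f i) x) \<Longrightarrow> b \<in> Basis \<Longrightarrow>
   dir_deriv b (\<lambda>y. \<Sum>i\<in>I. f i y) x = (\<Sum>i\<in>I. dir_deriv b (f i) x)"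
  by (rule dir_deriv_eq, rule has_vector_derivative_sum, rule smooth_near_has_dir_deriv) auto

lemma dir_deriv_mult:
  fixes f g :: "_ \<Rightarrow> real"
  assumes "smooth_near f x" "smooth_near g x" "b \<in> Basis"
  shows "dir_deriv b (\<lambda>y. f y * g y) x = dir_deriv b f x * g x + f x * dir_deriv b g x"
  using has_vector_derivative_mult[OF smooth_near_has_dir_deriv[OF assms(1,3)] smooth_near_has_dir_deriv[OF assms(2,3)]]
  by (intro dir_deriv_eq) (simp add: add.commute)

lemma dir_deriv_cmult:
  fixes f :: "_ \<Rightarrow> real"
  assumes "smooth_near f x" "b \<in> Basis"
  shows "dir_deriv b (\<lambda>y. c * f y) x = c * dir_deriv b f x"
  using dir_deriv_mult[OF smooth_near_const assms] by simp

lemma has_dir_deriv_shift: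
  assumes "has_dir_deriv b f (z + t *\<^sub>R b) d"
  shows "((\<lambda>t. f (z + t *\<^sub>R b)) has_vector_derivative d) (at t)"
proof -
  have "((\<lambda>h. f (z + t *\<^sub>R b + h *\<^sub>R b)) \<circ> (\<lambda>u. u - t) has_vector_derivative 1 *\<^sub>R d) (at t)"
    using assms by (intro vector_diff_chain_at) (auto intro!: derivative_eq_intros)
  then show ?thesis by (simp add: o_def algebra_simps flip: scaleR_add_left)
qed

text \<open>The double difference quotient of \<open>f\<close> is, by the mean value theorem applied in either
  order, a value of each of the two mixed derivatives near \<open>x\<close>.\<close>

lemma second_difference_mean_value:
  fixes f :: "'v::euclidean_space \<Rightarrow> real"
  assumes f: "smooth_on Basis U f" and ab: "a \<in> Basis" "b \<in> Basis" and s: "s > 0"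
    and U: "\<And>u v. 0 \<le> u \<Longrightarrow> u \<le> s \<Longrightarrow> 0 \<le> v \<Longrightarrow> v \<le> s \<Longrightarrow> x + u *\<^sub>R a + v *\<^sub>R b \<in> U"
  obtains u v where "0 \<le> u" "u \<le> s" "0 \<le> v" "v \<le> s"
    "f (x + s *\<^sub>R a + s *\<^sub>R b) - f (x + s *\<^sub>R a) - f (x + s *\<^sub>R b) + f x
      = s * s * dir_deriv a (dir_deriv b f) (x + u *\<^sub>R a + v *\<^sub>R b)"
proof -
  let ?p = "\<lambda>v. f (x + s *\<^sub>R a + v *\<^sub>R b) - f (x + v *\<^sub>R b)"
  have "\<exists>v. 0 < v \<and> v < s \<and> ?p s - ?p 0 = (s - 0) * (dir_deriv b f (x + s *\<^sub>R a + v *\<^sub>R b) - dir_deriv b f (x + v *\<^sub>R b))"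
  proof (rule MVT2[OF s])
    fix v assume v: "0 \<le> v" "v \<le> s"
    have "((\<lambda>v. f (x + s *\<^sub>R a + v *\<^sub>R b)) has_vector_derivative dir_deriv b f (x + s *\<^sub>R a + v *\<^sub>R b)) (at v)"
      by (rule has_dir_deriv_shift, rule smooth_on_has_dir_deriv[OF f]) (use U[of s v] v s ab in auto)
    moreover have "((\<lambda>v. f (x + v *\<^sub>R b)) has_vector_derivative dir_deriv b f (x + v *\<^sub>R b)) (at v)"
      by (rule has_dir_deriv_shift, rule smooth_on_has_dir_deriv[OF f]) (use U[of 0 v] v s ab in auto)
    ultimately show "(?p has_real_derivative (dir_deriv b f (x + s *\<^sub>R a + v *\<^sub>R b) - dir_deriv b f (x + v *\<^sub>R b))) (at v)"
      unfolding has_real_derivative_iff_has_vector_derivative by (rule has_vector_derivative_diff)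
  qed
  then obtain v where v: "0 < v" "v < s"
    "?p s - ?p 0 = s * (dir_deriv b f (x + s *\<^sub>R a + v *\<^sub>R b) - dir_deriv b f (x + v *\<^sub>R b))" by auto
  let ?q = "\<lambda>u. dir_deriv b f (x + v *\<^sub>R b + u *\<^sub>R a)"
  have "\<exists>u. 0 < u \<and> u < s \<and> ?q s - ?q 0 = (s - 0) * dir_deriv a (dir_deriv b f) (x + v *\<^sub>R b + u *\<^sub>R a)"
  proof (rule MVT2[OF s])
    fix u assume u: "0 \<le> u" "u \<le> s"
    show "(?q has_real_derivative dir_deriv a (dir_deriv b f) (x + v *\<^sub>R b + u *\<^sub>R a)) (at u)"
      unfolding has_real_derivative_iff_has_vector_derivative
      by (rule has_dir_deriv_shift, rule smooth_on_has_dir_deriv[OF smooth_on_dir_deriv[OF f]])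
        (use U[of u v] u v ab in \<open>auto simp: add_ac\<close>)
  qed
  then obtain u where u: "0 < u" "u < s" "?q s - ?q 0 = s * dir_deriv a (dir_deriv b f) (x + v *\<^sub>R b + u *\<^sub>R a)"
    by auto
  show thesis
    by (rule that[of u v]) (use u v in \<open>auto simp: add_ac algebra_simps\<close>)
qed

text \<open>If the mixed derivatives differed at \<open>x\<close> by \<open>2 * e\<close>, each
  would stay within \<open>e\<close> of its own value near \<open>x\<close>; but the second
  difference over a small square is \<open>s * s\<close> times a nearby value of either one.\<close>

lemma dir_deriv_commute:
  fixes f :: "'v::euclidean_space \<Rightarrow> real"
  assumes f: "smooth_near f x" and ab: "a \<in> Basis" "b \<in> Basis"
  shows "dir_deriv a (dir_deriv b f) x = dir_deriv b (dir_deriv a f) x"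
proof (rule ccontr)
  let ?A = "dir_deriv a (dir_deriv b f)" and ?B = "dir_deriv b (dir_deriv a f)"
  assume ne: "?A x \<noteq> ?B x"
  define e where "e = dist (?A x) (?B x) / 2"
  have e: "e > 0" using ne by (simp add: e_def)
  obtain U where U: "open U" "x \<in> U" "smooth_on Basis U f" using f by (auto simp: smooth_near_def)
  have "smooth_near ?A x" "smooth_near ?B x"
    using f ab by (auto intro: smooth_near_dir_deriv)
  then have "eventually (\<lambda>y. ?A y \<in> ball (?A x) e) (nhds x)" "eventually (\<lambda>y. ?B y \<in> ball (?B x) e) (nhds x)"
    using e smooth_near_eventually_in[of ?A x "ball (?A x) e"] smooth_near_eventually_in[of ?B x "ball (?B x) e"]
    by (simp_all only: open_ball centre_in_ball)
  then have "eventually (\<lambda>y. dist (?A y) (?A x) < e) (nhds x)" "eventually (\<lambda>y. dist (?B y) (?B x) < e) (nhds x)"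
    by (simp_all add: dist_commute)
  moreover have "eventually (\<lambda>y. y \<in> U) (nhds x)" using U by (auto simp: eventually_nhds)
  ultimately have "eventually (\<lambda>y. dist (?A y) (?A x) < e \<and> dist (?B y) (?B x) < e \<and> y \<in> U) (nhds x)"
    by eventually_elim auto
  then obtain r where r: "r > 0" "\<And>y. dist y x < r \<Longrightarrow> dist (?A y) (?A x) < e \<and> dist (?B y) (?B x) < e \<and> y \<in> U"
    unfolding eventually_nhds_metric by blast
  \<comment> \<open>Two steps of length at most \<open>s\<close> along unit vectors stay within
    \<open>2 * s < r\<close>.\<close>
  define s where "s = r / 3"
  have s: "s > 0" using r by (simp add: s_def)
  have near: "dist (x + u *\<^sub>R a + v *\<^sub>R b) x < r" "dist (x + u *\<^sub>R b + v *\<^sub>R a) x < r"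
    if "0 \<le> u" "u \<le> s" "0 \<le> v" "v \<le> s" for u v
  proof -
    have "norm (u *\<^sub>R c + v *\<^sub>R d) < r" if "c \<in> Basis" "d \<in> Basis" for c d :: 'v
      by (rule le_less_trans[OF norm_triangle_ineq])
        (use that \<open>0 \<le> u\<close> \<open>u \<le> s\<close> \<open>0 \<le> v\<close> \<open>v \<le> s\<close> s in \<open>simp add: s_def\<close>)
    from this[OF ab] this[OF ab(2,1)]
    show "dist (x + u *\<^sub>R a + v *\<^sub>R b) x < r" "dist (x + u *\<^sub>R b + v *\<^sub>R a) x < r"
      by (simp_all add: dist_norm add.assoc)
  qed
  obtain u v where 1: "0 \<le> u" "u \<le> s" "0 \<le> v" "v \<le> s"
    "f (x + s *\<^sub>R a + s *\<^sub>R b) - f (x + s *\<^sub>R a) - f (x + s *\<^sub>R b) + f x = s * s * ?A (x + u *\<^sub>R a + v *\<^sub>R b)"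
    using second_difference_mean_value[OF U(3) ab s, of x] r(2) near(1) by blast
  obtain u' v' where 2: "0 \<le> u'" "u' \<le> s" "0 \<le> v'" "v' \<le> s"
    "f (x + s *\<^sub>R b + s *\<^sub>R a) - f (x + s *\<^sub>R b) - f (x + s *\<^sub>R a) + f x = s * s * ?B (x + u' *\<^sub>R b + v' *\<^sub>R a)"
    using second_difference_mean_value[OF U(3) ab(2,1) s, of x] r(2) near(2) by blast
  have "s * s * ?A (x + u *\<^sub>R a + v *\<^sub>R b) = s * s * ?B (x + u' *\<^sub>R b + v' *\<^sub>R a)"
    unfolding 1(5)[symmetric] 2(5)[symmetric] by (simp add: add_ac)
  then have eq: "?A (x + u *\<^sub>R a + v *\<^sub>R b) = ?B (x + u' *\<^sub>R b + v' *\<^sub>R a)" using s by simp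
  have "dist (?A x) (?B x) < e + e"
    using r(2)[OF near(1)[OF 1(1-4)]] r(2)[OF near(2)[OF 2(1-4)]] eq
    by (metis add_strict_mono dist_commute dist_triangle le_less_trans)
  then show False by (simp add: e_def)
qed

section \<open>Iterated directional derivatives\<close>

text \<open>Admits general directions besides the axes of \<open>iter_partial\<close>: on a product
  space, derivatives in a parameter have to be interchanged with those in the variable of a
  germ.\<close>

definition dir_derivs :: "'v list \<Rightarrow> ('v::euclidean_space \<Rightarrow> 'w::real_normed_vector) \<Rightarrow> 'v \<Rightarrow> 'w" where
  "dir_derivs bs f = foldr dir_deriv bs f"

lemma dir_derivs_simps [simp]:
  "dir_derivs [] f = f"
  "dir_derivs (b # bs) f = dir_deriv b (dir_derivs bs f)"
  "dir_derivs (as @ bs) f = dir_derivs as (dir_derivs bs f)"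
  by (simp_all add: dir_derivs_def)

lemma iter_partial_dir_derivs: "iter_partial J f = dir_derivs (map (\<lambda>j. axis j 1) J) f"
  by (simp add: iter_partial_def dir_derivs_def foldr_map o_def)

lemma axes_subset_Basis [simp]: "set (map (\<lambda>j. axis j (1::real)) J) \<subseteq> Basis"
  by auto

lemma smooth_near_dir_derivs: "smooth_near f x \<Longrightarrow> set bs \<subseteq> Basis \<Longrightarrow> smooth_near (dir_derivs bs f) x"
  by (induction bs) (auto intro: smooth_near_dir_deriv)

lemma eventually_dir_derivs_cong:
  "eventually (\<lambda>y. f y = g y) (nhds x) \<Longrightarrow> eventually (\<lambda>y. dir_derivs bs f y = dir_derivs bs g y) (nhds x)"
  by (induction bs) (auto intro: eventually_dir_deriv_cong)

lemma dir_derivs_cong_nhds: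
  "eventually (\<lambda>y. f y = g y) (nhds x) \<Longrightarrow> dir_derivs bs f x = dir_derivs bs g x"
  using eventually_nhds_x_imp_x[OF eventually_dir_derivs_cong] .

lemma dir_deriv_shift: "dir_deriv b (\<lambda>y. f (y + c)) x = dir_deriv b f (x + c)"
  by (simp add: dir_deriv_def add_ac)

lemma dir_derivs_shift: "dir_derivs bs (\<lambda>y. f (y + c)) x = dir_derivs bs f (x + c)"
proof (induction bs arbitrary: x)
  case (Cons b bs)
  have "dir_derivs bs (\<lambda>y. f (y + c)) = (\<lambda>y. dir_derivs bs f (y + c))"
    using Cons.IH by auto
  then show ?case by (simp add: dir_deriv_shift)
qed simp

text \<open>Both sides of an identity between iterated derivatives may be differentiated once more, as
  the identity holds at all nearby points at which the same functions are smooth.\<close>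

lemma eventually_smooth_near_all:
  assumes "finite I" "\<And>i. i \<in> I \<Longrightarrow> smooth_near (f i) x"
  shows "eventually (\<lambda>y. \<forall>i\<in>I. smooth_near (f i) y) (nhds x)"
  using assms by (intro eventually_ball_finite ballI eventually_smooth_near)

lemma dir_derivs_sum:
  assumes "finite I" "\<And>i. i \<in> I \<Longrightarrow> smooth_near (f i) x" "set bs \<subseteq> Basis"
  shows "dir_derivs bs (\<lambda>y. \<Sum>i\<in>I. f i y) x = (\<Sum>i\<in>I. dir_derivs bs (f i) x)"
  using assms(2,3)
proof (induction bs arbitrary: x)
  case (Cons b bs)
  have "eventually (\<lambda>y. \<forall>i\<in>I. smooth_near (f i) y) (nhds x)"
    by (rule eventually_smooth_near_all[OF assms(1) Cons.prems(1)])
  then have "eventually (\<lambda>y. dir_derivs bs (\<lambda>y. \<Sum>i\<in>I. f i y) y = (\<Sum>i\<in>I. dir_derivs bs (f i) y)) (nhds x)"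
    by eventually_elim (use Cons in auto)
  then have "dir_deriv b (dir_derivs bs (\<lambda>y. \<Sum>i\<in>I. f i y)) x = dir_deriv b (\<lambda>y. \<Sum>i\<in>I. dir_derivs bs (f i) y) x"
    by (rule dir_deriv_cong_nhds)
  also have "\<dots> = (\<Sum>i\<in>I. dir_deriv b (dir_derivs bs (f i)) x)"
    using Cons.prems by (intro dir_deriv_sum smooth_near_dir_derivs) auto
  finally show ?case by simp
qed simp

lemma dir_derivs_bounded_linear:
  assumes "bounded_linear L" "smooth_near f x" "set bs \<subseteq> Basis"
  shows "dir_derivs bs (\<lambda>y. L (f y)) x = L (dir_derivs bs f x)"
  using assms(2,3)
proof (induction bs arbitrary: x)
  case (Cons b bs)
  have "eventually (\<lambda>y. dir_derivs bs (\<lambda>y. L (f y)) y = L (dir_derivs bs f y)) (nhds x)"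
    using eventually_smooth_near[OF Cons.prems(1)] by eventually_elim (use Cons in auto)
  then have "dir_deriv b (dir_derivs bs (\<lambda>y. L (f y))) x = dir_deriv b (\<lambda>y. L (dir_derivs bs f y)) x"
    by (rule dir_deriv_cong_nhds)
  also have "\<dots> = L (dir_deriv b (dir_derivs bs f) x)"
    using Cons.prems by (intro dir_deriv_bounded_linear assms(1) smooth_near_dir_derivs) auto
  finally show ?case by simp
qed simp

lemma dir_derivs_cmult:
  fixes f :: "_ \<Rightarrow> real"
  shows "smooth_near f x \<Longrightarrow> set bs \<subseteq> Basis \<Longrightarrow> dir_derivs bs (\<lambda>y. c * f y) x = c * dir_derivs bs f x"
  by (rule dir_derivs_bounded_linear[OF bounded_linear_mult_right])

lemma dir_derivs_add:
  assumes "smooth_near f x" "smooth_near g x" "set bs \<subseteq> Basis"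
  shows "dir_derivs bs (\<lambda>y. f y + g y) x = dir_derivs bs f x + dir_derivs bs g x"
  using dir_derivs_sum[of "UNIV :: bool set" "\<lambda>i. if i then f else g" x bs] assms
  by (auto simp: UNIV_bool add.commute)

lemma dir_derivs_move_front:
  fixes f :: "'v::euclidean_space \<Rightarrow> real"
  assumes "smooth_near f x" "set (us @ b # vs) \<subseteq> Basis"
  shows "dir_derivs (us @ b # vs) f x = dir_derivs (b # us @ vs) f x"
  using assms
proof (induction us arbitrary: x)
  case (Cons u us)
  have "eventually (\<lambda>y. dir_derivs (us @ b # vs) f y = dir_derivs (b # us @ vs) f y) (nhds x)"
    using eventually_smooth_near[OF Cons.prems(1)] by eventually_elim (use Cons in auto)
  then have "dir_deriv u (dir_derivs (us @ b # vs) f) x = dir_deriv u (dir_derivs (b # us @ vs) f) x"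
    by (rule dir_deriv_cong_nhds)
  also have "\<dots> = dir_deriv u (dir_deriv b (dir_derivs (us @ vs) f)) x"
    by (simp only: dir_derivs_simps)
  also have "\<dots> = dir_deriv b (dir_deriv u (dir_derivs (us @ vs) f)) x"
    by (rule dir_deriv_commute) (use Cons.prems in \<open>auto intro!: smooth_near_dir_derivs\<close>)
  finally show ?case by simp
qed simp

text \<open>The first entry of one list is pulled to the front of the other by
  \<open>dir_derivs_move_front\<close>; for the remaining entries the induction hypothesis holds at
  all nearby points and may be differentiated.\<close>

lemma dir_derivs_mset:
  fixes f :: "'v::euclidean_space \<Rightarrow> real"
  assumes "smooth_near f x" "set bs \<subseteq> Basis" "mset bs = mset bs'"
  shows "dir_derivs bs f x = dir_derivs bs' f x"
  using assms
proof (induction bs arbitrary: bs' x)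
  case (Cons b bs)
  have "b \<in> set bs'" using Cons.prems(3) by (metis list.set_intros(1) set_mset_mset)
  then obtain us vs where bs': "bs' = us @ b # vs" by (meson split_list)
  have *: "mset bs = mset (us @ vs)" using Cons.prems(3) by (simp add: bs')
  then have sub: "set (us @ b # vs) \<subseteq> Basis"
    using Cons.prems(2) by (metis bs' Cons.prems(3) set_mset_mset)
  have "eventually (\<lambda>y. dir_derivs bs f y = dir_derivs (us @ vs) f y) (nhds x)"
    using eventually_smooth_near[OF Cons.prems(1)] by eventually_elim (rule Cons.IH[OF _ _ *], use Cons.prems in auto)
  then have "dir_deriv b (dir_derivs bs f) x = dir_deriv b (dir_derivs (us @ vs) f) x"
    by (rule dir_deriv_cong_nhds)
  then show ?case
    using dir_derivs_move_front[OF Cons.prems(1) sub] by (simp add: bs')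
qed simp

text \<open>Distributes the entries of a list over two sublists in all \<open>2 ^ length K\<close>
  ways. Keeping repetitions in a list makes the Leibniz rule free of coefficients; these appear only
  when the splittings are counted in \<open>sum_splits\<close>.\<close>

primrec splits :: "'i list \<Rightarrow> ('i list \<times> 'i list) list" where
  "splits [] = [([], [])]"
| "splits (i # K) = map (apfst (Cons i)) (splits K) @ map (apsnd (Cons i)) (splits K)"

lemma splits_mset: "p \<in> set (splits K) \<Longrightarrow> mset K = mset (fst p) + mset (snd p)"
  by (induction K arbitrary: p) auto

lemma splits_length: "p \<in> set (splits K) \<Longrightarrow> length K = length (fst p) + length (snd p)"
  by (induction K arbitrary: p) auto

lemma splits_subset: "p \<in> set (splits K) \<Longrightarrow> set K \<subseteq> B \<Longrightarrow> set (fst p) \<subseteq> B \<and> set (snd p) \<subseteq> B"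
  using splits_mset[of p K] by (metis le_sup_iff set_mset_mset set_mset_union)

lemma splits_map: "splits (map f K) = map (map_prod (map f) (map f)) (splits K)"
  by (induction K) (simp_all add: o_def apfst_def apsnd_def map_prod_def case_prod_unfold)

lemma smooth_near_sum_list:
  "(\<And>i. i \<in> set xs \<Longrightarrow> smooth_near (f i) x) \<Longrightarrow> smooth_near (\<lambda>y. \<Sum>i\<leftarrow>xs. f i y) x"
  by (induction xs) (auto intro: smooth_near_add smooth_near_const)

lemma dir_deriv_sum_list:
  "(\<And>i. i \<in> set xs \<Longrightarrow> smooth_near (f i) x) \<Longrightarrow> b \<in> Basis \<Longrightarrow>
   dir_deriv b (\<lambda>y. \<Sum>i\<leftarrow>xs. f i y) x = (\<Sum>i\<leftarrow>xs. dir_deriv b (f i) x)"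
  by (induction xs) (simp_all add: dir_deriv_add smooth_near_sum_list)

lemma dir_derivs_mult:
  fixes f g :: "'v::euclidean_space \<Rightarrow> real"
  assumes "smooth_near f x" "smooth_near g x" "set K \<subseteq> Basis"
  shows "dir_derivs K (\<lambda>y. f y * g y) x
    = (\<Sum>p\<leftarrow>splits K. dir_derivs (fst p) f x * dir_derivs (snd p) g x)"
  using assms
proof (induction K arbitrary: x)
  case (Cons b K)
  have "eventually (\<lambda>y. dir_derivs K (\<lambda>y. f y * g y) y
      = (\<Sum>p\<leftarrow>splits K. dir_derivs (fst p) f y * dir_derivs (snd p) g y)) (nhds x)"
    using eventually_smooth_near[OF Cons.prems(1)] eventually_smooth_near[OF Cons.prems(2)]
    by eventually_elim (use Cons in auto)
  then have "dir_deriv b (dir_derivs K (\<lambda>y. f y * g y)) x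
      = dir_deriv b (\<lambda>y. \<Sum>p\<leftarrow>splits K. dir_derivs (fst p) f y * dir_derivs (snd p) g y) x"
    by (rule dir_deriv_cong_nhds)
  also have "\<dots> = (\<Sum>p\<leftarrow>splits K. dir_deriv b (\<lambda>y. dir_derivs (fst p) f y * dir_derivs (snd p) g y) x)"
    using Cons.prems splits_subset[of _ K Basis]
    by (intro dir_deriv_sum_list smooth_near_mult smooth_near_dir_derivs) auto
  also have "\<dots> = (\<Sum>p\<leftarrow>splits K. dir_deriv b (dir_derivs (fst p) f) x * dir_derivs (snd p) g x
      + dir_derivs (fst p) f x * dir_deriv b (dir_derivs (snd p) g) x)"
    using Cons.prems splits_subset[of _ K Basis]
    by (intro arg_cong[of _ _ sum_list] map_cong dir_deriv_mult smooth_near_dir_derivs) auto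
  finally show ?case by (simp add: o_def sum_list_addf)
qed simp

text \<open>The Leibniz rule read backwards, as in integration by parts. Since \<open>g\<close>
  times the \<open>b\<close>-derivative of a function is the derivative of the product minus
  \<open>dir_deriv b g\<close> times that function, the induction hypothesis is used both for
  \<open>g\<close> and for \<open>dir_deriv b g\<close>.\<close>

lemma mult_dir_derivs:
  fixes g h :: "'v::euclidean_space \<Rightarrow> real"
  assumes "smooth_near g x" "smooth_near h x" "set K \<subseteq> Basis"
  shows "g x * dir_derivs K h x
    = (\<Sum>p\<leftarrow>splits K. (-1) ^ length (fst p) * dir_derivs (snd p) (\<lambda>y. dir_derivs (fst p) g y * h y) x)"
  using assms
proof (induction K arbitrary: g x)
  case (Cons b K)
  have b: "b \<in> Basis" and K: "set K \<subseteq> Basis" using Cons.prems by auto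
  have sub: "set (fst p) \<subseteq> Basis" "set (snd p) \<subseteq> Basis" if "p \<in> set (splits K)" for p
    using splits_subset[OF that K] by auto
  have "eventually (\<lambda>y. g y * dir_derivs K h y = (\<Sum>p\<leftarrow>splits K. (-1) ^ length (fst p) *
      dir_derivs (snd p) (\<lambda>y. dir_derivs (fst p) g y * h y) y)) (nhds x)"
    using eventually_smooth_near[OF Cons.prems(1)] eventually_smooth_near[OF Cons.prems(2)]
    by eventually_elim (rule Cons.IH[OF _ _ K])
  then have "dir_deriv b (\<lambda>y. g y * dir_derivs K h y) x
    = dir_deriv b (\<lambda>y. \<Sum>p\<leftarrow>splits K. (-1) ^ length (fst p) *
      dir_derivs (snd p) (\<lambda>y. dir_derivs (fst p) g y * h y) y) x"
    by (rule dir_deriv_cong_nhds)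
  also have "\<dots> = (\<Sum>p\<leftarrow>splits K. dir_deriv b (\<lambda>y. (-1) ^ length (fst p) *
      dir_derivs (snd p) (\<lambda>y. dir_derivs (fst p) g y * h y) y) x)"
    using Cons.prems sub b
    by (intro dir_deriv_sum_list smooth_near_mult smooth_near_const smooth_near_dir_derivs) auto
  also have "\<dots> = (\<Sum>p\<leftarrow>splits K. (-1) ^ length (fst p) *
      dir_deriv b (dir_derivs (snd p) (\<lambda>y. dir_derivs (fst p) g y * h y)) x)"
    using Cons.prems sub b
    by (intro arg_cong[of _ _ sum_list] map_cong refl dir_deriv_cmult smooth_near_mult smooth_near_dir_derivs) auto
  finally have 1: "dir_deriv b g x * dir_derivs K h x + g x * dir_deriv b (dir_derivs K h) x = \<dots>"
    using Cons.prems b K by (subst (asm) dir_deriv_mult) (auto intro: smooth_near_dir_derivs)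
  have "dir_deriv b g x * dir_derivs K h x = (\<Sum>p\<leftarrow>splits K. (-1) ^ length (fst p) *
      dir_derivs (snd p) (\<lambda>y. dir_derivs (fst p) (dir_deriv b g) y * h y) x)"
    by (rule Cons.IH[OF _ _ K]) (use Cons.prems b in \<open>auto intro: smooth_near_dir_deriv\<close>)
  \<comment> \<open>The hypothesis for \<open>dir_deriv b g\<close> has \<open>b\<close> as
    innermost direction, while \<open>splits\<close> puts it in front; the derivatives commute at
    every point near \<open>x\<close>.\<close>
  also have "\<dots> = (\<Sum>p\<leftarrow>splits K. (-1) ^ length (fst p) *
      dir_derivs (snd p) (\<lambda>y. dir_derivs (b # fst p) g y * h y) x)"
  proof (intro arg_cong[of _ _ sum_list] map_cong refl arg_cong2[of _ _ _ _ "(*)"] dir_derivs_cong_nhds)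
    fix p assume p: "p \<in> set (splits K)"
    show "\<forall>\<^sub>F y in nhds x. dir_derivs (fst p) (dir_deriv b g) y * h y = dir_derivs (b # fst p) g y * h y"
      using eventually_smooth_near[OF Cons.prems(1)]
    proof eventually_elim
      case (elim y)
      have "dir_derivs (fst p @ [b]) g y = dir_derivs (b # fst p) g y"
        by (rule dir_derivs_mset[OF elim]) (use sub[OF p] b in auto)
      then show ?case by simp
    qed
  qed
  finally have 2: "dir_deriv b g x * dir_derivs K h x = \<dots>" .
  have "(\<Sum>p\<leftarrow>splits K. (-1) ^ length (b # fst p) * dir_derivs (snd p) (\<lambda>y. dir_derivs (b # fst p) g y * h y) x)
    = - (dir_deriv b g x * dir_derivs K h x)"
    unfolding 2 by (simp add: uminus_sum_list_map o_def)
  then show ?case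
    using 1 by (simp add: o_def)
qed simp

section \<open>Sums over multi-indices and over their splittings\<close>

lemma finite_lists_le [simp]: "finite {K::'n::finite list. length K \<le> m}"
  using finite_lists_length_le[of "UNIV::'n set" m] by simp

lemma finite_lists_eq [simp]: "finite {K::'n::finite list. length K = m}"
  using finite_lists_length_eq[of "UNIV::'n set" m] by simp

lemma sum_lists_Suc:
  fixes f :: "'n::finite list \<Rightarrow> real"
  shows "(\<Sum>K | length K = Suc m. f K) = (\<Sum>i\<in>UNIV. \<Sum>K | length K = m. f (i # K))"
proof -
  have "(\<Sum>K | length K = Suc m. f K) = (\<Sum>(i, K)\<in>UNIV \<times> {K. length K = m}. f (i # K))"
    by (rule sum.reindex_bij_witness[where i="\<lambda>(i, K). i # K" and j="\<lambda>K. (hd K, tl K)"])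
      (auto simp: length_Suc_conv)
  then show ?thesis by (simp add: sum.cartesian_product)
qed

lemma sum_lists_le:
  fixes f :: "'n::finite list \<Rightarrow> real"
  shows "(\<Sum>K | length K \<le> s. f K) = (\<Sum>m\<le>s. \<Sum>K | length K = m. f K)"
proof -
  have "{K::'n list. length K \<le> s} = (\<Union>m\<in>{..s}. {K. length K = m})" by auto
  also have "sum f \<dots> = (\<Sum>m\<le>s. \<Sum>K | length K = m. f K)"
    by (rule sum.UNION_disjoint) auto
  finally show ?thesis .
qed

text \<open>A pair \<open>(I, J)\<close> arises once for every way of interleaving \<open>I\<close>
  and \<open>J\<close>. The first entry of \<open>K\<close> belongs to one of the two halves, which
  turns the recursion into Pascal's rule.\<close>

lemma sum_splits_length:
  fixes F :: "'n::finite list \<Rightarrow> 'n list \<Rightarrow> real"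
  shows "(\<Sum>K | length K = m. \<Sum>p\<leftarrow>splits K. F (fst p) (snd p))
    = (\<Sum>j\<le>m. real (m choose j) * (\<Sum>I | length I = j. \<Sum>J | length J = m - j. F I J))"
proof (induction m arbitrary: F)
  case 0
  show ?case by simp
next
  case (Suc m)
  define S where "S = (\<lambda>a b. \<Sum>I | length I = a. \<Sum>J | length J = b. F I J)"
  have S1: "(\<Sum>i\<in>UNIV. \<Sum>I | length I = a. \<Sum>J | length J = b. F (i # I) J) = S (Suc a) b" for a b
    unfolding S_def by (rule sum_lists_Suc[symmetric])
  have S2: "(\<Sum>i\<in>UNIV. \<Sum>I | length I = a. \<Sum>J | length J = b. F I (i # J)) = S a (Suc b)" for a b
    unfolding S_def by (subst sum.swap) (simp add: sum_lists_Suc)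
  have "(\<Sum>K | length K = Suc m. \<Sum>p\<leftarrow>splits K. F (fst p) (snd p))
    = (\<Sum>i\<in>UNIV. \<Sum>K | length K = m. \<Sum>p\<leftarrow>splits K. F (i # fst p) (snd p))
      + (\<Sum>i\<in>UNIV. \<Sum>K | length K = m. \<Sum>p\<leftarrow>splits K. F (fst p) (i # snd p))"
    by (simp add: sum_lists_Suc o_def sum.distrib)
  also have "\<dots> = (\<Sum>j\<le>m. real (m choose j) * S (Suc j) (m - j)) + (\<Sum>j\<le>m. real (m choose j) * S j (Suc (m - j)))"
    unfolding Suc.IH[of "\<lambda>I J. F (_ # I) J"] Suc.IH[of "\<lambda>I J. F I (_ # J)"] S1[symmetric] S2[symmetric]
    by (simp add: sum.swap[of _ "{..m}"] sum_distrib_left)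
  \<comment> \<open>The added summand \<open>j = Suc m\<close> vanishes because
    \<open>m choose Suc m = 0\<close>; it prepares the index shift.\<close>
  also have "(\<Sum>j\<le>m. real (m choose j) * S j (Suc (m - j))) = (\<Sum>j\<le>Suc m. real (m choose j) * S j (Suc m - j))"
    by (simp add: Suc_diff_le)
  also have "\<dots> = S 0 (Suc m) + (\<Sum>j\<le>m. real (m choose Suc j) * S (Suc j) (m - j))"
    by (subst sum.atMost_Suc_shift) simp
  also have "(\<Sum>j\<le>m. real (m choose j) * S (Suc j) (m - j)) + \<dots>
    = S 0 (Suc m) + (\<Sum>j\<le>m. real (Suc m choose Suc j) * S (Suc j) (m - j))"
    by (simp add: sum.distrib algebra_simps)
  also have "\<dots> = (\<Sum>j\<le>Suc m. real (Suc m choose j) * S j (Suc m - j))"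
    by (subst sum.atMost_Suc_shift) simp
  finally show ?case by (simp add: S_def)
qed

text \<open>Brings the double sum produced by a Leibniz rule into the shape of the Lie-Euler
  operators: an outer index \<open>J\<close>, an inner \<open>I\<close> of length at most
  \<open>s - length J\<close>, and their binomial coefficient.\<close>

lemma sum_splits:
  fixes F :: "'n::finite list \<Rightarrow> 'n list \<Rightarrow> real"
  shows "(\<Sum>K | length K \<le> s. \<Sum>p\<leftarrow>splits K. F (fst p) (snd p))
    = (\<Sum>J | length J \<le> s. \<Sum>I | length I \<le> s - length J.
         real ((length I + length J) choose length I) * F I J)"
proof -
  define S where "S = (\<lambda>a b. real ((a + b) choose a) * (\<Sum>I | length I = a. \<Sum>J | length J = b. F I J))"
  have "(\<Sum>K | length K \<le> s. \<Sum>p\<leftarrow>splits K. F (fst p) (snd p)) = (\<Sum>m\<le>s. \<Sum>a\<le>m. S a (m - a))"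
    unfolding sum_lists_le sum_splits_length by (simp add: S_def)
  also have "\<dots> = (\<Sum>(a, b)\<in>{(a, b). a + b \<le> s}. S a b)"
    using sum.triangle_reindex_eq[of "\<lambda>a b. S a b" s] by simp
  also have "\<dots> = (\<Sum>(b, a)\<in>(SIGMA b:{..s}. {..s - b}). S a b)"
    by (rule sum.reindex_bij_witness[where i="\<lambda>(b, a). (a, b)" and j="\<lambda>(a, b). (b, a)"]) auto
  also have "\<dots> = (\<Sum>b\<le>s. \<Sum>a\<le>s - b. S a b)"
    by (simp add: sum.Sigma)
  also have "\<dots> = (\<Sum>b\<le>s. \<Sum>J | length J = b. \<Sum>a\<le>s - b. \<Sum>I | length I = a.
      real ((length I + length J) choose length I) * F I J)"
  proof (intro sum.cong refl)
    fix b
    have "(\<Sum>J | length J = b. \<Sum>a\<le>s - b. \<Sum>I | length I = a. real ((length I + length J) choose length I) * F I J)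
      = (\<Sum>a\<le>s - b. \<Sum>J | length J = b. \<Sum>I | length I = a. real ((a + b) choose a) * F I J)"
      by (subst sum.swap) (intro sum.cong refl, auto)
    also have "\<dots> = (\<Sum>a\<le>s - b. S a b)"
      unfolding S_def sum_distrib_left by (intro sum.cong refl sum.swap)
    finally show "(\<Sum>a\<le>s - b. S a b) = (\<Sum>J | length J = b. \<Sum>a\<le>s - b. \<Sum>I | length I = a.
      real ((length I + length J) choose length I) * F I J)" ..
  qed
  also have "\<dots> = (\<Sum>J | length J \<le> s. \<Sum>I | length I \<le> s - length J.
         real ((length I + length J) choose length I) * F I J)"
    unfolding sum_lists_le by (intro sum.cong refl) auto
  finally show ?thesis .
qed

section \<open>Iterated partial derivatives\<close>

lemma smooth_near_iter_partial: "smooth_near f x \<Longrightarrow> smooth_near (iter_partial J f) x"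
  unfolding iter_partial_dir_derivs by (rule smooth_near_dir_derivs) auto

lemma iter_partial_simps [simp]:
  "iter_partial [] f = f"
  "iter_partial (j # J) f = dir_deriv (axis j 1) (iter_partial J f)"
  "iter_partial (I @ J) f = iter_partial I (iter_partial J f)"
  by (simp_all add: iter_partial_def)

lemma iter_partial_cong_nhds:
  "eventually (\<lambda>y. f y = g y) (nhds x) \<Longrightarrow> iter_partial J f x = iter_partial J g x"
  unfolding iter_partial_dir_derivs by (rule dir_derivs_cong_nhds)

lemma iter_partial_shift: "iter_partial J (\<lambda>y. f (y + c)) x = iter_partial J f (x + c)"
  unfolding iter_partial_dir_derivs by (rule dir_derivs_shift)

lemma iter_partial_sum:
  "finite I \<Longrightarrow> (\<And>i. i \<in> I \<Longrightarrow> smooth_near (f i) x) \<Longrightarrow>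
   iter_partial J (\<lambda>y. \<Sum>i\<in>I. f i y) x = (\<Sum>i\<in>I. iter_partial J (f i) x)"
  unfolding iter_partial_dir_derivs by (rule dir_derivs_sum) auto

lemma iter_partial_cmult:
  "smooth_near f x \<Longrightarrow> iter_partial J (\<lambda>y. c * f y) x = c * iter_partial J f x"
  unfolding iter_partial_dir_derivs by (rule dir_derivs_cmult) auto

lemma iter_partial_add:
  "smooth_near f x \<Longrightarrow> smooth_near g x \<Longrightarrow>
   iter_partial J (\<lambda>y. f y + g y) x = iter_partial J f x + iter_partial J g x"
  unfolding iter_partial_dir_derivs by (rule dir_derivs_add) auto

lemma iter_partial_mset:
  "smooth_near f x \<Longrightarrow> mset J = mset J' \<Longrightarrow> iter_partial J f x = iter_partial J' f x"
  unfolding iter_partial_dir_derivs by (rule dir_derivs_mset) auto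

lemma iter_partial_mult:
  assumes "smooth_near f x" "smooth_near g x"
  shows "iter_partial K (\<lambda>y. f y * g y) x
    = (\<Sum>p\<leftarrow>splits K. iter_partial (fst p) f x * iter_partial (snd p) g x)"
  unfolding iter_partial_dir_derivs
  by (subst dir_derivs_mult[OF assms]) (auto simp: splits_map o_def)

lemma mult_iter_partial:
  assumes "smooth_near g x" "smooth_near h x"
  shows "g x * iter_partial K h x
    = (\<Sum>p\<leftarrow>splits K. (-1) ^ length (fst p) * iter_partial (snd p) (\<lambda>y. iter_partial (fst p) g y * h y) x)"
  unfolding iter_partial_dir_derivs
  by (subst mult_dir_derivs[OF assms]) (auto simp: splits_map o_def)

lemma iter_partial_zero: "iter_partial J (\<lambda>y. 0) x = 0"
proof (induction J arbitrary: x)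
  case (Cons j J)
  then have "iter_partial J (\<lambda>y. 0) = (\<lambda>y. 0)" by auto
  then show ?case by simp
qed simp

section \<open>Monomials, weights of multi-indices and Taylor polynomials\<close>

definition monom_at :: "real ^ 'n \<Rightarrow> ('n \<Rightarrow> nat) \<Rightarrow> real ^ 'n \<Rightarrow> real" where
  "monom_at x0 k u = (\<Prod>l\<in>UNIV. (u $ l - x0 $ l) ^ k l)"

lemma smooth_near_component: "smooth_near (\<lambda>u::real^'n. u $ l) x"
  by (rule smooth_near_linear) (rule bounded_linear_vec_nth)

lemma smooth_near_monom_at: "smooth_near (monom_at x0 k) x"
  unfolding monom_at_def[abs_def]
  by (intro smooth_near_prod smooth_near_power smooth_near_diff smooth_near_component smooth_near_const)

lemma dir_deriv_monom_at:
  "dir_deriv (axis i 1) (monom_at x0 k) u = real (k i) * monom_at x0 (k(i := k i - 1)) u"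
proof -
  let ?R = "\<Prod>l\<in>UNIV - {i}. (u $ l - x0 $ l) ^ k l"
  have split: "monom_at x0 k' v = (v $ i - x0 $ i) ^ k' i * (\<Prod>l\<in>UNIV - {i}. (v $ l - x0 $ l) ^ k' l)" for k' v
    unfolding monom_at_def by (rule prod.remove) auto
  have "monom_at x0 k (u + h *\<^sub>R axis i 1) = (u $ i + h - x0 $ i) ^ k i * ?R" for h
    unfolding split by (intro arg_cong2[of _ _ _ _ "(*)"] prod.cong) (auto simp: axis_def)
  moreover have "((\<lambda>h. (u $ i + h - x0 $ i) ^ k i * ?R) has_real_derivative
      real (k i) * (u $ i - x0 $ i) ^ (k i - 1) * ?R) (at 0)"
    by (auto intro!: derivative_eq_intros)
  ultimately have "has_dir_deriv (axis i 1) (monom_at x0 k) u (real (k i) * (u $ i - x0 $ i) ^ (k i - 1) * ?R)"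
    by (simp add: has_real_derivative_iff_has_vector_derivative)
  moreover have "monom_at x0 (k(i := k i - 1)) u = (u $ i - x0 $ i) ^ (k i - 1) * ?R"
    unfolding split by (intro arg_cong2[of _ _ _ _ "(*)"] prod.cong) auto
  ultimately show ?thesis by (simp add: dir_deriv_eq)
qed

text \<open>The induction runs from the end of \<open>J\<close>, because the last entry is the
  derivative applied first, and it lowers one exponent of the monomial.\<close>

lemma iter_partial_monom_at:
  "iter_partial J (monom_at x0 k) x0 = (if count (mset J) = k then \<Prod>l\<in>UNIV. fact (k l) else 0)"
proof (induction J arbitrary: k rule: rev_induct)
  case Nil
  show ?case
  proof (cases "k = (\<lambda>_. 0)")
    case False
    then obtain l where "k l \<noteq> 0" by auto
    then have "monom_at x0 k x0 = 0"
      unfolding monom_at_def by (intro prod_zero) (auto intro!: bexI[of _ l])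
    then show ?thesis using False by (auto simp: zero_multiset.rep_eq)
  qed (simp add: monom_at_def zero_multiset.rep_eq)
next
  case (snoc i J)
  have "iter_partial (J @ [i]) (monom_at x0 k) x0 = iter_partial J (\<lambda>u. real (k i) * monom_at x0 (k(i := k i - 1)) u) x0"
    by (simp add: dir_deriv_monom_at[abs_def])
  also have "\<dots> = real (k i) * iter_partial J (monom_at x0 (k(i := k i - 1))) x0"
    by (rule iter_partial_cmult) (rule smooth_near_monom_at)
  also have "\<dots> = (if count (mset (J @ [i])) = k then \<Prod>l\<in>UNIV. fact (k l) else 0)"
  proof (cases "k i")
    case 0
    then have "count (mset (J @ [i])) \<noteq> k" by (metis count_greater_zero_iff in_multiset_in_set list.set_intros(1) not_in_iff set_append UnI2)
    then show ?thesis using 0 by simp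
  next
    case (Suc m)
    have "(count (mset (J @ [i])) = k) \<longleftrightarrow> (count (mset J) = k(i := m))"
      using Suc by (auto simp: fun_eq_iff)
    moreover have "(\<Prod>l\<in>UNIV. fact (k l)) = real (k i) * (\<Prod>l\<in>UNIV. fact ((k(i := m)) l))"
    proof -
      have "(\<Prod>l\<in>UNIV - {i}. fact (k l)) = (\<Prod>l\<in>UNIV - {i}. (fact ((k(i := m)) l) :: real))"
        by (intro prod.cong) auto
      then show ?thesis
        using Suc by (subst (1 2) prod.remove[of UNIV i]) auto
    qed
    ultimately show ?thesis by (simp add: snoc.IH Suc fun_upd_def)
  qed
  finally show ?case .
qed

text \<open>The factorial of a multi-index. Divided by \<open>fact (size M)\<close> it is the
  reciprocal of the number of orderings of \<open>M\<close>.\<close>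

definition list_weight :: "'n::finite multiset \<Rightarrow> real" where
  "list_weight M = (\<Prod>l\<in>UNIV. fact (count M l))"

lemma list_weight_pos: "list_weight M > 0"
  unfolding list_weight_def by (simp add: prod_pos)

lemma card_lists_mset: "real (card {J. mset J = M}) * list_weight M = fact (size M)"
proof -
  have "(\<Prod>l\<in>UNIV. fact (count M l)) = (\<Prod>l\<in>set_mset M. (fact (count M l) :: nat))"
    by (rule prod.mono_neutral_right) (auto simp: not_in_iff)
  then have "(\<Prod>l\<in>UNIV. fact (count M l)) = (\<Prod>l\<in>set_mset M. (fact (count M l) :: real))"
    by (metis (mono_tags, lifting) of_nat_fact of_nat_prod prod.cong)
  moreover have "{J. mset J = M} = permutations_of_multiset M"
    by (simp add: permutations_of_multiset_def)
  moreover have "real (card (permutations_of_multiset M) * (\<Prod>l\<in>set_mset M. fact (count M l))) = real (fact (size M))"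
    by (simp only: card_permutations_of_multiset_aux)
  ultimately show ?thesis
    unfolding list_weight_def by simp
qed

lemma finite_msets_le [simp]: "finite {M::'n::finite multiset. size M \<le> s}"
proof -
  have "{M::'n multiset. size M \<le> s} \<subseteq> mset ` {J. length J \<le> s}"
    by (metis (mono_tags, lifting) ex_mset image_eqI mem_Collect_eq size_mset subsetI)
  then show ?thesis by (rule finite_subset) auto
qed

text \<open>A multiset \<open>M\<close> has \<open>fact (size M) / list_weight M\<close> orderings.
  Hence the factor built into \<open>vpartial\<close> turns sums over independent coordinates into
  sums over all sequences.\<close>

lemma sum_lists_mset:
  fixes f :: "'n::finite multiset \<Rightarrow> real"
  shows "(\<Sum>J | length J \<le> s. list_weight (mset J) / fact (length J) * f (mset J)) = (\<Sum>M | size M \<le> s. f M)"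
proof -
  have "(\<Sum>J | length J \<le> s. list_weight (mset J) / fact (length J) * f (mset J))
    = (\<Sum>M | size M \<le> s. \<Sum>J | J \<in> {J. length J \<le> s} \<and> mset J = M. list_weight (mset J) / fact (length J) * f (mset J))"
    by (rule sum.group[symmetric]) auto
  also have "\<dots> = (\<Sum>M | size M \<le> s. f M)"
  proof (rule sum.cong[OF refl])
    fix M :: "'n multiset" assume M: "M \<in> {M. size M \<le> s}"
    then have eq: "{J \<in> {J. length J \<le> s}. mset J = M} = {J. mset J = M}"
      by auto
    have "(\<Sum>J | mset J = M. list_weight (mset J) / fact (length J) * f (mset J))
        = (\<Sum>J | mset J = M. list_weight M / fact (size M) * f M)"
      by (rule sum.cong) auto
    also have "\<dots> = f M"
      using card_lists_mset[of M] by (simp add: field_simps)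
    finally show "(\<Sum>J | J \<in> {J. length J \<le> s} \<and> mset J = M. list_weight (mset J) / fact (length J) * f (mset J)) = f M"
      unfolding eq .
  qed
  finally show ?thesis .
qed

text \<open>The division by \<open>list_weight M\<close> makes \<open>a M\<close> the derivative at
  0 itself, so any prescribed jet coordinates are realised by a polynomial.\<close>

definition taylor_poly :: "nat \<Rightarrow> ('n::finite multiset \<Rightarrow> real) \<Rightarrow> real ^ 'n \<Rightarrow> real" where
  "taylor_poly s a u = (\<Sum>M | size M \<le> s. a M * (monom_at 0 (count M) u / list_weight M))"

lemma smooth_near_taylor_poly: "smooth_near (taylor_poly s a) x"
  unfolding taylor_poly_def[abs_def] divide_inverse
  by (intro smooth_near_sum smooth_near_mult smooth_near_const smooth_near_monom_at)

lemma iter_partial_taylor_poly: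
  assumes "length J \<le> s"
  shows "iter_partial J (taylor_poly s a) 0 = a (mset J)"
proof -
  have *: "taylor_poly s a = (\<lambda>u. \<Sum>M | size M \<le> s. (a M / list_weight M) * monom_at 0 (count M) u)"
    by (auto simp: taylor_poly_def fun_eq_iff)
  have "iter_partial J (taylor_poly s a) 0
    = (\<Sum>M | size M \<le> s. iter_partial J (\<lambda>u. (a M / list_weight M) * monom_at 0 (count M) u) 0)"
    unfolding * by (rule iter_partial_sum[OF finite_msets_le])
      (intro smooth_near_mult smooth_near_const smooth_near_monom_at)
  also have "\<dots> = (\<Sum>M | size M \<le> s. a M / list_weight M * iter_partial J (monom_at 0 (count M)) 0)"
    by (intro sum.cong refl iter_partial_cmult smooth_near_monom_at)
  also have "\<dots> = (\<Sum>M | size M \<le> s. if M = mset J then a M else 0)"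
    using list_weight_pos by (intro sum.cong refl) (auto simp: iter_partial_monom_at list_weight_def count_inject)
  also have "\<dots> = a (mset J)" using assms by (subst sum.delta) auto
  finally show ?thesis .
qed

text \<open>Testing on a monomial centred at \<open>x\<close> isolates the orderings of
  \<open>K\<close>. The operator sees only the sum of their coefficients, so symmetry in the
  multi-index is what allows a single coefficient to be recovered.\<close>

lemma operator_coeff_unique:
  fixes c d :: "'n::finite list \<Rightarrow> real"
  assumes "\<And>\<eta>. smooth_near \<eta> x \<Longrightarrow> (\<Sum>J | length J \<le> s. c J * iter_partial J \<eta> x) = (\<Sum>J | length J \<le> s. d J * iter_partial J \<eta> x)"
    and "\<And>J J'. mset J = mset J' \<Longrightarrow> c J = c J'" "\<And>J J'. mset J = mset J' \<Longrightarrow> d J = d J'"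
    and K: "length K \<le> s"
  shows "c K = d K"
proof -
  have ev: "(\<Sum>J | length J \<le> s. e J * iter_partial J (monom_at x (count (mset K))) x) = real (card {J. mset J = mset K}) * list_weight (mset K) * e K"
    if e: "\<And>J J'. mset J = mset J' \<Longrightarrow> e J = e J'" for e :: "'n list \<Rightarrow> real"
  proof -
    have "(\<Sum>J | length J \<le> s. e J * iter_partial J (monom_at x (count (mset K))) x)
      = (\<Sum>J | length J \<le> s. if mset J = mset K then e K * list_weight (mset K) else 0)"
    proof (intro sum.cong refl)
      fix J
      show "e J * iter_partial J (monom_at x (count (mset K))) x = (if mset J = mset K then e K * list_weight (mset K) else 0)"
        using e[of J K] by (cases "mset J = mset K") (simp_all add: iter_partial_monom_at list_weight_def count_inject)
    qed
    also have "\<dots> = (\<Sum>J\<in>{J \<in> {J. length J \<le> s}. mset J = mset K}. e K * list_weight (mset K))"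
      by (subst sum.inter_filter) auto
    also have "{J \<in> {J. length J \<le> s}. mset J = mset K} = {J. mset J = mset K}"
      using K by (auto dest: mset_eq_length)
    finally show ?thesis by (simp add: mult_ac)
  qed
  have evc: "(\<Sum>J | length J \<le> s. c J * iter_partial J (monom_at x (count (mset K))) x) = real (card {J. mset J = mset K}) * list_weight (mset K) * c K"
    by (rule ev, rule assms(2))
  have evd: "(\<Sum>J | length J \<le> s. d J * iter_partial J (monom_at x (count (mset K))) x) = real (card {J. mset J = mset K}) * list_weight (mset K) * d K"
    by (rule ev, rule assms(3))
  have "real (card {J. mset J = mset K}) * list_weight (mset K) * c K = real (card {J. mset J = mset K}) * list_weight (mset K) * d K"
    using assms(1)[OF smooth_near_monom_at, of x "count (mset K)"] unfolding evc evd .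
  then show ?thesis unfolding card_lists_mset by simp
qed

text \<open>Jets compose. The innermost derivative is expanded by the chain rule and the remaining
  ones by Leibniz, which leaves shorter strings acting on \<open>dir_deriv b h\<close> after
  \<open>f\<close> or \<open>g\<close>; hence the induction on length with \<open>h\<close>
  arbitrary. Innermost means last in the list, hence \<open>rev_cases\<close>.\<close>

lemma dir_derivs_compose_cong:
  fixes f g :: "'v::euclidean_space \<Rightarrow> 'w::euclidean_space" and h :: "'w \<Rightarrow> real"
  assumes f: "smooth_near f x" and g: "smooth_near g x" and "smooth_near h (f x)"
    and eq: "\<And>bs b. set bs \<subseteq> Basis \<Longrightarrow> length bs \<le> s \<Longrightarrow> b \<in> Basis \<Longrightarrow>
      dir_derivs bs (\<lambda>y. f y \<bullet> b) x = dir_derivs bs (\<lambda>y. g y \<bullet> b) x"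
    and "set bs \<subseteq> Basis" "length bs \<le> s"
  shows "dir_derivs bs (\<lambda>y. h (f y)) x = dir_derivs bs (\<lambda>y. h (g y)) x"
  using assms(3,5,6)
proof (induction "length bs" arbitrary: bs h rule: less_induct)
  case less
  have fg: "f x = g x"
    using eq[of "[]"] by (auto intro: euclidean_eqI)
  show ?case
  proof (cases bs rule: rev_cases)
    case Nil
    then show ?thesis by (simp add: fg)
  next
    case (snoc cs d)
    have d: "d \<in> Basis" and cs: "set cs \<subseteq> Basis" "length cs < length bs" using less.prems by (auto simp: snoc)
    have expand: "dir_derivs bs (\<lambda>y. h (k y)) x = (\<Sum>b\<in>Basis. \<Sum>p\<leftarrow>splits cs.
        dir_derivs (fst p @ [d]) (\<lambda>y. k y \<bullet> b) x * dir_derivs (snd p) (\<lambda>y. dir_deriv b h (k y)) x)"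
      if k: "smooth_near k x" "k x = f x" for k
    proof -
      have hk: "smooth_near h (k x)" using less.prems(1) k by simp
      have kb: "smooth_near (\<lambda>y. k y \<bullet> b) x" for b
        by (rule smooth_near_bounded_linear[OF bounded_linear_inner_left k(1)])
      have kh: "smooth_near (\<lambda>y. dir_deriv b h (k y)) x" if "b \<in> Basis" for b
        by (rule smooth_near_compose[OF k(1) smooth_near_dir_deriv[OF hk that]])
      have "eventually (\<lambda>y. smooth_near h (k y)) (nhds x)"
        using eventually_smooth_near[OF hk] smooth_near_isCont[OF k(1)]
        by (auto simp: isCont_def tendsto_at_iff_tendsto_nhds intro: eventually_compose_filterlim)
      then have "eventually (\<lambda>y. dir_deriv d (\<lambda>y. h (k y)) y = (\<Sum>b\<in>Basis. dir_deriv d (\<lambda>y. k y \<bullet> b) y * dir_deriv b h (k y))) (nhds x)"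
        using eventually_smooth_near[OF k(1)]
        by eventually_elim (subst dir_deriv_compose, use d in auto)
      then have "dir_derivs bs (\<lambda>y. h (k y)) x
        = dir_derivs cs (\<lambda>y. \<Sum>b\<in>Basis. dir_deriv d (\<lambda>y. k y \<bullet> b) y * dir_deriv b h (k y)) x"
        unfolding snoc dir_derivs_simps by (rule dir_derivs_cong_nhds)
      also have "\<dots> = (\<Sum>b\<in>Basis. dir_derivs cs (\<lambda>y. dir_deriv d (\<lambda>y. k y \<bullet> b) y * dir_deriv b h (k y)) x)"
        by (rule dir_derivs_sum, simp, rule smooth_near_mult, rule smooth_near_dir_deriv[OF kb d], erule kh, rule cs)
      also have "\<dots> = (\<Sum>b\<in>Basis. \<Sum>p\<leftarrow>splits cs.
        dir_derivs (fst p @ [d]) (\<lambda>y. k y \<bullet> b) x * dir_derivs (snd p) (\<lambda>y. dir_deriv b h (k y)) x)"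
        by (intro sum.cong refl, subst dir_derivs_mult)
          (use cs d kb kh in \<open>auto intro: smooth_near_dir_deriv\<close>)
      finally show ?thesis .
    qed
    show ?thesis
      unfolding expand[OF f refl] expand[OF g fg[symmetric]]
    proof (intro sum.cong refl arg_cong[of _ _ sum_list] map_cong arg_cong2[of _ _ _ _ "(*)"])
      fix b :: 'w and p assume b: "b \<in> Basis" and p: "p \<in> set (splits cs)"
      show "dir_derivs (fst p @ [d]) (\<lambda>y. f y \<bullet> b) x = dir_derivs (fst p @ [d]) (\<lambda>y. g y \<bullet> b) x"
        by (rule eq) (use splits_length[OF p] splits_subset[OF p cs(1)] d b less.prems(3) in \<open>auto simp: snoc\<close>)
      show "dir_derivs (snd p) (\<lambda>y. dir_deriv b h (f y)) x = dir_derivs (snd p) (\<lambda>y. dir_deriv b h (g y)) x"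
        by (rule less.hyps) (use splits_length[OF p] splits_subset[OF p cs(1)] b less.prems in
          \<open>auto simp: snoc intro: smooth_near_dir_deriv\<close>)
    qed
  qed
qed

section \<open>Matrix differential operators and their formal adjoints\<close>

definition lin_op where
  "lin_op s a \<xi> A u = (\<Sum>B\<in>UNIV. \<Sum>K | length K \<le> s. a A B K u * iter_partial K (\<xi> B) u)"

definition adj_op where
  "adj_op s a \<xi> A u = (\<Sum>B\<in>UNIV. \<Sum>K | length K \<le> s.
     (-1) ^ length K * iter_partial K (\<lambda>v. a B A K v * \<xi> B v) u)"

text \<open>Coefficients of the operator \<open>a'\<close> preceded by multiplication with
  \<open>M\<close> and followed by its transpose. The binomial coefficient is the one of
  \<open>sum_splits\<close>, and the derivatives fall on the first factor \<open>M\<close>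
  alone.\<close>

definition transformed_coeff ::
  "nat \<Rightarrow> ('N::finite \<Rightarrow> 'N \<Rightarrow> 'n::finite list \<Rightarrow> real ^ 'n \<Rightarrow> real) \<Rightarrow>
     ('N \<Rightarrow> 'N \<Rightarrow> real ^ 'n \<Rightarrow> real) \<Rightarrow> 'N \<Rightarrow> 'N \<Rightarrow> 'n list \<Rightarrow> real ^ 'n \<Rightarrow> real" where
  "transformed_coeff s a' M A B J u = (\<Sum>C\<in>UNIV. \<Sum>E\<in>UNIV. \<Sum>I | length I \<le> s - length J.
     real ((length I + length J) choose length I) *
       (iter_partial I (M E B) u * (M C A u * a' C E (I @ J) u)))"

lemma smooth_near_transformed_coeff:
  assumes "\<And>A B J. smooth_near (a' A B J) x" "\<And>A B. smooth_near (M A B) x"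
  shows "smooth_near (transformed_coeff s a' M A B J) x"
  unfolding transformed_coeff_def[abs_def]
  by (intro smooth_near_sum smooth_near_mult smooth_near_const smooth_near_iter_partial assms)

text \<open>Leibniz on \<open>M E B v * \<eta> v\<close>. Symmetry replaces \<open>K\<close> by
  \<open>I @ J\<close> for each of its splittings, so that \<open>sum_splits\<close> can collect the
  coefficient of \<open>iter_partial J \<eta>\<close>.\<close>

lemma lin_op_transformed:
  fixes \<eta> :: "real ^ 'n::finite \<Rightarrow> real" and M :: "'N::finite \<Rightarrow> 'N \<Rightarrow> real ^ 'n \<Rightarrow> real"
  assumes sym: "\<And>A B J J'. mset J = mset J' \<Longrightarrow> a' A B J = a' A B J'"
    and M: "\<And>A B. smooth_near (M A B) u" and \<eta>: "smooth_near \<eta> u"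
  shows "(\<Sum>C\<in>UNIV. M C A u * (\<Sum>E\<in>UNIV. \<Sum>K | length K \<le> s. a' C E K u * iter_partial K (\<lambda>v. M E B v * \<eta> v) u))
    = (\<Sum>J | length J \<le> s. transformed_coeff s a' M A B J u * iter_partial J \<eta> u)"
proof -
  have "(\<Sum>K | length K \<le> s. a' C E K u * iter_partial K (\<lambda>v. M E B v * \<eta> v) u)
    = (\<Sum>J | length J \<le> s. \<Sum>I | length I \<le> s - length J. real ((length I + length J) choose length I) *
        (a' C E (I @ J) u * (iter_partial I (M E B) u * iter_partial J \<eta> u)))" for C E
  proof -
    have "(\<Sum>K | length K \<le> s. a' C E K u * iter_partial K (\<lambda>v. M E B v * \<eta> v) u)
      = (\<Sum>K | length K \<le> s. \<Sum>p\<leftarrow>splits K. a' C E (fst p @ snd p) u *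
          (iter_partial (fst p) (M E B) u * iter_partial (snd p) \<eta> u))"
    proof (intro sum.cong refl)
      fix K
      have "a' C E K u * iter_partial K (\<lambda>v. M E B v * \<eta> v) u
        = (\<Sum>p\<leftarrow>splits K. a' C E K u * (iter_partial (fst p) (M E B) u * iter_partial (snd p) \<eta> u))"
        unfolding iter_partial_mult[OF M \<eta>] by (simp add: sum_list_const_mult)
      also have "\<dots> = (\<Sum>p\<leftarrow>splits K. a' C E (fst p @ snd p) u *
          (iter_partial (fst p) (M E B) u * iter_partial (snd p) \<eta> u))"
        using sym splits_mset[of _ K]
        by (intro arg_cong[of _ _ sum_list] map_cong refl) (metis mset_append)
      finally show "a' C E K u * iter_partial K (\<lambda>v. M E B v * \<eta> v) u = \<dots>" .
    qed
    also note sum_splits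
    finally show ?thesis .
  qed
  then have "(\<Sum>C\<in>UNIV. M C A u * (\<Sum>E\<in>UNIV. \<Sum>K | length K \<le> s. a' C E K u * iter_partial K (\<lambda>v. M E B v * \<eta> v) u))
    = (\<Sum>C\<in>UNIV. \<Sum>E\<in>UNIV. \<Sum>J | length J \<le> s. \<Sum>I | length I \<le> s - length J. real ((length I + length J) choose length I) *
       (iter_partial I (M E B) u * (M C A u * a' C E (I @ J) u)) * iter_partial J \<eta> u)"
    by (simp add: sum_distrib_left mult_ac)
  also have "\<dots> = (\<Sum>J | length J \<le> s. transformed_coeff s a' M A B J u * iter_partial J \<eta> u)"
    unfolding transformed_coeff_def sum_distrib_right
    by (simp only: sum.swap[of _ "{J. length J \<le> s}" UNIV])
  finally show ?thesis .
qed

text \<open>An identity between operators becomes one between coefficients by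
  \<open>operator_coeff_unique\<close>; the zeroth order term \<open>S\<close> contributes to the
  empty multi-index only.\<close>

lemma coeff_transformation:
  fixes M :: "'N::finite \<Rightarrow> 'N \<Rightarrow> real ^ 'n::finite \<Rightarrow> real"
  assumes sym: "\<And>A B J J'. mset J = mset J' \<Longrightarrow> a A B J = a A B J'" "\<And>A B J J'. mset J = mset J' \<Longrightarrow> a' A B J = a' A B J'"
    and M: "\<And>A B. smooth_near (M A B) u"
    and op: "\<And>\<xi>. (\<And>B. smooth_near (\<xi> B) u) \<Longrightarrow> lin_op s a \<xi> A u =
      (\<Sum>C\<in>UNIV. M C A u * lin_op s a' (\<lambda>E v. \<Sum>B\<in>UNIV. M E B v * \<xi> B v) C u) + (\<Sum>B\<in>UNIV. S A B u * \<xi> B u)"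
    and J: "length J \<le> s"
  shows "a A B J u = transformed_coeff s a' M A B J u + (if J = [] then S A B u else 0)"
proof (rule operator_coeff_unique[OF _ _ _ J, where x=u])
  fix \<eta> :: "real ^ 'n \<Rightarrow> real" assume \<eta>: "smooth_near \<eta> u"
  \<comment> \<open>A field with the single nonzero component \<open>B\<close> extracts column
    \<open>B\<close> of both operators.\<close>
  let ?\<xi> = "\<lambda>B'. if B' = B then \<eta> else (\<lambda>_. 0)"
  have "(\<Sum>J | length J \<le> s. a A B J u * iter_partial J \<eta> u) = lin_op s a ?\<xi> A u"
    unfolding lin_op_def
    by (subst sum.remove[of UNIV B]) (auto simp: iter_partial_zero)
  also have "\<dots> = (\<Sum>C\<in>UNIV. M C A u * lin_op s a' (\<lambda>E v. \<Sum>B\<in>UNIV. M E B v * ?\<xi> B v) C u) + (\<Sum>B\<in>UNIV. S A B u * ?\<xi> B u)"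
    by (rule op) (auto intro: \<eta> smooth_near_const)
  also have "(\<lambda>E v. \<Sum>B\<in>UNIV. M E B v * ?\<xi> B v) = (\<lambda>E v. M E B v * \<eta> v)"
    by (simp add: if_distrib[of "\<lambda>f. f _"] if_distrib[of "\<lambda>x. _ * x"] cong: if_cong)
  also have "(\<Sum>B\<in>UNIV. S A B u * ?\<xi> B u) = S A B u * \<eta> u"
    by (simp add: if_distrib[of "\<lambda>f. f _"] if_distrib[of "\<lambda>x. _ * x"] cong: if_cong)
  also have "(\<Sum>C\<in>UNIV. M C A u * lin_op s a' (\<lambda>E v. M E B v * \<eta> v) C u)
    = (\<Sum>J | length J \<le> s. transformed_coeff s a' M A B J u * iter_partial J \<eta> u)"
    unfolding lin_op_def by (rule lin_op_transformed[OF sym(2) M \<eta>])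
  also have "S A B u * \<eta> u = (\<Sum>J | length J \<le> s. (if J = [] then S A B u else 0) * iter_partial J \<eta> u)"
    by (subst sum.remove[of _ "[]"]) auto
  finally show "(\<Sum>J | length J \<le> s. a A B J u * iter_partial J \<eta> u)
    = (\<Sum>J | length J \<le> s. (transformed_coeff s a' M A B J u + (if J = [] then S A B u else 0)) * iter_partial J \<eta> u)"
    by (simp add: sum.distrib distrib_right)
next
  fix J J' :: "'n list" assume eq: "mset J = mset J'"
  show "a A B J u = a A B J' u" using sym(1)[OF eq] by simp
  have "a' C E (I @ J) = a' C E (I @ J')" for C E I
    by (rule sym(2)) (simp add: eq)
  moreover have "length J = length J'" using eq by (rule mset_eq_length)
  moreover have "J = [] \<longleftrightarrow> J' = []" using eq by auto
  ultimately show "transformed_coeff s a' M A B J u + (if J = [] then S A B u else 0)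
    = transformed_coeff s a' M A B J' u + (if J' = [] then S A B u else 0)"
    by (simp add: transformed_coeff_def)
qed

text \<open>The formal adjoint of \<open>M\<^sup>T \<circ> a' \<circ> M\<close> is \<open>M\<^sup>T \<circ> a'\<^sup>* \<circ> M\<close>; this is where the Leibniz rule in
  the form of \<open>mult_iter_partial\<close> enters.\<close>

lemma adj_op_transformed:
  fixes M :: "'N::finite \<Rightarrow> 'N \<Rightarrow> real ^ 'n::finite \<Rightarrow> real"
  assumes sym: "\<And>A B J J'. mset J = mset J' \<Longrightarrow> a' A B J = a' A B J'"
    and a': "\<And>A B J. smooth_near (a' A B J) u" and M: "\<And>A B. smooth_near (M A B) u"
    and \<xi>: "\<And>B. smooth_near (\<xi> B) u"
  shows "adj_op s (transformed_coeff s a' M) \<xi> A u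
    = (\<Sum>E\<in>UNIV. M E A u * adj_op s a' (\<lambda>E v. \<Sum>B\<in>UNIV. M E B v * \<xi> B v) E u)"
proof -
  \<comment> \<open>In the transposed coefficient \<open>transformed_coeff s a' M B A\<close> the
    factor \<open>M C B\<close> is not differentiated and is absorbed into \<open>h\<close>; the
    derivatives over \<open>I\<close> fall on \<open>M E A\<close>, the factor to be pulled out at
    the end.\<close>
  define h where "h = (\<lambda>B C E K v. M C B v * a' C E K v * \<xi> B v)"
  have h: "smooth_near (h B C E K) u" for B C E K
    unfolding h_def by (intro smooth_near_mult a' M \<xi>)
  define G where "G = (\<lambda>B C E I J. iter_partial J (\<lambda>v. iter_partial I (M E A) v * h B C E (I @ J) v) u)"
  have "iter_partial J (\<lambda>v. transformed_coeff s a' M B A J v * \<xi> B v) u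
     = (\<Sum>C\<in>UNIV. \<Sum>E\<in>UNIV. \<Sum>I | length I \<le> s - length J. real ((length I + length J) choose length I) * G B C E I J)"
    for B J
  proof -
    have eq: "(\<lambda>v. transformed_coeff s a' M B A J v * \<xi> B v) = (\<lambda>v. \<Sum>C\<in>UNIV. \<Sum>E\<in>UNIV. \<Sum>I | length I \<le> s - length J.
        real ((length I + length J) choose length I) * (iter_partial I (M E A) v * h B C E (I @ J) v))"
      by (simp add: transformed_coeff_def h_def sum_distrib_left mult_ac)
    have "iter_partial J (\<lambda>v. transformed_coeff s a' M B A J v * \<xi> B v) u = (\<Sum>C\<in>UNIV. iter_partial J (\<lambda>v. \<Sum>E\<in>UNIV. \<Sum>I | length I \<le> s - length J.
        real ((length I + length J) choose length I) * (iter_partial I (M E A) v * h B C E (I @ J) v)) u)"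
      unfolding eq by (rule iter_partial_sum[OF finite])
        (intro smooth_near_sum smooth_near_mult smooth_near_const smooth_near_iter_partial M h)
    also have "\<dots> = (\<Sum>C\<in>UNIV. \<Sum>E\<in>UNIV. iter_partial J (\<lambda>v. \<Sum>I | length I \<le> s - length J.
        real ((length I + length J) choose length I) * (iter_partial I (M E A) v * h B C E (I @ J) v)) u)"
      by (intro sum.cong refl iter_partial_sum[OF finite])
        (intro smooth_near_sum smooth_near_mult smooth_near_const smooth_near_iter_partial M h)
    also have "\<dots> = (\<Sum>C\<in>UNIV. \<Sum>E\<in>UNIV. \<Sum>I | length I \<le> s - length J. iter_partial J (\<lambda>v.
        real ((length I + length J) choose length I) * (iter_partial I (M E A) v * h B C E (I @ J) v)) u)"
      by (intro sum.cong refl iter_partial_sum[OF finite_lists_le])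
        (intro smooth_near_mult smooth_near_const smooth_near_iter_partial M h)
    also have "\<dots> = (\<Sum>C\<in>UNIV. \<Sum>E\<in>UNIV. \<Sum>I | length I \<le> s - length J.
        real ((length I + length J) choose length I) * G B C E I J)"
      unfolding G_def
      by (intro sum.cong refl iter_partial_cmult smooth_near_mult smooth_near_const smooth_near_iter_partial M h)
    finally show ?thesis .
  qed
  then have "adj_op s (transformed_coeff s a' M) \<xi> A u = (\<Sum>B\<in>UNIV. \<Sum>J | length J \<le> s. \<Sum>C\<in>UNIV. \<Sum>E\<in>UNIV.
      \<Sum>I | length I \<le> s - length J. real ((length I + length J) choose length I) * ((-1) ^ length J * G B C E I J))"
    by (simp add: adj_op_def sum_distrib_left mult_ac)
  also have "\<dots> = (\<Sum>B\<in>UNIV. \<Sum>C\<in>UNIV. \<Sum>E\<in>UNIV. \<Sum>J | length J \<le> s.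
      \<Sum>I | length I \<le> s - length J. real ((length I + length J) choose length I) * ((-1) ^ length J * G B C E I J))"
    by (simp only: sum.swap[of _ "UNIV :: 'N set" "{J. length J \<le> s}"])
  also have "\<dots> = (\<Sum>B\<in>UNIV. \<Sum>C\<in>UNIV. \<Sum>E\<in>UNIV. \<Sum>K | length K \<le> s. \<Sum>p\<leftarrow>splits K.
      (-1) ^ length (snd p) * G B C E (fst p) (snd p))"
    by (simp only: sum_splits[of "\<lambda>I J. (-1) ^ length J * G _ _ _ I J"])
  also have "\<dots> = (\<Sum>B\<in>UNIV. \<Sum>C\<in>UNIV. \<Sum>E\<in>UNIV. \<Sum>K | length K \<le> s.
      (-1) ^ length K * (M E A u * iter_partial K (h B C E K) u))"
  proof (intro sum.cong refl)
    fix B C E K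
    have "(\<Sum>p\<leftarrow>splits K. (-1) ^ length (snd p) * G B C E (fst p) (snd p))
      = (\<Sum>p\<leftarrow>splits K. (-1) ^ length K * ((-1) ^ length (fst p) *
          iter_partial (snd p) (\<lambda>v. iter_partial (fst p) (M E A) v * h B C E K v) u))"
    proof (intro arg_cong[of _ _ sum_list] map_cong refl)
      fix p assume p: "p \<in> set (splits K)"
      have "h B C E (fst p @ snd p) = h B C E K"
        unfolding h_def using sym[of "fst p @ snd p" K] splits_mset[OF p] by simp
      \<comment> \<open>The sign of \<open>snd p\<close> is that of \<open>K\<close> times that of
        \<open>fst p\<close>, which supplies the alternating sign required by
        \<open>mult_iter_partial\<close>.\<close>
      then show "(-1) ^ length (snd p) * G B C E (fst p) (snd p) = (-1) ^ length K * ((-1) ^ length (fst p) *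
          iter_partial (snd p) (\<lambda>v. iter_partial (fst p) (M E A) v * h B C E K v) u)"
        by (simp add: G_def splits_length[OF p] power_add flip: power_mult_distrib mult.assoc)
    qed
    also have "\<dots> = (-1) ^ length K * (M E A u * iter_partial K (h B C E K) u)"
      unfolding mult_iter_partial[OF M h] by (simp add: sum_list_const_mult)
    finally show "(\<Sum>p\<leftarrow>splits K. (-1) ^ length (snd p) * G B C E (fst p) (snd p)) = \<dots>" .
  qed
  also have "\<dots> = (\<Sum>E\<in>UNIV. M E A u * (\<Sum>C\<in>UNIV. \<Sum>K | length K \<le> s. (-1) ^ length K *
      (\<Sum>B\<in>UNIV. iter_partial K (h B C E K) u)))"
  proof -
    have "(\<Sum>B\<in>UNIV. \<Sum>C\<in>UNIV. \<Sum>E\<in>UNIV. \<Sum>K | length K \<le> s. (-1) ^ length K * (M E A u * iter_partial K (h B C E K) u))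
      = (\<Sum>E\<in>UNIV. \<Sum>B\<in>UNIV. \<Sum>C\<in>UNIV. \<Sum>K | length K \<le> s. (-1) ^ length K * (M E A u * iter_partial K (h B C E K) u))"
      by (subst (2) sum.swap, rule sum.swap)
    also have "\<dots> = (\<Sum>E\<in>UNIV. \<Sum>C\<in>UNIV. \<Sum>K | length K \<le> s. \<Sum>B\<in>UNIV. (-1) ^ length K * (M E A u * iter_partial K (h B C E K) u))"
    proof (rule sum.cong[OF refl])
      fix E
      have "(\<Sum>B\<in>UNIV. \<Sum>C\<in>UNIV. \<Sum>K | length K \<le> s. (-1) ^ length K * (M E A u * iter_partial K (h B C E K) u))
        = (\<Sum>C\<in>UNIV. \<Sum>B\<in>UNIV. \<Sum>K | length K \<le> s. (-1) ^ length K * (M E A u * iter_partial K (h B C E K) u))"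
        by (rule sum.swap)
      also have "\<dots> = (\<Sum>C\<in>UNIV. \<Sum>K | length K \<le> s. \<Sum>B\<in>UNIV. (-1) ^ length K * (M E A u * iter_partial K (h B C E K) u))"
        by (rule sum.cong[OF refl], rule sum.swap)
      finally show "(\<Sum>B\<in>UNIV. \<Sum>C\<in>UNIV. \<Sum>K | length K \<le> s. (-1) ^ length K * (M E A u * iter_partial K (h B C E K) u)) = \<dots>" .
    qed
    finally show ?thesis by (simp add: sum_distrib_left mult_ac)
  qed
  also have "\<dots> = (\<Sum>E\<in>UNIV. M E A u * adj_op s a' (\<lambda>E v. \<Sum>B\<in>UNIV. M E B v * \<xi> B v) E u)"
  proof -
    have "iter_partial K (\<lambda>v. a' C E K v * (\<Sum>B\<in>UNIV. M C B v * \<xi> B v)) u = (\<Sum>B\<in>UNIV. iter_partial K (h B C E K) u)" for C E K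
      by (subst iter_partial_sum[OF finite h, symmetric]) (simp add: h_def sum_distrib_left mult_ac)
    then show ?thesis by (simp add: adj_op_def)
  qed
  finally show ?thesis .
qed

text \<open>\<open>op\<close> is assumed on a neighbourhood because the adjoint differentiates the
  coefficients of \<open>a\<close>. The symmetry of \<open>S\<close> is asked at \<open>x\<close>
  alone, as a zeroth order term is not differentiated; it lets \<open>S\<close> cancel between the
  operator and its adjoint.\<close>

lemma helmholtz_operator_transformation:
  fixes M :: "'N::finite \<Rightarrow> 'N \<Rightarrow> real ^ 'n::finite \<Rightarrow> real"
  assumes sym: "\<And>A B J J'. mset J = mset J' \<Longrightarrow> a A B J = a A B J'" "\<And>A B J J'. mset J = mset J' \<Longrightarrow> a' A B J = a' A B J'"
    and a': "\<And>A B J. smooth_near (a' A B J) x" and M: "\<And>A B. smooth_near (M A B) x"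
    and S: "\<And>A B. smooth_near (S A B) x" "\<And>A B. S A B x = S B A x"
    and op: "eventually (\<lambda>u. \<forall>A \<xi>. (\<forall>B. smooth_near (\<xi> B) u) \<longrightarrow> lin_op s a \<xi> A u =
      (\<Sum>C\<in>UNIV. M C A u * lin_op s a' (\<lambda>E v. \<Sum>B\<in>UNIV. M E B v * \<xi> B v) C u) + (\<Sum>B\<in>UNIV. S A B u * \<xi> B u)) (nhds x)"
    and \<xi>: "\<And>B. smooth_near (\<xi> B) x"
  shows "lin_op s a \<xi> A x - adj_op s a \<xi> A x = (\<Sum>C\<in>UNIV. M C A x *
    (lin_op s a' (\<lambda>E v. \<Sum>B\<in>UNIV. M E B v * \<xi> B v) C x - adj_op s a' (\<lambda>E v. \<Sum>B\<in>UNIV. M E B v * \<xi> B v) C x))"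
proof -
  have "eventually (\<lambda>u. \<forall>A B. smooth_near (M A B) u) (nhds x)"
    by (intro eventually_all_finite eventually_smooth_near M)
  then have coeff: "eventually (\<lambda>u. \<forall>A B J. length J \<le> s \<longrightarrow>
      a A B J u = transformed_coeff s a' M A B J u + (if J = [] then S A B u else 0)) (nhds x)"
    using op
  proof eventually_elim
    case (elim u)
    then show ?case
      by (intro allI impI coeff_transformation[OF sym]) blast+
  qed
  have "adj_op s a \<xi> A x = (\<Sum>B\<in>UNIV. \<Sum>K | length K \<le> s. (-1) ^ length K *
      (iter_partial K (\<lambda>v. transformed_coeff s a' M B A K v * \<xi> B v) x + (if K = [] then S B A x * \<xi> B x else 0)))"
    unfolding adj_op_def
  proof (intro sum.cong refl arg_cong2[of _ _ _ _ "(*)"])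
    fix B and K :: "'n list" assume K: "K \<in> {K. length K \<le> s}"
    have "iter_partial K (\<lambda>v. a B A K v * \<xi> B v) x
      = iter_partial K (\<lambda>v. transformed_coeff s a' M B A K v * \<xi> B v + (if K = [] then S B A v else 0) * \<xi> B v) x"
      by (rule iter_partial_cong_nhds) (use coeff in \<open>eventually_elim, use K in \<open>simp add: distrib_right\<close>\<close>)
    also have "\<dots> = iter_partial K (\<lambda>v. transformed_coeff s a' M B A K v * \<xi> B v) x
        + iter_partial K (\<lambda>v. (if K = [] then S B A v else 0) * \<xi> B v) x"
      by (rule iter_partial_add) (cases "K = []"; simp add: S smooth_near_const \<xi> smooth_near_mult
          smooth_near_transformed_coeff a' M)+
    also have "iter_partial K (\<lambda>v. (if K = [] then S B A v else 0) * \<xi> B v) x = (if K = [] then S B A x * \<xi> B x else 0)"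
      by (cases "K = []") (simp_all add: iter_partial_zero)
    finally show "iter_partial K (\<lambda>v. a B A K v * \<xi> B v) x = iter_partial K (\<lambda>v. transformed_coeff s a' M B A K v * \<xi> B v) x
      + (if K = [] then S B A x * \<xi> B x else 0)" .
  qed
  also have "\<dots> = adj_op s (transformed_coeff s a' M) \<xi> A x + (\<Sum>B\<in>UNIV. S B A x * \<xi> B x)"
  proof -
    have "(\<Sum>K\<in>{K :: 'n list. length K \<le> s}. (-1) ^ length K * (if K = [] then c else 0)) = c" for c :: real
      by (subst sum.remove[of _ "[] :: 'n list"]) auto
    then show ?thesis by (simp add: adj_op_def distrib_left sum.distrib)
  qed
  \<comment> \<open>The adjoint of a zeroth order term is its transpose, here equal to the term
    itself.\<close>
  also have "(\<Sum>B\<in>UNIV. S B A x * \<xi> B x) = (\<Sum>B\<in>UNIV. S A B x * \<xi> B x)"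
    using S(2) by simp
  also note adj_op_transformed[OF sym(2) a' M \<xi>]
  finally have "adj_op s a \<xi> A x = (\<Sum>E\<in>UNIV. M E A x * adj_op s a' (\<lambda>E v. \<Sum>B\<in>UNIV. M E B v * \<xi> B v) E x)
    + (\<Sum>B\<in>UNIV. S A B x * \<xi> B x)" by simp
  moreover have "lin_op s a \<xi> A x = (\<Sum>C\<in>UNIV. M C A x * lin_op s a' (\<lambda>E v. \<Sum>B\<in>UNIV. M E B v * \<xi> B v) C x)
    + (\<Sum>B\<in>UNIV. S A B x * \<xi> B x)"
    using eventually_nhds_x_imp_x[OF op] \<xi> by blast
  ultimately show ?thesis by (simp add: right_diff_distrib sum_subtractf)
qed

section \<open>Jacobians\<close>

definition dir_jacobian :: "('v::euclidean_space \<Rightarrow> 'w::real_normed_vector) \<Rightarrow> 'v \<Rightarrow> 'v \<Rightarrow> 'w" where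
  "dir_jacobian f x v = (\<Sum>b\<in>Basis. (v \<bullet> b) *\<^sub>R dir_deriv b f x)"

lemma bounded_linear_dir_jacobian: "bounded_linear (dir_jacobian f x)"
  unfolding dir_jacobian_def[abs_def]
  by (intro bounded_linear_sum bounded_linear_compose[OF bounded_linear_scaleR_left bounded_linear_inner_left])

lemma linear_dir_jacobian: "linear (dir_jacobian f x)"
  using bounded_linear_dir_jacobian by (rule bounded_linear.linear)

text \<open>Total differentiability is \<open>directional_expansion\<close> along
  \<open>Basis\<close>. It links directional derivatives to \<open>frechet_derivative\<close>, in
  terms of which \<open>velocity_germs\<close> expresses immersivity.\<close>

lemma smooth_near_has_derivative:
  assumes "smooth_near f x"
  shows "(f has_derivative dir_jacobian f x) (at x)"
proof (rule has_derivativeI[OF bounded_linear_dir_jacobian], unfold LIM_def, intro allI impI)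
  fix e :: real assume e: "e > 0"
  obtain U where U: "open U" "x \<in> U" "smooth_on Basis U f"
    using assms by (auto simp: smooth_near_def)
  have n: "real DIM('a) > 0" by simp
  \<comment> \<open>The sum of the absolute coordinates is at most \<open>DIM('a)\<close> times the
    norm; the factor 2 makes the final estimate strict.\<close>
  then have e': "e / (2 * real DIM('a)) > 0" using e by simp
  have Ck: "Ck_on (Suc 0) Basis U f" using U(3) unfolding smooth_on_def by (rule spec)
  obtain d where d: "d > 0" "\<And>r. (\<And>b. b \<in> Basis \<Longrightarrow> \<bar>r b\<bar> < d) \<Longrightarrow>
     norm (f (x + (\<Sum>b\<in>Basis. r b *\<^sub>R b)) - f x - (\<Sum>b\<in>Basis. r b *\<^sub>R dir_deriv b f x))
       \<le> e / (2 * real DIM('a)) * (\<Sum>b\<in>Basis. \<bar>r b\<bar>)"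
    using directional_expansion[OF finite_Basis open_along_open[OF U(1)] Ck U(2) e'] by auto
  have "dist ((f y - f x - dir_jacobian f x (y - x)) /\<^sub>R norm (y - x)) 0 < e"
    if y: "y \<noteq> x" "dist y x < d" for y
  proof -
    have "\<bar>(y - x) \<bullet> b\<bar> < d" if "b \<in> Basis" for b
      using Basis_le_norm[OF that, of "y - x"] y by (simp add: dist_norm)
    from d(2)[of "\<lambda>b. (y - x) \<bullet> b", OF this]
    have "norm (f y - f x - dir_jacobian f x (y - x)) \<le> e / (2 * real DIM('a)) * (\<Sum>b\<in>Basis. \<bar>(y - x) \<bullet> b\<bar>)"
      by (simp add: euclidean_representation dir_jacobian_def)
    also have "\<dots> \<le> e / (2 * real DIM('a)) * (real DIM('a) * norm (y - x))"
      using e sum_bounded_above[of Basis "\<lambda>b. \<bar>(y - x) \<bullet> b\<bar>" "norm (y - x)"] Basis_le_norm[of _ "y - x"]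
      by (intro mult_left_mono) auto
    also have "\<dots> = e / 2 * norm (y - x)" using n by (simp add: field_simps)
    also have "\<dots> < e * norm (y - x)" using e y by simp
    finally show ?thesis using y by (simp add: inverse_eq_divide pos_divide_less_eq)
  qed
  then show "\<exists>s>0. \<forall>y. y \<noteq> x \<and> dist y x < s \<longrightarrow> dist ((f y - f x - dir_jacobian f x (y - x)) /\<^sub>R norm (y - x)) 0 < e"
    using d(1) by blast
qed

lemma frechet_derivative_smooth_near: "smooth_near f x \<Longrightarrow> frechet_derivative f (at x) = dir_jacobian f x"
  by (rule frechet_derivative_at[OF smooth_near_has_derivative, symmetric])

lemma dir_jacobian_cong_nhds:
  "eventually (\<lambda>y. f y = g y) (nhds x) \<Longrightarrow> dir_jacobian f x = dir_jacobian g x"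
  unfolding dir_jacobian_def[abs_def] by (simp add: dir_deriv_cong_nhds[of f g x])

lemma dir_jacobian_compose:
  fixes f :: "'v::euclidean_space \<Rightarrow> 'w::euclidean_space" and g :: "'w \<Rightarrow> 'u::real_normed_vector"
  assumes "smooth_near f x" "smooth_near g (f x)"
  shows "dir_jacobian (\<lambda>y. g (f y)) x = dir_jacobian g (f x) \<circ> dir_jacobian f x"
proof -
  have "((\<lambda>y. g (f y)) has_derivative dir_jacobian (\<lambda>y. g (f y)) x) (at x)"
    by (rule smooth_near_has_derivative, rule smooth_near_compose[OF assms])
  moreover have "(g \<circ> f has_derivative dir_jacobian g (f x) \<circ> dir_jacobian f x) (at x)"
    by (rule diff_chain_at[OF assms[THEN smooth_near_has_derivative]])
  ultimately show ?thesis
    unfolding o_def by (rule has_derivative_unique)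
qed

text \<open>An injective linear map is bounded below by some \<open>B > 0\<close>, and changing its
  columns by less than \<open>B\<close> in total cannot create a nonzero kernel vector. So
  immersivity is stable, both in families of germs and under perturbation of jet
  coordinates.\<close>

lemma eventually_inj_jacobian:
  fixes g :: "'p::t2_space \<Rightarrow> 'v::euclidean_space \<Rightarrow> 'w::euclidean_space"
  assumes cont: "\<And>b. b \<in> Basis \<Longrightarrow> ((\<lambda>p. dir_deriv b (g p) x) \<longlongrightarrow> dir_deriv b (g p0) x) (nhds p0)"
    and inj: "inj (dir_jacobian (g p0) x)"
  shows "eventually (\<lambda>p. inj (dir_jacobian (g p) x)) (nhds p0)"
proof -
  obtain B where B: "B > 0" "\<And>v. B * norm v \<le> norm (dir_jacobian (g p0) x v)"
    using linear_inj_bounded_below_pos[OF linear_dir_jacobian inj] by blast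
  have "((\<lambda>p. \<Sum>b\<in>Basis. norm (dir_deriv b (g p0) x - dir_deriv b (g p) x)) \<longlongrightarrow>
      (\<Sum>b\<in>(Basis::'v set). norm (dir_deriv b (g p0) x - dir_deriv b (g p0) x))) (nhds p0)"
    by (intro tendsto_sum tendsto_norm tendsto_diff tendsto_const cont)
  then have "eventually (\<lambda>p. (\<Sum>b\<in>Basis. norm (dir_deriv b (g p0) x - dir_deriv b (g p) x)) < B) (nhds p0)"
    using B(1) by (intro order_tendstoD(2)) auto
  then show ?thesis
  proof eventually_elim
    case (elim p)
    show ?case
      unfolding linear_injective_0[OF linear_dir_jacobian]
    proof (intro allI impI)
      fix v assume v: "dir_jacobian (g p) x v = 0"
      have "B * norm v \<le> norm (dir_jacobian (g p0) x v - dir_jacobian (g p) x v)" using B(2) v by simp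
      also have "\<dots> = norm (\<Sum>b\<in>Basis. (v \<bullet> b) *\<^sub>R (dir_deriv b (g p0) x - dir_deriv b (g p) x))"
        by (simp add: dir_jacobian_def scaleR_diff_right sum_subtractf)
      also have "\<dots> \<le> (\<Sum>b\<in>Basis. norm v * norm (dir_deriv b (g p0) x - dir_deriv b (g p) x))"
        by (rule order_trans[OF norm_sum]) (auto intro!: sum_mono mult_right_mono Basis_le_norm)
      also have "\<dots> = norm v * (\<Sum>b\<in>Basis. norm (dir_deriv b (g p0) x - dir_deriv b (g p) x))"
        by (simp add: sum_distrib_left)
      finally have "B * norm v \<le> norm v * (\<Sum>b\<in>Basis. norm (dir_deriv b (g p0) x - dir_deriv b (g p) x))" .
      then show "v = 0"
        using elim by (metis mult.commute mult_le_cancel_left_pos norm_le_zero_iff not_le)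
    qed
  qed
qed

section \<open>Components of maps and functions on product spaces\<close>

lemma smooth_near_vec:
  fixes f :: "'v::euclidean_space \<Rightarrow> real ^ 'N"
  assumes "\<And>A. smooth_near (\<lambda>y. f y $ A) x"
  shows "smooth_near f x"
  by (rule smooth_near_euclidean) (use assms in \<open>auto simp: Basis_vec_def inner_axis\<close>)

lemma smooth_near_nth: "smooth_near f x \<Longrightarrow> smooth_near (\<lambda>y. f y $ A) x"
  by (rule smooth_near_bounded_linear[OF bounded_linear_vec_nth])

lemma sum_Basis_vec: "(\<Sum>b\<in>(Basis :: (real ^ 'N) set). F b) = (\<Sum>A\<in>UNIV. F (axis A 1))"
proof -
  have B: "(Basis :: (real ^ 'N) set) = range (\<lambda>A. axis A 1)" by (auto simp: Basis_vec_def)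
  have "inj (\<lambda>A::'N. axis A (1::real))" by (auto simp: inj_on_def axis_eq_axis)
  then show ?thesis unfolding B by (subst sum.reindex) (auto simp: o_def)
qed

lemma dir_deriv_compose_vec:
  fixes f :: "'v::euclidean_space \<Rightarrow> real ^ 'N"
  assumes "smooth_near f x" "smooth_near g (f x)" "d \<in> Basis"
  shows "dir_deriv d (\<lambda>y. g (f y)) x = (\<Sum>A\<in>UNIV. dir_deriv d (\<lambda>y. f y $ A) x *\<^sub>R dir_deriv (axis A 1) g (f x))"
  unfolding dir_deriv_compose[OF assms] sum_Basis_vec by (simp add: inner_axis)

lemma iter_partial_compose_cong:
  fixes f g :: "real ^ 'n \<Rightarrow> real ^ 'N" and h :: "real ^ 'N \<Rightarrow> real"
  assumes "smooth_near f x" "smooth_near g x" "smooth_near h (f x)"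
    and "\<And>J A. length J \<le> s \<Longrightarrow> iter_partial J (\<lambda>y. f y $ A) x = iter_partial J (\<lambda>y. g y $ A) x"
    and "length J \<le> s"
  shows "iter_partial J (\<lambda>y. h (f y)) x = iter_partial J (\<lambda>y. h (g y)) x"
  unfolding iter_partial_dir_derivs
proof (rule dir_derivs_compose_cong[OF assms(1-3)])
  fix bs :: "(real ^ 'n) list" and b :: "real ^ 'N"
  assume bs: "set bs \<subseteq> Basis" "length bs \<le> s" and "b \<in> Basis"
  then obtain A where A: "b = axis A 1" by (auto simp: Basis_vec_def)
  have "\<exists>K. bs = map (\<lambda>j. axis j 1) K"
    using bs(1) by (induction bs) (auto simp: Basis_vec_def Cons_eq_map_conv)
  then obtain K where K: "bs = map (\<lambda>j. axis j 1) K" ..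
  show "dir_derivs bs (\<lambda>y. f y \<bullet> b) x = dir_derivs bs (\<lambda>y. g y \<bullet> b) x"
    using assms(4)[of K A] bs(2) by (simp add: A K inner_axis iter_partial_dir_derivs)
qed (use assms(5) in auto)

lemma dir_derivs_slice:
  "dir_derivs (map (Pair 0) bs) G (p, u) = dir_derivs bs (\<lambda>u. G (p, u)) u"
proof (induction bs arbitrary: u)
  case (Cons b bs)
  then have "(\<lambda>h. dir_derivs (map (Pair 0) bs) G ((p, u) + h *\<^sub>R (0, b))) = (\<lambda>h. dir_derivs bs (\<lambda>u. G (p, u)) (u + h *\<^sub>R b))"
    by (simp add: scaleR_Pair)
  then show ?case by (simp add: dir_deriv_def)
qed simp

lemma Pair_in_Basis: "b \<in> Basis \<Longrightarrow> (0, b) \<in> Basis" "b \<in> Basis \<Longrightarrow> (b, 0) \<in> Basis"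
  by (auto simp: Basis_prod_def)

lemma smooth_near_slice_point:
  assumes "smooth_near G (p, u)"
  shows "smooth_near (\<lambda>p. G (p, u)) p" "smooth_near (\<lambda>u. G (p, u)) u"
proof -
  have "smooth_near (\<lambda>p. (p, 0) + (0, u)) p" "smooth_near (\<lambda>u. (0, u) + (p, 0)) u"
    by (intro smooth_near_add smooth_near_const smooth_near_linear bounded_linear_Pair
        bounded_linear_ident bounded_linear_zero)+
  then have "smooth_near (\<lambda>p. (p, u)) p" "smooth_near (\<lambda>u. (p, u)) u"
    by simp_all
  then show "smooth_near (\<lambda>p. G (p, u)) p" "smooth_near (\<lambda>u. G (p, u)) u"
    using assms by (auto intro: smooth_near_compose[where g=G])
qed

lemma smooth_near_iter_partial_slice:
  assumes "smooth_near G (p, u)"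
  shows "smooth_near (\<lambda>p. iter_partial J (\<lambda>u. G (p, u)) u) p"
proof -
  have "smooth_near (dir_derivs (map (Pair 0) (map (\<lambda>j. axis j 1) J)) G) (p, u)"
    by (rule smooth_near_dir_derivs[OF assms]) (auto simp: Basis_prod_def)
  from smooth_near_slice_point(1)[OF this] show ?thesis
    unfolding dir_derivs_slice iter_partial_dir_derivs .
qed

lemma dir_deriv_slice1: "dir_deriv (b, 0) G (p, u) = dir_deriv b (\<lambda>p. G (p, u)) p"
  by (simp add: dir_deriv_def scaleR_Pair)

text \<open>Parameter and variable are directions of one product space, so interchanging their
  derivatives is a permutation covered by \<open>dir_derivs_mset\<close>.\<close>

lemma dir_deriv_iter_partial_slice:
  fixes G :: "'p::euclidean_space \<times> (real ^ 'n) \<Rightarrow> real"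
  assumes "smooth_near G (p, u)" "b \<in> Basis"
  shows "dir_deriv b (\<lambda>p. iter_partial J (\<lambda>u. G (p, u)) u) p = iter_partial J (\<lambda>u. dir_deriv b (\<lambda>p. G (p, u)) p) u"
proof -
  let ?bs = "map (Pair 0) (map (\<lambda>j. axis j 1) J) :: ('p \<times> (real ^ 'n)) list"
  have bs: "set ?bs \<subseteq> Basis" by (auto simp: Basis_prod_def)
  have "dir_deriv b (\<lambda>p. iter_partial J (\<lambda>u. G (p, u)) u) p = dir_derivs ((b, 0) # ?bs) G (p, u)"
    by (simp add: dir_deriv_slice1 dir_derivs_slice iter_partial_dir_derivs del: map_map)
  also have "\<dots> = dir_derivs (?bs @ [(b, 0)]) G (p, u)"
    by (rule dir_derivs_mset[OF assms(1)]) (use bs assms(2) in \<open>auto simp: Pair_in_Basis\<close>)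
  also have "\<dots> = iter_partial J (\<lambda>u. dir_deriv b (\<lambda>p. G (p, u)) p) u"
    by (simp add: dir_derivs_slice iter_partial_dir_derivs dir_deriv_slice1 del: map_map)
  finally show ?thesis .
qed

section \<open>Velocities in charts\<close>

definition cinv :: "('a, 'N) chart \<Rightarrow> real ^ 'N \<Rightarrow> 'a" where
  "cinv c = inv_into (fst c) (snd c)"

definition transition :: "('a, 'N) chart \<Rightarrow> ('a, 'N) chart \<Rightarrow> real ^ 'N \<Rightarrow> real ^ 'N" where
  "transition c c' y = snd c' (cinv c y)"

locale velocity_bundle =
  fixes X :: "'a topology" and \<A> :: "('a, 'N::finite) chart set" and imm :: bool
  assumes smooth_manifold: "smooth_manifold X \<A>"
begin

lemma chart:
  assumes "c \<in> \<A>"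
  shows chart_inj: "inj_on (snd c) (fst c)"
    and chart_open: "open (snd c ` fst c)"
    and chart_overlap_open: "c' \<in> \<A> \<Longrightarrow> open (snd c ` (fst c \<inter> fst c'))"
proof -
  have c: "is_chart X c" if "c \<in> \<A>" for c
    using smooth_manifold that by (auto simp: smooth_manifold_def)
  have hm: "homeomorphic_map (subtopology X (fst c)) (top_of_set (snd c ` fst c)) (snd c)"
    and op: "open (snd c ` fst c)" and oX: "openin X (fst c)"
    using c[OF assms] by (auto simp: is_chart_def)
  have top: "topspace (subtopology X (fst c)) = fst c"
    using openin_subset[OF oX] by auto
  show "inj_on (snd c) (fst c)"
    using homeomorphic_imp_injective_map[OF hm] unfolding top .
  show "open (snd c ` fst c)" by (rule op)
  show "open (snd c ` (fst c \<inter> fst c'))" if "c' \<in> \<A>"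
  proof -
    have "openin (subtopology X (fst c)) (fst c \<inter> fst c')"
      using c[OF that] oX by (auto simp: is_chart_def openin_subtopology)
    then have "openin (top_of_set (snd c ` fst c)) (snd c ` (fst c \<inter> fst c'))"
      using homeomorphic_map_openness[OF hm, of "fst c \<inter> fst c'"] unfolding top by auto
    then show ?thesis using op openin_open_trans by blast
  qed
qed

lemma cinv_chart: "c \<in> \<A> \<Longrightarrow> x \<in> fst c \<Longrightarrow> cinv c (snd c x) = x"
  unfolding cinv_def using chart_inj by (simp add: inv_into_f_f)

lemma chart_cinv: "y \<in> snd c ` fst c \<Longrightarrow> snd c (cinv c y) = y" "y \<in> snd c ` fst c \<Longrightarrow> cinv c y \<in> fst c"
  unfolding cinv_def by (simp_all add: f_inv_into_f inv_into_into)

lemma transition_chart: "c \<in> \<A> \<Longrightarrow> x \<in> fst c \<Longrightarrow> transition c c' (snd c x) = snd c' x"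
  by (simp add: transition_def cinv_chart)

lemma smooth_near_transition:
  assumes "c \<in> \<A>" "c' \<in> \<A>" "x \<in> fst c" "x \<in> fst c'"
  shows "smooth_near (transition c c') (snd c x)"
proof (rule smooth_on_near[OF chart_overlap_open[OF assms(1,2)]])
  have "compatible c c'"
    using smooth_manifold assms by (auto simp: smooth_manifold_def)
  then show "smooth_on Basis (snd c ` (fst c \<inter> fst c')) (transition c c')"
    unfolding compatible_def transition_def[abs_def] cinv_def o_def by blast
qed (use assms in auto)

lemma mem_chart_by_coord:
  assumes "c \<in> \<A>" "x \<in> fst c" "snd c x \<in> snd c ` (fst c \<inter> fst c')"
  shows "x \<in> fst c'"
  using assms chart_inj[OF assms(1)] by (auto simp: inj_on_def)

section \<open>Germs in charts\<close>

abbreviation germs :: "(real ^ 'n::finite \<Rightarrow> 'a) set" where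
  "germs \<equiv> velocity_germs \<A> imm"

lemma germsI:
  assumes "c \<in> \<A>" "smooth_near (\<lambda>u. snd c (\<gamma> u)) 0" "eventually (\<lambda>u. \<gamma> u \<in> fst c) (nhds 0)"
    and "imm \<Longrightarrow> inj (dir_jacobian (\<lambda>u. snd c (\<gamma> u)) 0)"
  shows "\<gamma> \<in> germs"
proof -
  obtain U where U: "open U" "0 \<in> U" "\<And>u. u \<in> U \<Longrightarrow> \<gamma> u \<in> fst c"
    using assms(3) unfolding eventually_nhds by blast
  obtain V where V: "open V" "0 \<in> V" "smooth_on Basis V (\<lambda>u. snd c (\<gamma> u))"
    using assms(2) unfolding smooth_near_def by blast
  have "open (U \<inter> V) \<and> 0 \<in> U \<inter> V \<and> \<gamma> ` (U \<inter> V) \<subseteq> fst c \<and> smooth_on Basis (U \<inter> V) (snd c \<circ> \<gamma>)"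
    using U V by (auto simp: o_def intro: smooth_on_subset)
  moreover have "imm \<longrightarrow> inj (frechet_derivative (snd c \<circ> \<gamma>) (at 0))"
    using assms(4) frechet_derivative_smooth_near[OF assms(2)] by (simp add: o_def)
  ultimately show ?thesis
    unfolding velocity_germs_def using assms(1) by blast
qed

text \<open>\<open>velocity_germs\<close> provides one unspecified chart \<open>c0\<close>;
  transition maps carry smoothness and immersivity to every chart around
  \<open>\<gamma> 0\<close>.\<close>

lemma germ_in_chart:
  assumes "\<gamma> \<in> germs" "c \<in> \<A>" "\<gamma> 0 \<in> fst c"
  shows germ_smooth: "smooth_near (\<lambda>u. snd c (\<gamma> u)) 0"
    and germ_near: "eventually (\<lambda>u. \<gamma> u \<in> fst c) (nhds 0)"
    and germ_immersive: "imm \<Longrightarrow> inj (dir_jacobian (\<lambda>u. snd c (\<gamma> u)) 0)"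
proof -
  obtain c0 U where U: "c0 \<in> \<A>" "open U" "0 \<in> U" "\<gamma> ` U \<subseteq> fst c0" "smooth_on Basis U (snd c0 \<circ> \<gamma>)"
    "imm \<longrightarrow> inj (frechet_derivative (snd c0 \<circ> \<gamma>) (at 0))"
    using assms(1) unfolding velocity_germs_def by blast
  have g0: "\<gamma> 0 \<in> fst c0" using U by auto
  have sm0: "smooth_near (\<lambda>u. snd c0 (\<gamma> u)) 0"
    using U by (auto simp: smooth_near_def o_def)
  have ev0: "eventually (\<lambda>u. \<gamma> u \<in> fst c0) (nhds 0)"
    using U unfolding eventually_nhds by blast
  have "eventually (\<lambda>u. snd c0 (\<gamma> u) \<in> snd c0 ` (fst c0 \<inter> fst c)) (nhds 0)"
    by (rule smooth_near_eventually_in[OF sm0 chart_overlap_open[OF U(1) assms(2)]]) (use g0 assms(3) in auto)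
  with ev0 show ev: "eventually (\<lambda>u. \<gamma> u \<in> fst c) (nhds 0)"
    by eventually_elim (rule mem_chart_by_coord[OF U(1)])
  have tr: "smooth_near (transition c0 c) (snd c0 (\<gamma> 0))" "smooth_near (transition c c0) (snd c (\<gamma> 0))"
    using smooth_near_transition g0 assms U(1) by auto
  have eq: "eventually (\<lambda>u. transition c0 c (snd c0 (\<gamma> u)) = snd c (\<gamma> u)) (nhds 0)"
    using ev0 by eventually_elim (rule transition_chart[OF U(1)])
  have eq': "eventually (\<lambda>u. transition c c0 (snd c (\<gamma> u)) = snd c0 (\<gamma> u)) (nhds 0)"
    using ev by eventually_elim (rule transition_chart[OF assms(2)])
  show sm: "smooth_near (\<lambda>u. snd c (\<gamma> u)) 0"
    by (rule smooth_near_cong[OF eq smooth_near_compose[OF sm0 tr(1)]])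
  show "inj (dir_jacobian (\<lambda>u. snd c (\<gamma> u)) 0)" if imm
  proof -
    \<comment> \<open>The Jacobian in \<open>c0\<close> is the one in \<open>c\<close> followed by
      that of the transition map, so its injectivity passes to the first factor.\<close>
    have "inj (dir_jacobian (\<lambda>u. snd c0 (\<gamma> u)) 0)"
      using U(6) that frechet_derivative_smooth_near[OF sm0] by (simp add: o_def)
    also have "dir_jacobian (\<lambda>u. snd c0 (\<gamma> u)) 0 = dir_jacobian (\<lambda>u. transition c c0 (snd c (\<gamma> u))) 0"
      by (rule dir_jacobian_cong_nhds[OF eq', symmetric])
    also have "\<dots> = dir_jacobian (transition c c0) (snd c (\<gamma> 0)) \<circ> dir_jacobian (\<lambda>u. snd c (\<gamma> u)) 0"
      by (rule dir_jacobian_compose[OF sm tr(2)])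
    finally show ?thesis by (rule inj_on_imageI2)
  qed
qed

lemma germ_of_coords:
  assumes "c \<in> \<A>" "smooth_near g 0" "g 0 \<in> snd c ` fst c" "imm \<Longrightarrow> inj (dir_jacobian g 0)"
  shows "(\<lambda>u. cinv c (g u)) \<in> germs" "cinv c (g 0) \<in> fst c"
    "eventually (\<lambda>u. snd c (cinv c (g u)) = g u) (nhds 0)"
proof -
  have "eventually (\<lambda>u. g u \<in> snd c ` fst c) (nhds 0)"
    by (rule smooth_near_eventually_in[OF assms(2) chart_open[OF assms(1)] assms(3)])
  then have ev: "eventually (\<lambda>u. cinv c (g u) \<in> fst c) (nhds 0)"
    and eq: "eventually (\<lambda>u. snd c (cinv c (g u)) = g u) (nhds 0)"
    by (auto elim!: eventually_mono intro: chart_cinv)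
  show "eventually (\<lambda>u. snd c (cinv c (g u)) = g u) (nhds 0)" by (rule eq)
  show "cinv c (g 0) \<in> fst c" using assms(3) by (rule chart_cinv)
  have eq': "eventually (\<lambda>u. g u = snd c (cinv c (g u))) (nhds 0)"
    using eq by eventually_elim simp
  show "(\<lambda>u. cinv c (g u)) \<in> germs"
  proof (rule germsI[OF assms(1) _ ev])
    show "smooth_near (\<lambda>u. snd c (cinv c (g u))) 0" by (rule smooth_near_cong[OF eq' assms(2)])
    show "inj (dir_jacobian (\<lambda>u. snd c (cinv c (g u))) 0)" if imm
      using assms(4)[OF that] dir_jacobian_cong_nhds[OF eq'] by simp
  qed
qed

section \<open>Jets and their projections\<close>

definition agree :: "nat \<Rightarrow> ('a, 'N) chart \<Rightarrow> (real ^ 'n::finite \<Rightarrow> 'a) \<Rightarrow> (real ^ 'n \<Rightarrow> 'a) \<Rightarrow> bool" where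
  "agree r c \<gamma> \<delta> \<longleftrightarrow> (\<forall>A J. length J \<le> r \<longrightarrow>
     iter_partial J (\<lambda>u. snd c (\<gamma> u) $ A) 0 = iter_partial J (\<lambda>u. snd c (\<delta> u) $ A) 0)"

lemma jet_iff: "\<delta> \<in> jet \<A> imm r \<gamma> \<longleftrightarrow>
  \<delta> \<in> germs \<and> \<delta> 0 = \<gamma> 0 \<and> (\<forall>c\<in>\<A>. \<gamma> 0 \<in> fst c \<longrightarrow> agree r c \<delta> \<gamma>)"
  unfolding jet_def agree_def by auto

text \<open>\<open>jet\<close> demands agreement in every chart around the point. By the chain rule
  for jets one chart is enough, so velocities can be compared in a single chart.\<close>

lemma agree_change_chart:
  assumes "\<gamma> \<in> germs" "\<delta> \<in> germs" "\<gamma> 0 = \<delta> 0" "c \<in> \<A>" "c' \<in> \<A>" "\<gamma> 0 \<in> fst c" "\<gamma> 0 \<in> fst c'" "agree r c \<gamma> \<delta>"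
  shows "agree r c' \<gamma> \<delta>"
  unfolding agree_def
proof (intro allI impI)
  fix A and J :: "'b list" assume J: "length J \<le> r"
  have change: "iter_partial J (\<lambda>u. snd c' (\<epsilon> u) $ A) 0 = iter_partial J (\<lambda>u. transition c c' (snd c (\<epsilon> u)) $ A) 0"
    if "\<epsilon> \<in> germs" "\<epsilon> 0 \<in> fst c" for \<epsilon> :: "real ^ 'b \<Rightarrow> 'a"
    by (rule iter_partial_cong_nhds)
      (use germ_near[OF that(1) assms(4) that(2)] in \<open>eventually_elim, simp add: transition_chart assms(4)\<close>)
  have "iter_partial J (\<lambda>u. transition c c' (snd c (\<gamma> u)) $ A) 0 = iter_partial J (\<lambda>u. transition c c' (snd c (\<delta> u)) $ A) 0"
    by (rule iter_partial_compose_cong[where s=r])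
      (use assms J in \<open>auto simp: agree_def intro!: germ_smooth smooth_near_nth smooth_near_transition\<close>)
  then show "iter_partial J (\<lambda>u. snd c' (\<gamma> u) $ A) 0 = iter_partial J (\<lambda>u. snd c' (\<delta> u) $ A) 0"
    using change[OF assms(1,6)] change[OF assms(2)] assms(3,6) by simp
qed

lemma jet_self: "\<gamma> \<in> germs \<Longrightarrow> \<gamma> \<in> jet \<A> imm r \<gamma>"
  by (simp add: jet_iff agree_def)

lemma jet_eq_iff_mem:
  assumes "\<gamma> \<in> germs"
  shows "jet \<A> imm r \<delta> = jet \<A> imm r \<gamma> \<longleftrightarrow> \<gamma> \<in> jet \<A> imm r \<delta>"
proof
  assume "\<gamma> \<in> jet \<A> imm r \<delta>"
  then show "jet \<A> imm r \<delta> = jet \<A> imm r \<gamma>"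
    by (auto simp: jet_iff agree_def)
qed (use jet_self[OF assms] in auto)

lemma jet_eqI:
  assumes "\<gamma> \<in> germs" "\<delta> \<in> germs" "c \<in> \<A>" "\<gamma> 0 \<in> fst c" "\<delta> 0 \<in> fst c" "agree r c \<gamma> \<delta>"
  shows "jet \<A> imm r \<gamma> = jet \<A> imm r \<delta>"
proof -
  have "snd c (\<gamma> 0) = snd c (\<delta> 0)"
    using assms(6)[unfolded agree_def, rule_format, of "[]"] by (simp add: vec_eq_iff)
  then have 0: "\<gamma> 0 = \<delta> 0"
    using chart_inj[OF assms(3)] assms(4,5) by (auto simp: inj_on_def)
  have "\<delta> \<in> jet \<A> imm r \<gamma>"
    using agree_change_chart[OF assms(1,2) 0 assms(3) _ assms(4) _ assms(6)] assms(2) 0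
    by (auto simp: jet_iff agree_def)
  then show ?thesis using jet_eq_iff_mem[OF assms(2)] by blast
qed

lemma jet_eqD:
  assumes "jet \<A> imm r \<gamma> = jet \<A> imm r \<delta>" "\<delta> \<in> germs"
  shows "\<gamma> 0 = \<delta> 0" "c \<in> \<A> \<Longrightarrow> \<gamma> 0 \<in> fst c \<Longrightarrow> agree r c \<gamma> \<delta>"
  using jet_self[OF assms(2), of r] unfolding assms(1)[symmetric] by (auto simp: jet_iff agree_def)

lemma some_jet:
  assumes "\<gamma> \<in> germs"
  shows "(SOME \<delta>. \<delta> \<in> jet \<A> imm r \<gamma>) \<in> jet \<A> imm r \<gamma>"
  using jet_self[OF assms, of r] by (rule someI[where P="\<lambda>\<delta>. \<delta> \<in> jet \<A> imm r \<gamma>"])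

lemma jet_mem_velocities: "\<gamma> \<in> germs \<Longrightarrow> jet \<A> imm r \<gamma> \<in> velocities \<A> imm r"
  by (auto simp: velocities_def)

lemma jet_mem_vdom: "\<gamma> \<in> germs \<Longrightarrow> jet \<A> imm r \<gamma> \<in> vdom \<A> imm r c \<longleftrightarrow> \<gamma> 0 \<in> fst c"
  using jet_self by (force simp: vdom_def jet_mem_velocities jet_iff)

lemma vdomE:
  assumes "p \<in> vdom \<A> imm r c"
  obtains \<gamma> where "\<gamma> \<in> germs" "\<gamma> 0 \<in> fst c" "p = jet \<A> imm r \<gamma>"
proof -
  obtain \<gamma> where \<gamma>: "\<gamma> \<in> germs" "p = jet \<A> imm r \<gamma>"
    using assms by (auto simp: vdom_def velocities_def)
  moreover have "\<gamma> 0 \<in> fst c" using assms jet_mem_vdom[OF \<gamma>(1)] unfolding \<gamma>(2) by simp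
  ultimately show thesis using that by blast
qed

text \<open>\<open>vcoord\<close> evaluates a chosen representative; up to order \<open>r\<close>
  all representatives have the same derivatives.\<close>

lemma vcoord_jet:
  assumes "\<gamma> \<in> germs" "c \<in> \<A>" "\<gamma> 0 \<in> fst c" "length J \<le> r"
  shows "vcoord c A J (jet \<A> imm r \<gamma>) = iter_partial J (\<lambda>u. snd c (\<gamma> u) $ A) 0"
  using some_jet[OF assms(1), of r] assms(2-4) by (auto simp: vcoord_def jet_iff agree_def)

lemma velocity_proj_jet:
  assumes "\<gamma> \<in> germs" "s \<le> t"
  shows "velocity_proj \<A> imm s (jet \<A> imm t \<gamma>) = jet \<A> imm s \<gamma>"
proof -
  let ?\<delta> = "SOME \<delta>. \<delta> \<in> jet \<A> imm t \<gamma>"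
  have "?\<delta> \<in> jet \<A> imm t \<gamma>" by (rule some_jet[OF assms(1)])
  then have "?\<delta> \<in> jet \<A> imm s \<gamma>" "?\<delta> \<in> germs"
    using assms(2) by (auto simp: jet_iff agree_def)
  then show ?thesis
    unfolding velocity_proj_def using jet_eq_iff_mem by metis
qed

lemma velocity_proj_vdom:
  "p \<in> vdom \<A> imm t c \<Longrightarrow> s \<le> t \<Longrightarrow> velocity_proj \<A> imm s p \<in> vdom \<A> imm s c"
  by (elim vdomE) (simp add: velocity_proj_jet jet_mem_vdom)

end

section \<open>The coordinate space of velocities\<close>

definition vindex :: "nat \<Rightarrow> ('N \<times> 'n multiset) set" where
  "vindex r = UNIV \<times> {M. size M \<le> r}"

lemma finite_vindex [simp]: "finite (vindex r :: ('N::finite \<times> 'n::finite multiset) set)"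
  by (simp add: vindex_def)

lemma vbasis_eq: "vbasis r = (\<lambda>k. Poly_Mapping.single k 1) ` vindex r"
  by (auto simp: vbasis_def vindex_def)

lemma finite_vbasis [simp]: "finite (vbasis r :: ('N::finite, 'n::finite) vcoords set)"
  by (simp add: vbasis_eq)

lemma single_in_vbasis: "size M \<le> r \<Longrightarrow> Poly_Mapping.single (A, M) 1 \<in> vbasis r"
  by (auto simp: vbasis_def)

lemma inj_single: "inj (\<lambda>k. Poly_Mapping.single k (1::real))"
  by (rule injI) (metis lookup_single_eq lookup_single_not_eq zero_neq_one)

lemma sum_vbasis:
  fixes F :: "('N::finite, 'n::finite) vcoords \<Rightarrow> 'b::comm_monoid_add"
  shows "sum F (vbasis r) = (\<Sum>A\<in>UNIV. \<Sum>M | size M \<le> r. F (Poly_Mapping.single (A, M) 1))"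
proof -
  have "sum F (vbasis r) = (\<Sum>k\<in>vindex r. F (Poly_Mapping.single k 1))"
    unfolding vbasis_eq by (subst sum.reindex) (auto intro: inj_on_subset[OF inj_single])
  then show ?thesis by (simp add: vindex_def sum.cartesian_product)
qed

text \<open>Recovers the index of a basis vector. The calculus along directions sums over the
  vectors in \<open>vbasis r\<close> themselves, and the coefficients have to be read off from
  them.\<close>

definition vkey :: "('N, 'n) vcoords \<Rightarrow> 'N \<times> 'n multiset" where
  "vkey b = the_elem (Poly_Mapping.keys b)"

lemma vkey_single [simp]: "vkey (Poly_Mapping.single k 1) = k"
  by (simp add: vkey_def)

lemma lookup_scaleR [simp]: "Poly_Mapping.lookup (r *\<^sub>R x) k = r *\<^sub>R Poly_Mapping.lookup x k" for x :: "'k \<Rightarrow>\<^sub>0 real"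
proof -
  have "finite {i. r *\<^sub>R Poly_Mapping.lookup x i \<noteq> 0}"
    by (rule finite_subset[of _ "Poly_Mapping.keys x"]) (auto simp: in_keys_iff)
  then show ?thesis by (simp add: scaleR_poly_mapping_def)
qed

lemma lookup_sum: "Poly_Mapping.lookup (\<Sum>i\<in>I. f i) k = (\<Sum>i\<in>I. Poly_Mapping.lookup (f i) k)"
  by (induction I rule: infinite_finite_induct) (simp_all add: lookup_add)

text \<open>The norm of a finitely supported function is the sum of its absolute values, so it
  dominates every coordinate.\<close>

lemma bounded_linear_lookup: "bounded_linear (\<lambda>x :: 'k \<Rightarrow>\<^sub>0 real. Poly_Mapping.lookup x k)"
proof
  show "\<exists>K. \<forall>x :: 'k \<Rightarrow>\<^sub>0 real. norm (Poly_Mapping.lookup x k) \<le> norm x * K"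
  proof (intro exI[of _ 1] allI)
    fix x :: "'k \<Rightarrow>\<^sub>0 real"
    have "norm x = (\<Sum>n\<in>Poly_Mapping.keys x. norm (Poly_Mapping.lookup x n))"
      by (simp add: norm_poly_mapping_def dist_poly_mapping_def)
    moreover have "norm (Poly_Mapping.lookup x k) \<le> (\<Sum>n\<in>Poly_Mapping.keys x. norm (Poly_Mapping.lookup x n))"
    proof (cases "k \<in> Poly_Mapping.keys x")
      case True
      then show ?thesis by (intro member_le_sum) auto
    qed (simp add: in_keys_iff sum_nonneg)
    ultimately show "norm (Poly_Mapping.lookup x k) \<le> norm x * 1" by simp
  qed
qed (simp_all add: lookup_add)

lemma vcoords_expansion:
  fixes a :: "('N::finite, 'n::finite) vcoords"
  assumes "\<And>A M. size M > r \<Longrightarrow> Poly_Mapping.lookup a (A, M) = 0"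
  shows "a = (\<Sum>b\<in>vbasis r. Poly_Mapping.lookup a (vkey b) *\<^sub>R b)"
proof (rule poly_mapping_eqI)
  fix k :: "'N \<times> 'n multiset"
  obtain A M where k: "k = (A, M)" by (cases k)
  have "Poly_Mapping.lookup (\<Sum>b\<in>vbasis r. Poly_Mapping.lookup a (vkey b) *\<^sub>R b) k
    = (\<Sum>B\<in>UNIV. \<Sum>L | size L \<le> r. if L = M then (if B = A then Poly_Mapping.lookup a (A, M) else 0) else 0)"
    unfolding lookup_sum sum_vbasis by (intro sum.cong) (auto simp: k lookup_single when_def)
  also have "\<dots> = Poly_Mapping.lookup a k"
    using assms[of M A] by (cases "size M \<le> r") (simp_all add: k sum.delta)
  finally show "Poly_Mapping.lookup a k = Poly_Mapping.lookup (\<Sum>b\<in>vbasis r. Poly_Mapping.lookup a (vkey b) *\<^sub>R b) k" ..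
qed

lemma span_vbasis:
  "a \<in> span (vbasis r :: ('N::finite, 'n::finite) vcoords set) \<longleftrightarrow> (\<forall>A M. size M > r \<longrightarrow> Poly_Mapping.lookup a (A, M) = 0)"
proof
  assume "a \<in> span (vbasis r)"
  then show "\<forall>A M. size M > r \<longrightarrow> Poly_Mapping.lookup a (A, M) = 0"
  proof (induction rule: span_induct_alt)
    case (step c x y)
    then show ?case by (auto simp: vbasis_def lookup_add lookup_single when_def split: if_splits)
  qed simp
next
  assume a: "\<forall>A M. size M > r \<longrightarrow> Poly_Mapping.lookup a (A, M) = 0"
  have "(\<Sum>b\<in>vbasis r. Poly_Mapping.lookup a (vkey b) *\<^sub>R b) \<in> span (vbasis r)"
    by (intro span_sum span_scale span_base)
  then show "a \<in> span (vbasis r)"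
    using vcoords_expansion[of r a] a by simp
qed

lemma lookup_vchart:
  "Poly_Mapping.lookup (vchart r c p) (A, M) = (if size M \<le> r then vcoord c A (SOME J. mset J = M) p else 0)"
  for c :: "('a, 'N::finite) chart" and p :: "('a, 'n::finite) velocity"
proof -
  let ?f = "\<lambda>(A, M). if size M \<le> r then vcoord c A (SOME J. mset J = M) p else 0"
  have "finite {k. ?f k \<noteq> 0}"
    by (rule finite_subset[OF _ finite_vindex[of r]]) (auto simp: vindex_def split: if_splits)
  then show ?thesis by (simp add: vchart_def)
qed

lemma mset_some_list: "mset (SOME J. mset J = M) = M"
  using ex_mset[of M] by (rule someI_ex)

lemma vchart_in_span: "vchart r c p \<in> span (vbasis r)"
  by (simp add: span_vbasis lookup_vchart)

lemma nth_dir_deriv: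
  "smooth_near f x \<Longrightarrow> b \<in> Basis \<Longrightarrow> dir_deriv b f x $ A = dir_deriv b (\<lambda>y. f y $ A) x"
  by (rule dir_deriv_bounded_linear[OF bounded_linear_vec_nth, symmetric])

text \<open>Adding the Taylor polynomial shifts the jet coordinates of \<open>g\<close> by exactly
  \<open>a\<close>; nearby points of the coordinate space are reached in this way.\<close>

definition perturb :: "nat \<Rightarrow> (real ^ 'n::finite \<Rightarrow> real ^ 'N::finite) \<Rightarrow> ('N, 'n) vcoords \<Rightarrow> real ^ 'n \<Rightarrow> real ^ 'N" where
  "perturb r g a u = g u + (\<chi> A. taylor_poly r (\<lambda>M. Poly_Mapping.lookup a (A, M)) u)"

lemma smooth_near_perturb: "smooth_near g x \<Longrightarrow> smooth_near (perturb r g a) x"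
  unfolding perturb_def[abs_def]
  by (intro smooth_near_add smooth_near_vec) (simp_all add: smooth_near_taylor_poly smooth_near_nth)

lemma iter_partial_perturb:
  assumes "smooth_near g 0" "length J \<le> r"
  shows "iter_partial J (\<lambda>u. perturb r g a u $ A) 0
    = iter_partial J (\<lambda>u. g u $ A) 0 + Poly_Mapping.lookup a (A, mset J)"
  unfolding perturb_def vector_add_component vec_lambda_beta
  by (subst iter_partial_add[OF smooth_near_nth[OF assms(1)] smooth_near_taylor_poly])
    (simp add: iter_partial_taylor_poly[OF assms(2)])

section \<open>Induced charts and families of velocities\<close>

context velocity_bundle
begin

lemma lookup_vchart_jet:
  assumes "\<gamma> \<in> germs" "c \<in> \<A>" "\<gamma> 0 \<in> fst c" "length J \<le> r"
  shows "Poly_Mapping.lookup (vchart r c (jet \<A> imm r \<gamma>)) (A, mset J) = iter_partial J (\<lambda>u. snd c (\<gamma> u) $ A) 0"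
proof -
  let ?J = "SOME K. mset K = mset J"
  have J: "mset ?J = mset J" by (rule mset_some_list)
  then have len: "length ?J \<le> r" using assms(4) by (metis size_mset)
  have "Poly_Mapping.lookup (vchart r c (jet \<A> imm r \<gamma>)) (A, mset J) = iter_partial ?J (\<lambda>u. snd c (\<gamma> u) $ A) 0"
    using assms(4) by (simp add: lookup_vchart vcoord_jet[OF assms(1-3) len])
  also have "\<dots> = iter_partial J (\<lambda>u. snd c (\<gamma> u) $ A) 0"
    by (rule iter_partial_mset[OF smooth_near_nth[OF germ_smooth[OF assms(1-3)]] J])
  finally show ?thesis .
qed

lemma lookup_vchart_vcoord:
  assumes "p \<in> vdom \<A> imm r c" "c \<in> \<A>" "length J \<le> r"
  shows "Poly_Mapping.lookup (vchart r c p) (A, mset J) = vcoord c A J p"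
  using assms by (elim vdomE) (simp add: lookup_vchart_jet vcoord_jet)

lemma vchart_inj:
  assumes "c \<in> \<A>"
  shows "inj_on (vchart r c) (vdom \<A> imm r c)"
proof (rule inj_onI)
  fix p q assume "p \<in> vdom \<A> imm r c" "q \<in> vdom \<A> imm r c" and eq: "vchart r c p = vchart r c q"
  then obtain \<gamma> \<delta> where \<gamma>: "\<gamma> \<in> germs" "\<gamma> 0 \<in> fst c" "p = jet \<A> imm r \<gamma>"
    and \<delta>: "\<delta> \<in> germs" "\<delta> 0 \<in> fst c" "q = jet \<A> imm r \<delta>"
    by (elim vdomE) blast
  have "agree r c \<gamma> \<delta>"
    unfolding agree_def
    using eq lookup_vchart_jet[OF \<gamma>(1) assms \<gamma>(2)] lookup_vchart_jet[OF \<delta>(1) assms \<delta>(2)] \<gamma>(3) \<delta>(3)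
    by metis
  then show "p = q" using jet_eqI[OF \<gamma>(1) \<delta>(1) assms \<gamma>(2) \<delta>(2)] \<gamma>(3) \<delta>(3) by simp
qed

lemma local_rep_vchart:
  "c \<in> \<A> \<Longrightarrow> p \<in> vdom \<A> imm r c \<Longrightarrow> local_rep \<A> imm r c f (vchart r c p) = f p"
  by (simp add: local_rep_def inv_into_f_f vchart_inj)

text \<open>Chart membership and immersivity are open conditions on the 1-jet. The order
  \<open>Suc r\<close> instead of \<open>r\<close> makes the first derivatives at 0 controllable for
  \<open>r = 0\<close> as well.\<close>

lemma perturb_germ:
  assumes \<gamma>: "\<gamma> \<in> germs" "\<gamma> 0 \<in> fst c" and c: "c \<in> \<A>"
  defines "g \<equiv> \<lambda>u. snd c (\<gamma> u)"
  shows "eventually (\<lambda>a. perturb (Suc r) g a 0 \<in> snd c ` fst c \<and> (imm \<longrightarrow> inj (dir_jacobian (perturb (Suc r) g a) 0))) (nhds 0)"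
proof -
  have g: "smooth_near g 0" unfolding g_def by (rule germ_smooth[OF \<gamma>(1) c \<gamma>(2)])
  have lk: "((\<lambda>a. Poly_Mapping.lookup a k) \<longlongrightarrow> Poly_Mapping.lookup 0 k) (nhds (0 :: ('N, 'b) vcoords))" for k
    by (rule bounded_linear.tendsto[OF bounded_linear_lookup filterlim_ident])
  have iter: "((\<lambda>a. iter_partial J (\<lambda>u. perturb (Suc r) g a u $ A) 0) \<longlongrightarrow> iter_partial J (\<lambda>u. perturb (Suc r) g 0 u $ A) 0) (nhds 0)"
    if "length J \<le> Suc r" for J A
    unfolding iter_partial_perturb[OF g that] by (intro tendsto_add tendsto_const lk)
  have "((\<lambda>a. perturb (Suc r) g a 0) \<longlongrightarrow> perturb (Suc r) g 0 0) (nhds 0)"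
    by (rule vec_tendstoI) (use iter[of "[]"] in simp)
  moreover have "taylor_poly m (\<lambda>M. 0) u = 0" for m and u :: "real ^ 'b"
    by (simp add: taylor_poly_def)
  then have p0: "perturb (Suc r) g 0 = g"
    by (simp add: perturb_def fun_eq_iff vec_eq_iff)
  ultimately have "eventually (\<lambda>a. perturb (Suc r) g a 0 \<in> snd c ` fst c) (nhds 0)"
    by (intro topological_tendstoD[OF _ chart_open[OF c]]) (use \<gamma>(2) in \<open>auto simp: g_def\<close>)
  moreover have "eventually (\<lambda>a. imm \<longrightarrow> inj (dir_jacobian (perturb (Suc r) g a) 0)) (nhds 0)"
  proof (cases imm)
    case True
    have "eventually (\<lambda>a. inj (dir_jacobian (perturb (Suc r) g a) 0)) (nhds 0)"
    proof (rule eventually_inj_jacobian[where g="perturb (Suc r) g"])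
      fix b :: "real ^ 'b" assume b: "b \<in> Basis"
      then obtain j where j: "b = axis j 1" by (auto simp: Basis_vec_def)
      show "((\<lambda>a. dir_deriv b (perturb (Suc r) g a) 0) \<longlongrightarrow> dir_deriv b (perturb (Suc r) g 0) 0) (nhds 0)"
      proof (rule vec_tendstoI)
        fix A
        show "((\<lambda>a. dir_deriv b (perturb (Suc r) g a) 0 $ A) \<longlongrightarrow> dir_deriv b (perturb (Suc r) g 0) 0 $ A) (nhds 0)"
          unfolding nth_dir_deriv[OF smooth_near_perturb[OF g] b]
          using iter[of "[j]" A] by (simp add: j)
      qed
    next
      show "inj (dir_jacobian (perturb (Suc r) g 0) 0)"
        unfolding p0 using germ_immersive[OF \<gamma>(1) c \<gamma>(2) True] by (simp add: g_def)
    qed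
    then show ?thesis by eventually_elim simp
  qed simp
  ultimately show ?thesis by (rule eventually_conj)
qed

text \<open>A point \<open>a\<close> close to the coordinates \<open>a0\<close> of a germ is reached
  by perturbing the germ by \<open>a - a0\<close>, which by \<open>perturb_germ\<close> keeps it in
  the chart and immersive. Openness is what gives directional derivatives of local representatives a
  meaning.\<close>

lemma open_along_vchart_image:
  assumes c: "c \<in> \<A>"
  shows "open_along (vbasis r) (vchart r c ` (vdom \<A> imm r c :: ('a, 'n::finite) velocity set))"
  unfolding open_along_def
proof
  fix a0 assume "a0 \<in> vchart r c ` (vdom \<A> imm r c :: ('a, 'n::finite) velocity set)"
  then obtain \<gamma> :: "real ^ 'n \<Rightarrow> 'a" where \<gamma>: "\<gamma> \<in> germs" "\<gamma> 0 \<in> fst c" and a0: "a0 = vchart r c (jet \<A> imm r \<gamma>)"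
    by (auto elim: vdomE)
  let ?g = "\<lambda>u. snd c (\<gamma> u)"
  have g: "smooth_near ?g 0" by (rule germ_smooth[OF \<gamma>(1) c \<gamma>(2)])
  obtain e where e: "e > 0" "\<And>b. dist b 0 < e \<Longrightarrow> perturb (Suc r) ?g b 0 \<in> snd c ` fst c \<and>
      (imm \<longrightarrow> inj (dir_jacobian (perturb (Suc r) ?g b) 0))"
    using perturb_germ[OF \<gamma> c, of r] unfolding eventually_nhds_metric by blast
  have "a \<in> vchart r c ` (vdom \<A> imm r c :: ('a, 'n::finite) velocity set)"
    if a: "a - a0 \<in> span (vbasis r)" "norm (a - a0) < e" for a
  proof -
    let ?h = "perturb (Suc r) ?g (a - a0)" and ?\<delta> = "\<lambda>u. cinv c (perturb (Suc r) ?g (a - a0) u)"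
    have h: "smooth_near ?h 0" by (rule smooth_near_perturb[OF g])
    have h0: "?h 0 \<in> snd c ` fst c" "imm \<Longrightarrow> inj (dir_jacobian ?h 0)"
      using e(2)[of "a - a0"] a(2) by (auto simp: dist_norm)
    have \<delta>: "?\<delta> \<in> germs" "?\<delta> 0 \<in> fst c" "eventually (\<lambda>u. snd c (?\<delta> u) = ?h u) (nhds 0)"
      using germ_of_coords[OF c h] h0 by blast+
    have "Poly_Mapping.lookup (vchart r c (jet \<A> imm r ?\<delta>)) (A, M) = Poly_Mapping.lookup a (A, M)" for A M
    proof (cases "size M \<le> r")
      case True
      obtain J where J: "mset J = M" using ex_mset by blast
      then have len: "length J \<le> r" using True by auto
      have "Poly_Mapping.lookup (vchart r c (jet \<A> imm r ?\<delta>)) (A, mset J) = iter_partial J (\<lambda>u. snd c (?\<delta> u) $ A) 0"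
        by (rule lookup_vchart_jet[OF \<delta>(1) c \<delta>(2) len])
      also have "\<dots> = iter_partial J (\<lambda>u. ?h u $ A) 0"
        by (rule iter_partial_cong_nhds) (use \<delta>(3) in \<open>eventually_elim, simp\<close>)
      also have "\<dots> = Poly_Mapping.lookup a0 (A, mset J) + Poly_Mapping.lookup (a - a0) (A, mset J)"
        using len unfolding a0 lookup_vchart_jet[OF \<gamma>(1) c \<gamma>(2) len] by (intro iter_partial_perturb g) simp
      finally show ?thesis by (simp add: J lookup_minus)
    next
      case False
      then have "Poly_Mapping.lookup (a - a0) (A, M) = 0" using a(1) by (auto simp: span_vbasis)
      then show ?thesis using False by (simp add: lookup_vchart lookup_minus a0)
    qed
    then have "vchart r c (jet \<A> imm r ?\<delta>) = a" by (auto intro: poly_mapping_eqI)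
    moreover have "jet \<A> imm r ?\<delta> \<in> vdom \<A> imm r c" using jet_mem_vdom[OF \<delta>(1)] \<delta>(2) by simp
    ultimately show ?thesis by (rule image_eqI[OF sym])
  qed
  then show "\<exists>e>0. \<forall>y. y - a0 \<in> span (vbasis r) \<longrightarrow> norm (y - a0) < e \<longrightarrow>
      y \<in> vchart r c ` (vdom \<A> imm r c :: ('a, 'n::finite) velocity set)"
    using e(1) by blast
qed

text \<open>Smooth families of velocities, given by the coordinates \<open>G (p, u)\<close> of representing germs
  that depend on a parameter \<open>p\<close>.\<close>

definition family :: "('a, 'N) chart \<Rightarrow> ('p::euclidean_space \<times> (real ^ 'n::finite) \<Rightarrow> real ^ 'N) \<Rightarrow> 'p \<Rightarrow> bool" where
  "family c G p \<longleftrightarrow> c \<in> \<A> \<and> smooth_near G (p, 0) \<and> G (p, 0) \<in> snd c ` fst c \<and>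
     (imm \<longrightarrow> inj (dir_jacobian (\<lambda>u. G (p, u)) 0))"

definition fgerm :: "('a, 'N) chart \<Rightarrow> ('p \<times> (real ^ 'n) \<Rightarrow> real ^ 'N) \<Rightarrow> 'p \<Rightarrow> real ^ 'n \<Rightarrow> 'a" where
  "fgerm c G p u = cinv c (G (p, u))"

lemma eventually_nhds_slice:
  assumes "eventually P (nhds (p0, u))"
  shows "eventually (\<lambda>p. P (p, u)) (nhds p0)"
  using eventually_compose_filterlim[OF assms tendsto_Pair[OF filterlim_ident tendsto_const]] .

text \<open>Lying in the chart and, through \<open>eventually_inj_jacobian\<close>, being immersive
  are open conditions on the parameter. This permits differentiation with respect to it.\<close>

lemma eventually_family:
  fixes G :: "'p::euclidean_space \<times> (real ^ 'n::finite) \<Rightarrow> real ^ 'N"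
  assumes "family c G p0"
  shows "eventually (family c G) (nhds p0)"
proof -
  have c: "c \<in> \<A>" and G: "smooth_near G (p0, 0)" and G0: "G (p0, 0) \<in> snd c ` fst c"
    and inj: "imm \<Longrightarrow> inj (dir_jacobian (\<lambda>u. G (p0, u)) 0)"
    using assms unfolding family_def by blast+
  have 1: "eventually (\<lambda>p. smooth_near G (p, 0)) (nhds p0)"
    by (rule eventually_nhds_slice[OF eventually_smooth_near[OF G]])
  have 2: "eventually (\<lambda>p. G (p, 0) \<in> snd c ` fst c) (nhds p0)"
    by (rule eventually_nhds_slice[OF smooth_near_eventually_in[OF G chart_open[OF c] G0]])
  have 3: "eventually (\<lambda>p. imm \<longrightarrow> inj (dir_jacobian (\<lambda>u. G (p, u)) 0)) (nhds p0)"
  proof (cases imm)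
    case True
    have "eventually (\<lambda>p. inj (dir_jacobian (\<lambda>u. G (p, u)) 0)) (nhds p0)"
    proof (rule eventually_inj_jacobian[where g="\<lambda>p u. G (p, u)"])
      fix b :: "real ^ 'n" assume "b \<in> Basis"
      then have "smooth_near (\<lambda>p. dir_deriv (0, b) G (p, 0)) p0"
        by (intro smooth_near_slice_point smooth_near_dir_deriv G Pair_in_Basis)
      then have "isCont (\<lambda>p. dir_deriv (0, b) G (p, 0)) p0" by (rule smooth_near_isCont)
      then have "((\<lambda>p. dir_deriv (0, b) G (p, 0)) \<longlongrightarrow> dir_deriv (0, b) G (p0, 0)) (nhds p0)"
        unfolding isCont_def tendsto_at_iff_tendsto_nhds[of "\<lambda>p. dir_deriv (0, b) G (p, 0)" p0] .
      moreover have "dir_deriv (0, b) G (p, 0) = dir_deriv b (\<lambda>u. G (p, u)) 0" for p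
        using dir_derivs_slice[of "[b]" G p 0] by simp
      ultimately show "((\<lambda>p. dir_deriv b (\<lambda>u. G (p, u)) 0) \<longlongrightarrow> dir_deriv b (\<lambda>u. G (p0, u)) 0) (nhds p0)"
        by simp
    qed (use inj True in simp)
    then show ?thesis by eventually_elim simp
  qed simp
  show ?thesis
    using 1 2 3 by eventually_elim (simp add: family_def c)
qed

lemma family_germ:
  assumes "family c G p"
  shows "fgerm c G p \<in> germs" "fgerm c G p 0 \<in> fst c" "eventually (\<lambda>u. snd c (fgerm c G p u) = G (p, u)) (nhds 0)"
proof -
  have "smooth_near (\<lambda>u. G (p, u)) 0"
    using assms by (intro smooth_near_slice_point(2)) (simp add: family_def)
  note * = germ_of_coords[OF _ this, of c]
  show "fgerm c G p \<in> germs" "fgerm c G p 0 \<in> fst c" "eventually (\<lambda>u. snd c (fgerm c G p u) = G (p, u)) (nhds 0)"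
    using * assms unfolding family_def fgerm_def[abs_def] by auto
qed

lemma fjet_vdom: "family c G p \<Longrightarrow> jet \<A> imm r (fgerm c G p) \<in> vdom \<A> imm r c"
  using family_germ jet_mem_vdom by blast

lemma iter_partial_fgerm:
  "family c G p \<Longrightarrow> iter_partial J (\<lambda>u. snd c (fgerm c G p u) $ A) 0 = iter_partial J (\<lambda>u. G (p, u) $ A) 0"
  by (rule iter_partial_cong_nhds, drule family_germ(3), erule eventually_mono) simp

lemma lookup_fjet:
  assumes "family c G p" "length J \<le> r"
  shows "Poly_Mapping.lookup (vchart r c (jet \<A> imm r (fgerm c G p))) (A, mset J) = iter_partial J (\<lambda>u. G (p, u) $ A) 0"
proof -
  have c: "c \<in> \<A>" using assms by (simp add: family_def)
  show ?thesis
    using lookup_vchart_jet[OF family_germ(1)[OF assms(1)] c family_germ(2)[OF assms(1)] assms(2)]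
      iter_partial_fgerm[OF assms(1)] by simp
qed

text \<open>In coordinates, a function along a family is its local representative after the
  coordinate curve \<open>q\<close>, whose coefficients are derivatives of \<open>G\<close> at
  \<open>u = 0\<close>. Composition and chain rule along \<open>vbasis r\<close> therefore
  apply.\<close>

lemma family_function:
  fixes G :: "'p::euclidean_space \<times> (real ^ 'n::finite) \<Rightarrow> real ^ 'N"
  assumes fam: "family c G p0" and f: "vsmooth_on \<A> imm r c (vdom \<A> imm r c) f"
  shows smooth_near_family: "smooth_near (\<lambda>p. f (jet \<A> imm r (fgerm c G p))) p0"
    and dir_deriv_family: "d \<in> Basis \<Longrightarrow> dir_deriv d (\<lambda>p. f (jet \<A> imm r (fgerm c G p))) p0
      = (\<Sum>B\<in>UNIV. \<Sum>J | length J \<le> r. vpartial \<A> imm r c B J f (jet \<A> imm r (fgerm c G p0)) *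
          dir_deriv d (\<lambda>p. iter_partial J (\<lambda>u. G (p, u) $ B) 0) p0)"
proof -
  have c: "c \<in> \<A>" and G: "smooth_near G (p0, 0)" using fam by (auto simp: family_def)
  define q where "q = (\<lambda>p. vchart r c (jet \<A> imm r (fgerm c G p)))"
  have lk: "eventually (\<lambda>p. Poly_Mapping.lookup (q p) (A, mset J) = iter_partial J (\<lambda>u. G (p, u) $ A) 0) (nhds p0)"
    if "length J \<le> r" for A J
    using eventually_family[OF fam] by eventually_elim (simp add: q_def lookup_fjet that)
  have sm: "smooth_near (\<lambda>p. Poly_Mapping.lookup (q p) (vkey b)) p0" if bV: "b \<in> vbasis r" for b
  proof -
    obtain A M where b: "b = Poly_Mapping.single (A, M) 1" "size M \<le> r"
      using bV unfolding vbasis_def by blast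
    obtain J where J: "mset J = M" using ex_mset by blast
    have "smooth_near (\<lambda>p. iter_partial J (\<lambda>u. G (p, u) $ A) 0) p0"
      using smooth_near_iter_partial_slice[OF smooth_near_nth[OF G]] .
    moreover have "eventually (\<lambda>p. iter_partial J (\<lambda>u. G (p, u) $ A) 0 = Poly_Mapping.lookup (q p) (A, M)) (nhds p0)"
      by (rule eventually_mono[OF lk[of J A]]) (use b(2) J in auto)
    ultimately show ?thesis unfolding b vkey_single by (rule smooth_near_cong[rotated])
  qed
  obtain U2 where U2: "open U2" "p0 \<in> U2" "\<And>b. b \<in> vbasis r \<Longrightarrow> smooth_on Basis U2 (\<lambda>p. Poly_Mapping.lookup (q p) (vkey b))"
    using smooth_near_common[of "vbasis r" "\<lambda>b p. Poly_Mapping.lookup (q p) (vkey b)", OF finite_vbasis sm] by blast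
  obtain U1 where U1: "open U1" "p0 \<in> U1" "\<And>p. p \<in> U1 \<Longrightarrow> family c G p"
    using eventually_family[OF fam] unfolding eventually_nhds by blast
  define U where "U = U1 \<inter> U2"
  have U: "open U" "p0 \<in> U" "\<And>p. p \<in> U \<Longrightarrow> family c G p"
    "\<And>b. b \<in> vbasis r \<Longrightarrow> smooth_on Basis U (\<lambda>p. Poly_Mapping.lookup (q p) (vkey b))"
    using U1 U2 by (auto simp: U_def intro: smooth_on_subset)
  let ?W = "vchart r c ` vdom \<A> imm r c" and ?f = "local_rep \<A> imm r c f"
  have q: "q p = (\<Sum>b\<in>vbasis r. Poly_Mapping.lookup (q p) (vkey b) *\<^sub>R b)" for p
    by (rule vcoords_expansion) (simp add: q_def lookup_vchart)
  have qW: "q p \<in> ?W" if "p \<in> U" for p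
    unfolding q_def using fjet_vdom[OF U(3)[OF that]] by (rule imageI)
  have fq: "?f (q p) = f (jet \<A> imm r (fgerm c G p))" if "p \<in> U" for p
    unfolding q_def by (rule local_rep_vchart[OF c fjet_vdom[OF U(3)[OF that]]])
  have fW: "smooth_on (vbasis r) ?W ?f" using f by (simp add: vsmooth_on_def)
  have "smooth_on Basis U (\<lambda>p. ?f (q p))"
    by (rule smooth_on_compose[OF finite_vbasis open_along_vchart_image[OF c] open_along_open[OF U(1)] q qW U(4) fW])
  then have "smooth_on Basis U (\<lambda>p. f (jet \<A> imm r (fgerm c G p)))"
    by (rule smooth_on_cong[OF open_along_open[OF U(1)], rotated]) (rule fq)
  then show "smooth_near (\<lambda>p. f (jet \<A> imm r (fgerm c G p))) p0"
    by (rule smooth_on_near[OF U(1,2)])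
  assume d: "d \<in> Basis"
  have Ck: "Ck_on (Suc 0) D V h" if "smooth_on D V h" for D V and h :: "'x::real_normed_vector \<Rightarrow> real"
    using that unfolding smooth_on_def by (rule spec)
  have has: "has_dir_deriv d (\<lambda>p. ?f (q p)) p0
      (\<Sum>b\<in>vbasis r. dir_deriv d (\<lambda>p. Poly_Mapping.lookup (q p) (vkey b)) p0 *\<^sub>R dir_deriv b ?f (q p0))"
    by (rule has_dir_deriv_compose[OF finite_vbasis open_along_vchart_image[OF c] open_along_open[OF U(1)]
          Ck[OF U(4)] Ck[OF fW] q qW d U(2)])
  have "dir_deriv d (\<lambda>p. f (jet \<A> imm r (fgerm c G p))) p0 = dir_deriv d (\<lambda>p. ?f (q p)) p0"
    by (rule dir_deriv_cong_on(2)[OF open_along_open[OF U(1)] d U(2) fq[symmetric]])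
  also have "\<dots> = (\<Sum>b\<in>vbasis r. dir_deriv d (\<lambda>p. Poly_Mapping.lookup (q p) (vkey b)) p0 *\<^sub>R dir_deriv b ?f (q p0))"
    by (rule dir_deriv_eq[OF has])
  also have "\<dots> = (\<Sum>B\<in>UNIV. \<Sum>M | size M \<le> r. dir_deriv d (\<lambda>p. Poly_Mapping.lookup (q p) (B, M)) p0 *
      dir_deriv (Poly_Mapping.single (B, M) 1) ?f (q p0))"
    unfolding sum_vbasis by simp
  \<comment> \<open>The chain rule yields one term per independent coordinate; the normalisation of
    \<open>vpartial\<close> spreads it evenly over all orderings of its index.\<close>
  also have "\<dots> = (\<Sum>B\<in>UNIV. \<Sum>J | length J \<le> r. list_weight (mset J) / fact (length J) *
      (dir_deriv d (\<lambda>p. Poly_Mapping.lookup (q p) (B, mset J)) p0 * dir_deriv (Poly_Mapping.single (B, mset J) 1) ?f (q p0)))"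
    unfolding sum_lists_mset[of _ _, symmetric] by (rule refl)
  also have "\<dots> = (\<Sum>B\<in>UNIV. \<Sum>J | length J \<le> r. vpartial \<A> imm r c B J f (jet \<A> imm r (fgerm c G p0)) *
          dir_deriv d (\<lambda>p. iter_partial J (\<lambda>u. G (p, u) $ B) 0) p0)"
  proof (intro sum.cong refl)
    fix B and J :: "'n list" assume "J \<in> {J. length J \<le> r}"
    then have "dir_deriv d (\<lambda>p. Poly_Mapping.lookup (q p) (B, mset J)) p0 = dir_deriv d (\<lambda>p. iter_partial J (\<lambda>u. G (p, u) $ B) 0) p0"
      using lk by (intro dir_deriv_cong_nhds) simp
    then show "list_weight (mset J) / fact (length J) *
      (dir_deriv d (\<lambda>p. Poly_Mapping.lookup (q p) (B, mset J)) p0 * dir_deriv (Poly_Mapping.single (B, mset J) 1) ?f (q p0))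
      = vpartial \<A> imm r c B J f (jet \<A> imm r (fgerm c G p0)) * dir_deriv d (\<lambda>p. iter_partial J (\<lambda>u. G (p, u) $ B) 0) p0"
      by (simp add: vpartial_def list_weight_def q_def)
  qed
  finally show "dir_deriv d (\<lambda>p. f (jet \<A> imm r (fgerm c G p))) p0
      = (\<Sum>B\<in>UNIV. \<Sum>J | length J \<le> r. vpartial \<A> imm r c B J f (jet \<A> imm r (fgerm c G p0)) *
          dir_deriv d (\<lambda>p. iter_partial J (\<lambda>u. G (p, u) $ B) 0) p0)" .
qed

end

section \<open>Formal derivatives along germs\<close>

lemma vpartial_weight:
  "vpartial \<A> imm t c A J f p = list_weight (mset J) / fact (length J) *
     dir_deriv (Poly_Mapping.single (A, mset J) 1) (local_rep \<A> imm t c f) (vchart t c p)"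
  by (simp add: vpartial_def list_weight_def)

lemma vpartial_mset: "mset J = mset J' \<Longrightarrow> vpartial \<A> imm t c A J = vpartial \<A> imm t c A J'"
  by (auto simp: vpartial_def fun_eq_iff dest: mset_eq_length)

text \<open>The map sending \<open>v\<close> to the jet of \<open>shift \<gamma> v\<close> is the
  prolongation of \<open>\<gamma>\<close>, with the jet at \<open>v\<close> transported to
  0.\<close>

definition shift :: "(real ^ 'n \<Rightarrow> 'a) \<Rightarrow> real ^ 'n \<Rightarrow> real ^ 'n \<Rightarrow> 'a" where
  "shift \<gamma> v u = \<gamma> (u + v)"

lemma shift_0 [simp]: "shift \<gamma> 0 = \<gamma>"
  by (simp add: shift_def fun_eq_iff)

lemma shift_shift: "shift (shift \<gamma> v) w = shift \<gamma> (w + v)"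
  by (simp add: shift_def fun_eq_iff add_ac)

context velocity_bundle
begin

section \<open>Smooth functions of velocities and their order\<close>

definition vsmooth :: "nat \<Rightarrow> ('a, 'N) chart \<Rightarrow> (('a, 'n::finite) velocity \<Rightarrow> real) \<Rightarrow> bool" where
  "vsmooth t c f \<longleftrightarrow> c \<in> \<A> \<and> vsmooth_on \<A> imm t c (vdom \<A> imm t c) f"

lemma vsmoothI:
  assumes "c \<in> \<A>" "smooth_on (vbasis t) (vchart t c ` vdom \<A> imm t c) h"
    and "\<And>p. p \<in> vdom \<A> imm t c \<Longrightarrow> f p = h (vchart t c p)"
  shows "vsmooth t c f"
  unfolding vsmooth_def vsmooth_on_def
  using assms(1,3)
  by (auto intro!: smooth_on_cong[OF open_along_vchart_image[OF assms(1)] _ assms(2)] simp: local_rep_vchart)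

lemma vsmooth_local_rep:
  "vsmooth t c f \<Longrightarrow> smooth_on (vbasis t) (vchart t c ` vdom \<A> imm t c) (local_rep \<A> imm t c f)"
  by (simp add: vsmooth_def vsmooth_on_def)

lemma vsmooth_chart: "vsmooth t c f \<Longrightarrow> c \<in> \<A>"
  by (simp add: vsmooth_def)

lemma vsmooth_sum:
  assumes c: "c \<in> \<A>" and f: "\<And>i. i \<in> I \<Longrightarrow> vsmooth t c (f i)"
  shows "vsmooth t c (\<lambda>p. \<Sum>i\<in>I. f i p)"
  by (rule vsmoothI[OF c smooth_on_sum[OF open_along_vchart_image[OF c] vsmooth_local_rep[OF f]]])
    (simp_all add: local_rep_vchart c)

lemma vsmooth_mult:
  assumes "vsmooth t c f" "vsmooth t c g"
  shows "vsmooth t c (\<lambda>p. f p * g p)"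
proof -
  note c = vsmooth_chart[OF assms(1)]
  show ?thesis
    by (rule vsmoothI[OF c smooth_on_mult[OF open_along_vchart_image[OF c] vsmooth_local_rep[OF assms(1)] vsmooth_local_rep[OF assms(2)]]])
      (simp add: local_rep_vchart c)
qed

lemma vsmooth_const:
  assumes c: "c \<in> \<A>"
  shows "vsmooth t c (\<lambda>p. x)"
  by (rule vsmoothI[OF c smooth_on_const[OF open_along_vchart_image[OF c]]]) simp

lemma vsmooth_diff:
  assumes "vsmooth t c f" "vsmooth t c g"
  shows "vsmooth t c (\<lambda>p. f p - g p)"
proof -
  note c = vsmooth_chart[OF assms(1)]
  show ?thesis
    by (rule vsmoothI[OF c smooth_on_diff[OF open_along_vchart_image[OF c] vsmooth_local_rep[OF assms(1)] vsmooth_local_rep[OF assms(2)]]])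
      (simp add: local_rep_vchart c)
qed

lemma vsmooth_vcoord:
  assumes c: "c \<in> \<A>" and J: "length J \<le> t"
  shows "vsmooth t c (vcoord c A J)"
  by (rule vsmoothI[OF c smooth_on_linear[OF bounded_linear_lookup[of "(A, mset J)"] open_along_vchart_image[OF c]]])
    (simp add: lookup_vchart_vcoord c J)

lemma vsmooth_vpartial:
  assumes f: "vsmooth t c f" and J: "length J \<le> t"
  shows "vsmooth t c (vpartial \<A> imm t c A J f)"
proof -
  note c = vsmooth_chart[OF f]
  have "smooth_on (vbasis t) (vchart t c ` vdom \<A> imm t c)
     (\<lambda>a. list_weight (mset J) / fact (length J) * dir_deriv (Poly_Mapping.single (A, mset J) 1) (local_rep \<A> imm t c f) a)"
    by (rule smooth_on_mult[OF open_along_vchart_image[OF c] smooth_on_const[OF open_along_vchart_image[OF c]]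
        smooth_on_dir_deriv[OF vsmooth_local_rep[OF f] single_in_vbasis]]) (simp add: J)
  then show ?thesis
    by (rule vsmoothI[OF c]) (simp add: vpartial_weight)
qed

lemma vsmooth_formal_deriv:
  assumes f: "vsmooth t c f" and t: "t \<ge> 1"
  shows "vsmooth t c (formal_deriv \<A> imm t c i f)"
  unfolding formal_deriv_def[abs_def]
  by (intro vsmooth_sum vsmooth_mult vsmooth_vcoord vsmooth_vpartial f vsmooth_chart[OF f]) (use t in auto)

text \<open>Functions pulled back from a lower order stay functions on velocities of order
  \<open>t\<close>. Their true order must be recorded, since \<open>formal_deriv\<close> drops the
  terms with \<open>length J = t\<close>.\<close>

definition order_le :: "nat \<Rightarrow> ('a, 'N) chart \<Rightarrow> nat \<Rightarrow> (('a, 'n::finite) velocity \<Rightarrow> real) \<Rightarrow> bool" where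
  "order_le t c r f \<longleftrightarrow> (\<forall>p\<in>vdom \<A> imm t c. \<forall>q\<in>vdom \<A> imm t c.
     (\<forall>A M. size M \<le> r \<longrightarrow> Poly_Mapping.lookup (vchart t c p) (A, M) = Poly_Mapping.lookup (vchart t c q) (A, M))
       \<longrightarrow> f p = f q)"

text \<open>Since the chart image is open, short pieces of coordinate lines consist of coordinates
  of velocities; so values of a function on velocities determine its partial derivatives.\<close>

lemma vchart_image_line:
  assumes "c \<in> \<A>" "p \<in> vdom \<A> imm t c" "length J \<le> t"
  shows "eventually (\<lambda>h::real. \<exists>p'\<in>vdom \<A> imm t c. vchart t c p' = vchart t c p + h *\<^sub>R Poly_Mapping.single (A, mset J) 1) (nhds 0)"
proof -
  have "Poly_Mapping.single (A, mset J) 1 \<in> vbasis t"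
    by (rule single_in_vbasis) (simp add: assms(3))
  from open_along_line[OF open_along_vchart_image[OF assms(1)] imageI[OF assms(2)] this]
  show ?thesis by eventually_elim (metis imageE)
qed

lemma vpartial_eqI:
  assumes c: "c \<in> \<A>" and p: "p \<in> vdom \<A> imm t c" and q: "q \<in> vdom \<A> imm t c" and J: "length J \<le> t"
    and eq: "\<And>p' q' h. p' \<in> vdom \<A> imm t c \<Longrightarrow> q' \<in> vdom \<A> imm t c \<Longrightarrow>
      vchart t c p' = vchart t c p + h *\<^sub>R Poly_Mapping.single (A, mset J) 1 \<Longrightarrow>
      vchart t c q' = vchart t c q + h *\<^sub>R Poly_Mapping.single (A, mset J) 1 \<Longrightarrow> f p' = f q'"
  shows "vpartial \<A> imm t c A J f p = vpartial \<A> imm t c A J f q"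
proof -
  let ?s = "Poly_Mapping.single (A, mset J) (1::real)"
  have "eventually (\<lambda>h. local_rep \<A> imm t c f (vchart t c p + h *\<^sub>R ?s) = local_rep \<A> imm t c f (vchart t c q + h *\<^sub>R ?s)) (nhds 0)"
    using vchart_image_line[OF c p J, of A] vchart_image_line[OF c q J, of A]
  proof eventually_elim
    case (elim h)
    then obtain p' q' where "p' \<in> vdom \<A> imm t c" "vchart t c p' = vchart t c p + h *\<^sub>R ?s"
      "q' \<in> vdom \<A> imm t c" "vchart t c q' = vchart t c q + h *\<^sub>R ?s"
      by blast
    then show ?case using eq local_rep_vchart[OF c] by metis
  qed
  then show ?thesis
    by (simp add: vpartial_def dir_deriv_def vector_derivative_cong_nhds)
qed

lemma order_le_vpartial:
  assumes c: "c \<in> \<A>" and f: "order_le t c r f" and J: "length J \<le> t"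
  shows "order_le t c r (vpartial \<A> imm t c A J f)"
  unfolding order_le_def
proof (intro ballI impI, rule vpartial_eqI[OF c _ _ J])
  fix p q p' q' h
  assume eq: "\<forall>A M. size M \<le> r \<longrightarrow> Poly_Mapping.lookup (vchart t c p) (A, M) = Poly_Mapping.lookup (vchart t c q) (A, M)"
    and pq: "p' \<in> vdom \<A> imm t c" "q' \<in> vdom \<A> imm t c"
    and line: "vchart t c p' = vchart t c p + h *\<^sub>R Poly_Mapping.single (A, mset J) 1"
      "vchart t c q' = vchart t c q + h *\<^sub>R Poly_Mapping.single (A, mset J) 1"
  show "f p' = f q'"
    by (rule f[unfolded order_le_def, rule_format, OF pq]) (simp add: line lookup_add eq)
qed

lemma vpartial_high_order:
  assumes c: "c \<in> \<A>" and f: "order_le t c r f" and J: "length J \<le> t" "r < length J" and p: "p \<in> vdom \<A> imm t c"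
  shows "vpartial \<A> imm t c A J f p = 0"
proof -
  let ?s = "Poly_Mapping.single (A, mset J) (1::real)"
  have "eventually (\<lambda>h. local_rep \<A> imm t c f (vchart t c p + h *\<^sub>R ?s) = f p) (nhds 0)"
    using vchart_image_line[OF c p J(1), of A]
  proof eventually_elim
    case (elim h)
    then obtain p' where p': "p' \<in> vdom \<A> imm t c" "vchart t c p' = vchart t c p + h *\<^sub>R ?s"
      by blast
    have "f p' = f p"
      by (rule f[unfolded order_le_def, rule_format, OF p'(1) p])
        (use J(2) in \<open>auto simp: p'(2) lookup_add lookup_single when_def\<close>)
    then show ?case using p' local_rep_vchart[OF c p'(1)] by metis
  qed
  then have "vector_derivative (\<lambda>h. local_rep \<A> imm t c f (vchart t c p + h *\<^sub>R ?s)) (at 0) = vector_derivative (\<lambda>h. f p) (at 0)"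
    by (rule vector_derivative_cong_nhds)
  then show ?thesis by (simp add: vpartial_def dir_deriv_def)
qed

text \<open>Terms with \<open>length J > r\<close> vanish because \<open>f\<close> does not see
  these coordinates; in the others \<open>i # J\<close> has at most \<open>Suc r\<close>
  entries.\<close>

lemma order_le_formal_deriv:
  fixes f :: "('a, 'n::finite) velocity \<Rightarrow> real"
  assumes c: "c \<in> \<A>" and f: "order_le t c r f" and r: "r < t"
  shows "order_le t c (Suc r) (formal_deriv \<A> imm t c i f)"
  unfolding order_le_def formal_deriv_def
proof (intro ballI impI sum.cong refl)
  fix p q :: "('a, 'n) velocity" and A and J :: "'n list"
  assume p: "p \<in> vdom \<A> imm t c" and q: "q \<in> vdom \<A> imm t c" and "J \<in> {J. length J \<le> t - 1}"
    and eq: "\<forall>A M. size M \<le> Suc r \<longrightarrow> Poly_Mapping.lookup (vchart t c p) (A, M) = Poly_Mapping.lookup (vchart t c q) (A, M)"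
  then have J: "length J \<le> t" "length (i # J) \<le> t" using r by auto
  show "vcoord c A (i # J) p * vpartial \<A> imm t c A J f p = vcoord c A (i # J) q * vpartial \<A> imm t c A J f q"
  proof (cases "length J \<le> r")
    case True
    have "vpartial \<A> imm t c A J f p = vpartial \<A> imm t c A J f q"
      by (rule order_le_vpartial[OF c f J(1), unfolded order_le_def, rule_format, OF p q]) (simp add: eq)
    moreover have "vcoord c A (i # J) p = vcoord c A (i # J) q"
      using lookup_vchart_vcoord[OF p c J(2)] lookup_vchart_vcoord[OF q c J(2)] eq True by (metis Suc_le_mono length_Cons size_mset)
    ultimately show ?thesis by simp
  next
    case False
    then show ?thesis using vpartial_high_order[OF c f J(1)] p q by simp
  qed
qed

text \<open>The translated germs form a family whose parameter is the translation vector, so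
  \<open>family_function\<close> applies along the prolongation of \<open>\<gamma>\<close>.\<close>

lemma shift_family:
  assumes \<gamma>: "\<gamma> \<in> germs" "\<gamma> 0 \<in> fst c" and c: "c \<in> \<A>"
  defines "G \<equiv> \<lambda>(v, u). snd c (\<gamma> (u + v))"
  shows "family c G 0"
    and "eventually (\<lambda>v. shift \<gamma> v \<in> germs \<and> shift \<gamma> v 0 \<in> fst c \<and> family c G v \<and>
      (\<forall>r. jet \<A> imm r (shift \<gamma> v) = jet \<A> imm r (fgerm c G v))) (nhds 0)"
proof -
  have "bounded_linear (\<lambda>p :: (real ^ 'b) \<times> (real ^ 'b). snd p + fst p)"
    by (intro bounded_linear_add bounded_linear_fst bounded_linear_snd)
  from smooth_near_compose[OF smooth_near_linear[OF this], of "\<lambda>u. snd c (\<gamma> u)" "(0, 0)"]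
  have "smooth_near G (0, 0)"
    using germ_smooth[OF \<gamma>(1) c \<gamma>(2)] by (simp add: G_def case_prod_unfold)
  then show fam: "family c G 0"
    using \<gamma> c germ_immersive[OF \<gamma>(1) c \<gamma>(2)] by (auto simp: family_def G_def)
  have "eventually (\<lambda>v. eventually (\<lambda>u. \<gamma> u \<in> fst c) (nhds v)) (nhds 0)"
    using germ_near[OF \<gamma>(1) c \<gamma>(2)] unfolding eventually_eventually .
  with eventually_family[OF fam]
  show "eventually (\<lambda>v. shift \<gamma> v \<in> germs \<and> shift \<gamma> v 0 \<in> fst c \<and> family c G v \<and>
      (\<forall>r. jet \<A> imm r (shift \<gamma> v) = jet \<A> imm r (fgerm c G v))) (nhds 0)"
  proof eventually_elim
    case (elim v)
    have "filterlim (\<lambda>u. u + v) (nhds (0 + v)) (nhds 0)"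
      by (intro tendsto_add filterlim_ident tendsto_const)
    with elim(2) have ev: "eventually (\<lambda>u. shift \<gamma> v u \<in> fst c) (nhds 0)"
      using eventually_compose_filterlim[of "\<lambda>u. \<gamma> u \<in> fst c" "nhds v" "\<lambda>u. u + v" "nhds 0"] by (simp add: shift_def)
    have G: "(\<lambda>u. snd c (shift \<gamma> v u)) = (\<lambda>u. G (v, u))" by (simp add: G_def shift_def)
    have v0: "shift \<gamma> v 0 \<in> fst c" using eventually_nhds_x_imp_x[OF ev] .
    have g: "shift \<gamma> v \<in> germs"
    proof (rule germsI[OF c _ ev])
      show "smooth_near (\<lambda>u. snd c (shift \<gamma> v u)) 0"
        unfolding G by (rule smooth_near_slice_point(2)) (use elim(1) in \<open>simp add: family_def\<close>)
      show "inj (dir_jacobian (\<lambda>u. snd c (shift \<gamma> v u)) 0)" if imm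
        unfolding G using elim(1) that unfolding family_def by blast
    qed
    have "agree r c (shift \<gamma> v) (fgerm c G v)" for r
      unfolding agree_def iter_partial_fgerm[OF elim(1)] G[THEN fun_cong] by simp
    then show ?case
      using g v0 elim(1) jet_eqI[OF g family_germ(1)[OF elim(1)] c v0 family_germ(2)[OF elim(1)]] by blast
  qed
qed

lemma smooth_near_along_germ:
  assumes \<gamma>: "\<gamma> \<in> germs" "\<gamma> 0 \<in> fst c" and f: "vsmooth t c f"
  shows "smooth_near (\<lambda>v. f (jet \<A> imm t (shift \<gamma> v))) 0"
proof -
  note c = vsmooth_chart[OF f]
  note fam = shift_family[OF \<gamma> c]
  have "eventually (\<lambda>v. f (jet \<A> imm t (fgerm c (\<lambda>(v, u). snd c (\<gamma> (u + v))) v)) = f (jet \<A> imm t (shift \<gamma> v))) (nhds 0)"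
    using fam(2) by eventually_elim simp
  then show ?thesis
    by (rule smooth_near_cong) (rule smooth_near_family[OF fam(1)], use f in \<open>simp add: vsmooth_def\<close>)
qed

text \<open>The chain rule along the prolongation: there the \<open>i\<close>-th partial derivative
  of the coordinate with index \<open>J\<close> is the coordinate with index
  \<open>i # J\<close>.\<close>

lemma formal_deriv_along_germ:
  assumes \<gamma>: "\<gamma> \<in> germs" "\<gamma> 0 \<in> fst c" and f: "vsmooth t c f" and r: "order_le t c r f" "r < t"
  shows "formal_deriv \<A> imm t c i f (jet \<A> imm t \<gamma>) = dir_deriv (axis i 1) (\<lambda>v. f (jet \<A> imm t (shift \<gamma> v))) 0"
proof -
  note c = vsmooth_chart[OF f]
  note fam = shift_family[OF \<gamma> c]
  let ?G = "\<lambda>(v, u). snd c (\<gamma> (u + v))"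
  have p: "jet \<A> imm t \<gamma> \<in> vdom \<A> imm t c" using jet_mem_vdom[OF \<gamma>(1)] \<gamma>(2) by simp
  have "dir_deriv (axis i 1) (\<lambda>v. f (jet \<A> imm t (shift \<gamma> v))) 0
    = dir_deriv (axis i 1) (\<lambda>v. f (jet \<A> imm t (fgerm c ?G v))) 0"
    by (rule dir_deriv_cong_nhds) (use fam(2) in \<open>eventually_elim, simp\<close>)
  also have "\<dots> = (\<Sum>B\<in>UNIV. \<Sum>J | length J \<le> t. vpartial \<A> imm t c B J f (jet \<A> imm t (fgerm c ?G 0)) *
          dir_deriv (axis i 1) (\<lambda>v. iter_partial J (\<lambda>u. ?G (v, u) $ B) 0) 0)"
    by (rule dir_deriv_family[OF fam(1)]) (use f in \<open>simp_all add: vsmooth_def\<close>)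
  also have "jet \<A> imm t (fgerm c ?G 0) = jet \<A> imm t \<gamma>"
    using eventually_nhds_x_imp_x[OF fam(2)] by simp
  also have "(\<Sum>B\<in>UNIV. \<Sum>J | length J \<le> t. vpartial \<A> imm t c B J f (jet \<A> imm t \<gamma>) *
          dir_deriv (axis i 1) (\<lambda>v. iter_partial J (\<lambda>u. ?G (v, u) $ B) 0) 0)
    = (\<Sum>B\<in>UNIV. \<Sum>J | length J \<le> t - 1. vcoord c B (i # J) (jet \<A> imm t \<gamma>) * vpartial \<A> imm t c B J f (jet \<A> imm t \<gamma>))"
  proof (rule sum.cong[OF refl], rule sum.mono_neutral_cong_right)
    fix B
    \<comment> \<open>The indices of length exactly \<open>t\<close>, absent from
      \<open>formal_deriv\<close>, contribute nothing because \<open>f\<close> has order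
      \<open>r < t\<close>.\<close>
    show "\<forall>J\<in>{J. length J \<le> t} - {J. length J \<le> t - 1}. vpartial \<A> imm t c B J f (jet \<A> imm t \<gamma>) *
          dir_deriv (axis i 1) (\<lambda>v. iter_partial J (\<lambda>u. ?G (v, u) $ B) 0) 0 = 0"
      using vpartial_high_order[OF c r(1) _ _ p] r(2) by auto
    fix J :: "'b list" assume "J \<in> {J. length J \<le> t - 1}"
    then have J: "length (i # J) \<le> t" using r(2) by auto
    show "vpartial \<A> imm t c B J f (jet \<A> imm t \<gamma>) * dir_deriv (axis i 1) (\<lambda>v. iter_partial J (\<lambda>u. ?G (v, u) $ B) 0) 0
      = vcoord c B (i # J) (jet \<A> imm t \<gamma>) * vpartial \<A> imm t c B J f (jet \<A> imm t \<gamma>)"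
      unfolding vcoord_jet[OF \<gamma>(1) c \<gamma>(2) J] by (simp add: iter_partial_shift[of J "\<lambda>u. snd c (\<gamma> u) $ B"])
  qed auto
  finally show ?thesis by (simp add: formal_deriv_def)
qed

text \<open>Smoothness and order are carried through the induction, as each further formal
  derivative requires both and raises the order by one. The equation is claimed for all germs so
  that it can be used at \<open>shift \<gamma> v\<close> and then differentiated in
  \<open>v\<close>.\<close>

lemma formal_derivs_along_germ:
  assumes f: "vsmooth t c f" and r: "order_le t c r f" "r + length J \<le> t"
  shows "vsmooth t c (formal_derivs \<A> imm t c J f) \<and> order_le t c (r + length J) (formal_derivs \<A> imm t c J f) \<and>
    (\<forall>\<gamma>\<in>germs. \<gamma> 0 \<in> fst c \<longrightarrow>
      formal_derivs \<A> imm t c J f (jet \<A> imm t \<gamma>) = iter_partial J (\<lambda>v. f (jet \<A> imm t (shift \<gamma> v))) 0)"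
  using r(2)
proof (induction J)
  case Nil
  then show ?case using f r by (simp add: formal_derivs_def)
next
  case (Cons i J)
  note c = vsmooth_chart[OF f]
  let ?g = "formal_derivs \<A> imm t c J f"
  have fd: "formal_derivs \<A> imm t c (i # J) f = formal_deriv \<A> imm t c i ?g"
    by (simp add: formal_derivs_def)
  have IH: "vsmooth t c ?g" "order_le t c (r + length J) ?g"
    "\<And>\<gamma>. \<gamma> \<in> germs \<Longrightarrow> \<gamma> 0 \<in> fst c \<Longrightarrow> ?g (jet \<A> imm t \<gamma>) = iter_partial J (\<lambda>v. f (jet \<A> imm t (shift \<gamma> v))) 0"
    using Cons by auto
  have lt: "r + length J < t" using Cons.prems by simp
  have "formal_deriv \<A> imm t c i ?g (jet \<A> imm t \<gamma>) = iter_partial (i # J) (\<lambda>v. f (jet \<A> imm t (shift \<gamma> v))) 0"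
    if \<gamma>: "\<gamma> \<in> germs" "\<gamma> 0 \<in> fst c" for \<gamma>
  proof -
    have "eventually (\<lambda>v. ?g (jet \<A> imm t (shift \<gamma> v)) = iter_partial J (\<lambda>v. f (jet \<A> imm t (shift \<gamma> v))) v) (nhds 0)"
      using shift_family(2)[OF \<gamma> c]
    proof eventually_elim
      case (elim v)
      then have "?g (jet \<A> imm t (shift \<gamma> v)) = iter_partial J (\<lambda>w. f (jet \<A> imm t (shift \<gamma> (w + v)))) 0"
        using IH(3)[of "shift \<gamma> v"] by (simp add: shift_shift)
      then show ?case using iter_partial_shift[of J "\<lambda>v. f (jet \<A> imm t (shift \<gamma> v))" v 0] by simp
    qed
    then show ?thesis
      unfolding formal_deriv_along_germ[OF \<gamma> IH(1,2) lt] by (simp add: dir_deriv_cong_nhds)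
  qed
  moreover have "vsmooth t c (formal_deriv \<A> imm t c i ?g)"
    by (rule vsmooth_formal_deriv[OF IH(1)]) (use lt in simp)
  ultimately show ?case
    unfolding fd using order_le_formal_deriv[OF c IH(2) lt] by simp
qed

section \<open>Functions pulled back from lower order\<close>

lemma lookup_vchart_proj:
  assumes "p \<in> vdom \<A> imm t c" "c \<in> \<A>" "s \<le> t" "size M \<le> s"
  shows "Poly_Mapping.lookup (vchart s c (velocity_proj \<A> imm s p)) (A, M) = Poly_Mapping.lookup (vchart t c p) (A, M)"
proof -
  obtain \<gamma> where \<gamma>: "\<gamma> \<in> germs" "\<gamma> 0 \<in> fst c" "p = jet \<A> imm t \<gamma>" using assms(1) by (rule vdomE)
  obtain J where J: "mset J = M" using ex_mset by blast
  then have "length J \<le> s" using assms(4) by auto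
  then show ?thesis
    using lookup_vchart_jet[OF \<gamma>(1) assms(2) \<gamma>(2), of J] assms(3)
    by (simp add: J[symmetric] \<gamma>(3) velocity_proj_jet[OF \<gamma>(1) assms(3)])
qed

lemma order_le_proj:
  fixes f :: "('a, 'n::finite) velocity \<Rightarrow> real"
  assumes "c \<in> \<A>" "s \<le> t"
  shows "order_le t c s (f \<circ> velocity_proj \<A> imm s)"
  unfolding order_le_def
proof (intro ballI impI)
  fix p q :: "('a, 'n) velocity"
  assume p: "p \<in> vdom \<A> imm t c" and q: "q \<in> vdom \<A> imm t c"
    and eq: "\<forall>A M. size M \<le> s \<longrightarrow> Poly_Mapping.lookup (vchart t c p) (A, M) = Poly_Mapping.lookup (vchart t c q) (A, M)"
  have "vchart s c (velocity_proj \<A> imm s p) = vchart s c (velocity_proj \<A> imm s q)"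
  proof (rule poly_mapping_eqI, clarify)
    fix A and M :: "'n multiset"
    show "Poly_Mapping.lookup (vchart s c (velocity_proj \<A> imm s p)) (A, M) = Poly_Mapping.lookup (vchart s c (velocity_proj \<A> imm s q)) (A, M)"
      using lookup_vchart_proj[OF p assms, of M A] lookup_vchart_proj[OF q assms, of M A] eq
      by (cases "size M \<le> s") (simp_all add: lookup_vchart)
  qed
  then have "velocity_proj \<A> imm s p = velocity_proj \<A> imm s q"
    using vchart_inj[OF assms(1)] velocity_proj_vdom[OF p assms(2)] velocity_proj_vdom[OF q assms(2)]
    by (meson inj_onD)
  then show "(f \<circ> velocity_proj \<A> imm s) p = (f \<circ> velocity_proj \<A> imm s) q" by simp
qed

lemma vsmooth_proj:
  assumes f: "vsmooth s c f" and st: "s \<le> t"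
  shows "vsmooth t c (f \<circ> velocity_proj \<A> imm s)"
proof -
  note c = vsmooth_chart[OF f]
  \<comment> \<open>The projection in coordinates, which discards all coordinates of order above
    \<open>s\<close>.\<close>
  define \<tau> where "\<tau> = (\<lambda>a :: ('N, 'b) vcoords. \<Sum>b\<in>vbasis s. Poly_Mapping.lookup a (vkey b) *\<^sub>R b)"
  have \<tau>: "\<tau> (vchart t c p) = vchart s c (velocity_proj \<A> imm s p)" if p: "p \<in> vdom \<A> imm t c" for p
  proof -
    have "vchart s c (velocity_proj \<A> imm s p)
      = (\<Sum>b\<in>vbasis s. Poly_Mapping.lookup (vchart s c (velocity_proj \<A> imm s p)) (vkey b) *\<^sub>R b)"
      by (rule vcoords_expansion) (simp add: lookup_vchart)
    also have "\<dots> = \<tau> (vchart t c p)"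
      unfolding \<tau>_def by (rule sum.cong) (auto simp: vbasis_def lookup_vchart_proj[OF p c st])
    finally show ?thesis ..
  qed
  have "smooth_on (vbasis t) (vchart t c ` vdom \<A> imm t c) (\<lambda>a. local_rep \<A> imm s c f (\<tau> a))"
    by (rule smooth_on_compose[OF finite_vbasis open_along_vchart_image[OF c] open_along_vchart_image[OF c] _ _ _ vsmooth_local_rep[OF f]])
      (auto simp: \<tau>_def[symmetric] \<tau> velocity_proj_vdom st
        intro!: imageI smooth_on_linear[OF bounded_linear_lookup open_along_vchart_image[OF c]] fun_cong[OF \<tau>_def])
  then show ?thesis
    by (rule vsmoothI[OF c]) (simp add: \<tau> local_rep_vchart[OF c] velocity_proj_vdom st)
qed

text \<open>A coordinate line of order \<open>t\<close> in a direction of order at most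
  \<open>s\<close> projects onto the corresponding line of order \<open>s\<close>. This connects
  \<open>helmholtz\<close>, computed on order \<open>t\<close>, with the linearization rule,
  computed on order \<open>s\<close>.\<close>

lemma vpartial_proj:
  assumes c: "c \<in> \<A>" and p: "p \<in> vdom \<A> imm t c" and st: "s \<le> t" and J: "length J \<le> s"
  shows "vpartial \<A> imm t c A J (f \<circ> velocity_proj \<A> imm s) p = vpartial \<A> imm s c A J f (velocity_proj \<A> imm s p)"
proof -
  let ?s = "Poly_Mapping.single (A, mset J) (1::real)"
  have "eventually (\<lambda>h. local_rep \<A> imm t c (f \<circ> velocity_proj \<A> imm s) (vchart t c p + h *\<^sub>R ?s)
      = local_rep \<A> imm s c f (vchart s c (velocity_proj \<A> imm s p) + h *\<^sub>R ?s)) (nhds 0)"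
    using vchart_image_line[OF c p order_trans[OF J st], of A]
  proof eventually_elim
    case (elim h)
    then obtain p' where p': "p' \<in> vdom \<A> imm t c" "vchart t c p' = vchart t c p + h *\<^sub>R ?s"
      by blast
    have "vchart s c (velocity_proj \<A> imm s p') = vchart s c (velocity_proj \<A> imm s p) + h *\<^sub>R ?s"
    proof (rule poly_mapping_eqI, clarify)
      fix B and M :: "'b multiset"
      show "Poly_Mapping.lookup (vchart s c (velocity_proj \<A> imm s p')) (B, M)
        = Poly_Mapping.lookup (vchart s c (velocity_proj \<A> imm s p) + h *\<^sub>R ?s) (B, M)"
      proof (cases "size M \<le> s")
        case True
        then show ?thesis
          using lookup_vchart_proj[OF p'(1) c st True] lookup_vchart_proj[OF p c st True] p'(2) by (simp add: lookup_add)
      next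
        case False
        then show ?thesis using J by (auto simp: lookup_vchart lookup_add lookup_single when_def)
      qed
    qed
    then have "local_rep \<A> imm s c f (vchart s c (velocity_proj \<A> imm s p) + h *\<^sub>R ?s) = f (velocity_proj \<A> imm s p')"
      using local_rep_vchart[OF c velocity_proj_vdom[OF p'(1) st]] by metis
    moreover have "local_rep \<A> imm t c (f \<circ> velocity_proj \<A> imm s) (vchart t c p + h *\<^sub>R ?s) = f (velocity_proj \<A> imm s p')"
      using local_rep_vchart[OF c p'(1), of "f \<circ> velocity_proj \<A> imm s"] p'(2) by simp
    ultimately show ?case by (simp add: o_def)
  qed
  then show ?thesis
    by (simp add: vpartial_def dir_deriv_def vector_derivative_cong_nhds o_def)
qed

end

section \<open>Tangent vectors and changes of charts\<close>

text \<open>Expands the adjoint by Leibniz. Next to \<open>(-1) ^ length J\<close>, the coefficient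
  of \<open>iter_partial J (\<xi> B)\<close> has the form of a Lie-Euler operator with partial
  derivatives in place of formal ones.\<close>

lemma adj_op_expansion:
  fixes a :: "'N::finite \<Rightarrow> 'N \<Rightarrow> 'n::finite list \<Rightarrow> real ^ 'n \<Rightarrow> real"
  assumes sym: "\<And>A B J J'. mset J = mset J' \<Longrightarrow> a A B J = a A B J'"
    and a: "\<And>A B J. smooth_near (a A B J) u" and \<xi>: "\<And>B. smooth_near (\<xi> B) u"
  shows "adj_op s a \<xi> A u = (\<Sum>B\<in>UNIV. \<Sum>J | length J \<le> s. (-1) ^ length J *
    (\<Sum>I | length I \<le> s - length J. (-1) ^ length I * real ((length J + length I) choose length J) *
       iter_partial I (a B A (J @ I)) u) * iter_partial J (\<xi> B) u)"
  unfolding adj_op_def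
proof (rule sum.cong[OF refl])
  fix B
  have "(\<Sum>K | length K \<le> s. (-1) ^ length K * iter_partial K (\<lambda>v. a B A K v * \<xi> B v) u)
    = (\<Sum>K | length K \<le> s. \<Sum>p\<leftarrow>splits K. (-1) ^ (length (fst p) + length (snd p)) *
        (iter_partial (fst p) (a B A (snd p @ fst p)) u * iter_partial (snd p) (\<xi> B) u))"
  proof (rule sum.cong[OF refl])
    fix K
    have "(-1) ^ length K * iter_partial K (\<lambda>v. a B A K v * \<xi> B v) u
      = (\<Sum>p\<leftarrow>splits K. (-1) ^ length K * (iter_partial (fst p) (a B A K) u * iter_partial (snd p) (\<xi> B) u))"
      unfolding iter_partial_mult[OF a \<xi>] by (simp add: sum_list_const_mult)
    also have "\<dots> = (\<Sum>p\<leftarrow>splits K. (-1) ^ (length (fst p) + length (snd p)) *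
        (iter_partial (fst p) (a B A (snd p @ fst p)) u * iter_partial (snd p) (\<xi> B) u))"
    proof (intro arg_cong[of _ _ sum_list] map_cong refl)
      fix p assume p: "p \<in> set (splits K)"
      have "a B A K = a B A (snd p @ fst p)"
        by (rule sym) (simp add: splits_mset[OF p])
      then show "(-1) ^ length K * (iter_partial (fst p) (a B A K) u * iter_partial (snd p) (\<xi> B) u)
        = (-1) ^ (length (fst p) + length (snd p)) *
          (iter_partial (fst p) (a B A (snd p @ fst p)) u * iter_partial (snd p) (\<xi> B) u)"
        by (simp add: splits_length[OF p])
    qed
    finally show "(-1) ^ length K * iter_partial K (\<lambda>v. a B A K v * \<xi> B v) u = \<dots>" .
  qed
  also have "\<dots> = (\<Sum>J | length J \<le> s. \<Sum>I | length I \<le> s - length J. real ((length I + length J) choose length I) *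
      ((-1) ^ (length I + length J) * (iter_partial I (a B A (J @ I)) u * iter_partial J (\<xi> B) u)))"
    by (rule sum_splits)
  also have "\<dots> = (\<Sum>J | length J \<le> s. (-1) ^ length J *
    (\<Sum>I | length I \<le> s - length J. (-1) ^ length I * real ((length J + length I) choose length J) *
       iter_partial I (a B A (J @ I)) u) * iter_partial J (\<xi> B) u)"
  proof (rule sum.cong[OF refl])
    fix J :: "'n list"
    have "real ((length I + length J) choose length I) = real ((length J + length I) choose length J)" for I :: "'n list"
      using binomial_symmetric[of "length I" "length I + length J"] by (simp add: add.commute)
    then show "(\<Sum>I | length I \<le> s - length J. real ((length I + length J) choose length I) *
      ((-1) ^ (length I + length J) * (iter_partial I (a B A (J @ I)) u * iter_partial J (\<xi> B) u)))
      = (-1) ^ length J *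
    (\<Sum>I | length I \<le> s - length J. (-1) ^ length I * real ((length J + length I) choose length J) *
       iter_partial I (a B A (J @ I)) u) * iter_partial J (\<xi> B) u"
      by (simp add: sum_distrib_left sum_distrib_right power_add mult_ac)
  qed
  finally show "(\<Sum>K | length K \<le> s. (-1) ^ length K * iter_partial K (\<lambda>v. a B A K v * \<xi> B v) u) = \<dots>" .
qed

lemma vector_derivative_dir_deriv: "vector_derivative f (at 0) = dir_deriv 1 f (0::real)"
  by (simp add: dir_deriv_def)

lemma dir_deriv_compose_slice:
  fixes G :: "real \<times> (real ^ 'n) \<Rightarrow> real ^ 'N" and h :: "real ^ 'N \<Rightarrow> real"
  assumes "smooth_near G (0, 0)" "smooth_near h (G (0, 0))"
  shows "eventually (\<lambda>u. dir_deriv 1 (\<lambda>t. h (G (t, u))) 0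
    = (\<Sum>B\<in>UNIV. dir_deriv (axis B 1) h (G (0, u)) * dir_deriv 1 (\<lambda>t. G (t, u) $ B) 0)) (nhds 0)"
proof -
  have "filterlim (\<lambda>u. (0 :: real, u)) (nhds (0, 0 :: real ^ 'n)) (nhds 0)"
    by (intro tendsto_Pair tendsto_const filterlim_ident)
  from eventually_compose_filterlim[OF eventually_smooth_near[OF assms(1)] this]
  have 1: "eventually (\<lambda>u. smooth_near G (0, u)) (nhds 0)" .
  have "smooth_near (\<lambda>u. G (0, u)) 0" by (rule smooth_near_slice_point(2)[OF assms(1)])
  then have "((\<lambda>u. G (0, u)) \<longlongrightarrow> G (0, 0)) (nhds 0)"
    using smooth_near_isCont[of "\<lambda>u. G (0, u)" 0]
    unfolding isCont_def tendsto_at_iff_tendsto_nhds[of "\<lambda>u. G (0, u)" 0] by simp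
  from eventually_compose_filterlim[OF eventually_smooth_near[OF assms(2)] this]
  have 2: "eventually (\<lambda>u. smooth_near h (G (0, u))) (nhds 0)" .
  show ?thesis
    using 1 2
  proof eventually_elim
    case (elim u)
    have "dir_deriv 1 (\<lambda>t. h (G (t, u))) 0 = (\<Sum>B\<in>UNIV. dir_deriv 1 (\<lambda>t. G (t, u) $ B) 0 *\<^sub>R dir_deriv (axis B 1) h (G (0, u)))"
      by (rule dir_deriv_compose_vec[OF smooth_near_slice_point(1)[OF elim(1)] elim(2)]) simp
    then show ?case by (simp add: mult.commute)
  qed
qed

context velocity_bundle
begin

text \<open>Rewrites a family in another chart without changing its velocities. The second claim is
  eventual, since the germs have to stay in the new chart.\<close>

lemma family_change_chart:
  fixes G :: "'p::euclidean_space \<times> (real ^ 'n::finite) \<Rightarrow> real ^ 'N"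
  assumes fam: "family c G p0" and c': "c' \<in> \<A>" and pt: "fgerm c G p0 0 \<in> fst c'"
  shows "family c' (\<lambda>q. transition c c' (G q)) p0"
    and "eventually (\<lambda>p. fgerm c G p 0 \<in> fst c' \<and>
      jet \<A> imm r (fgerm c' (\<lambda>q. transition c c' (G q)) p) = jet \<A> imm r (fgerm c G p)) (nhds p0)"
proof -
  let ?G = "\<lambda>q. transition c c' (G q)"
  have c: "c \<in> \<A>" and G: "smooth_near G (p0, 0)" and G0: "G (p0, 0) \<in> snd c ` fst c"
    using fam unfolding family_def by blast+
  note g = family_germ[OF fam]
  have slice: "(\<lambda>u. ?G (p, u)) = (\<lambda>u. snd c' (fgerm c G p u))" for p
    by (simp add: transition_def fgerm_def)
  have pt0: "snd c (fgerm c G p0 0) = G (p0, 0)"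
    unfolding fgerm_def using G0 by (rule chart_cinv)
  have "smooth_near (transition c c') (G (p0, 0))"
    using smooth_near_transition[OF c c' g(2) pt] by (simp add: pt0)
  from smooth_near_compose[OF G this] have sm: "smooth_near ?G (p0, 0)" .
  show fam': "family c' ?G p0"
    unfolding family_def slice
    using sm c' pt germ_immersive[OF g(1) c' pt] fun_cong[OF slice, of p0 0] by auto
  have "G (p0, 0) \<in> snd c ` (fst c \<inter> fst c')"
    using pt0 g(2) pt by (metis IntI imageI)
  from eventually_nhds_slice[OF smooth_near_eventually_in[OF G chart_overlap_open[OF c c'] this]]
  have "eventually (\<lambda>p. G (p, 0) \<in> snd c ` (fst c \<inter> fst c')) (nhds p0)" .
  then have "eventually (\<lambda>p. fgerm c G p 0 \<in> fst c') (nhds p0)"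
    by eventually_elim (auto simp: fgerm_def cinv_chart[OF c])
  with eventually_family[OF fam] eventually_family[OF fam']
  show "eventually (\<lambda>p. fgerm c G p 0 \<in> fst c' \<and>
      jet \<A> imm r (fgerm c' ?G p) = jet \<A> imm r (fgerm c G p)) (nhds p0)"
  proof eventually_elim
    case (elim p)
    have "agree r c' (fgerm c' ?G p) (fgerm c G p)"
      unfolding agree_def iter_partial_fgerm[OF elim(2)] slice[THEN fun_cong] by simp
    then show ?case
      using jet_eqI[OF family_germ(1)[OF elim(2)] family_germ(1)[OF elim(1)] c' family_germ(2)[OF elim(2)] elim(3)] elim(3)
      by blast
  qed
qed

lemma vsmooth_at_vcoord:
  assumes "c \<in> \<A>" "p \<in> vdom \<A> imm t c" "length J \<le> t"
  shows "vsmooth_at \<A> imm t p (vcoord c A J)"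
proof -
  have "openin (top_of_set (span (vbasis t))) (vchart t c ` vdom \<A> imm t c)"
    by (rule openin_open_along[OF open_along_vchart_image[OF assms(1)]]) (auto intro: vchart_in_span)
  moreover have "vsmooth_on \<A> imm t c (vdom \<A> imm t c) (vcoord c A J)"
    using vsmooth_vcoord[OF assms(1,3)] by (simp add: vsmooth_def)
  ultimately show ?thesis
    unfolding vsmooth_at_def using assms by blast
qed

text \<open>Lifts the curve of velocities defining \<open>v\<close> to a curve of germs: a
  representative of the initial velocity is perturbed by the Taylor polynomial of the coordinate
  increment.\<close>

lemma tangent_familyE:
  fixes p :: "('a, 'n::finite) velocity"
  assumes "v \<in> tangent_space \<A> imm t p"
  obtains c and G :: "real \<times> (real ^ 'n) \<Rightarrow> real ^ 'N" where "family c G 0" "jet \<A> imm t (fgerm c G 0) = p"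
    "\<And>f. vsmooth_at \<A> imm t p f \<Longrightarrow> v f = dir_deriv 1 (\<lambda>h. f (jet \<A> imm t (fgerm c G h))) 0"
proof -
  obtain \<kappa> where v: "v = (\<lambda>f. if vsmooth_at \<A> imm t p f then vector_derivative (f \<circ> \<kappa>) (at 0) else 0)"
    and \<kappa>: "smooth_curve \<A> imm t \<kappa>" "\<kappa> 0 = p"
    using assms unfolding tangent_space_def by blast
  obtain c e where c: "c \<in> \<A>" and e: "e > 0" and dom: "\<kappa> ` {-e<..<e} \<subseteq> vdom \<A> imm t c"
    and sm: "smooth_on Basis {-e<..<e} (vchart t c \<circ> \<kappa>)"
    using \<kappa>(1) unfolding smooth_curve_def by blast
  have "\<kappa> 0 \<in> vdom \<A> imm t c" using dom e by auto
  then obtain \<gamma> where \<gamma>: "\<gamma> \<in> germs" "\<gamma> 0 \<in> fst c" "\<kappa> 0 = jet \<A> imm t \<gamma>" by (rule vdomE)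
  define g where "g = (\<lambda>u. snd c (\<gamma> u))"
  have g: "smooth_near g 0" unfolding g_def by (rule germ_smooth[OF \<gamma>(1) c \<gamma>(2)])
  \<comment> \<open>Since \<open>k 0 = 0\<close>, the slice \<open>G (0, u)\<close> is the
    representative \<open>g\<close> itself; the other slices acquire the jet coordinates of
    \<open>\<kappa> h\<close>.\<close>
  define k where "k = (\<lambda>h. vchart t c (\<kappa> h) - vchart t c (\<kappa> 0))"
  define G where "G = (\<lambda>(h, u). perturb t g (k h) u)"
  have "smooth_near (\<lambda>h. vchart t c (\<kappa> h)) 0"
    by (rule smooth_on_near[of "{-e<..<e}"]) (use e sm in \<open>auto simp: o_def\<close>)
  then have k: "smooth_near (\<lambda>h. Poly_Mapping.lookup (k h) i) 0" for i
    unfolding k_def by (intro smooth_near_bounded_linear[OF bounded_linear_lookup] smooth_near_diff smooth_near_const)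
  have G: "smooth_near G (0, 0)"
  proof -
    have fst0: "smooth_near (fst :: real \<times> (real ^ 'n) \<Rightarrow> real) (0, 0)" and snd0: "smooth_near (snd :: real \<times> (real ^ 'n) \<Rightarrow> _) (0, 0)"
      by (rule smooth_near_linear[OF bounded_linear_fst], rule smooth_near_linear[OF bounded_linear_snd])
    have 1: "smooth_near (\<lambda>q :: real \<times> (real ^ 'n). g (snd q)) (0, 0)"
      by (rule smooth_near_compose[OF snd0]) (simp add: g)
    have 2: "smooth_near (\<lambda>q :: real \<times> (real ^ 'n). Poly_Mapping.lookup (k (fst q)) i) (0, 0)" for i
      by (rule smooth_near_compose[OF fst0, of "\<lambda>h. Poly_Mapping.lookup (k h) i"]) (simp add: k)
    have 3: "smooth_near (\<lambda>q :: real \<times> (real ^ 'n). monom_at 0 j (snd q)) (0, 0)" for j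
      by (rule smooth_near_compose[OF snd0 smooth_near_monom_at])
    have "smooth_near (\<lambda>q. g (snd q) + (\<chi> A. taylor_poly t (\<lambda>M. Poly_Mapping.lookup (k (fst q)) (A, M)) (snd q))) (0, 0)"
    proof (rule smooth_near_add[OF 1], rule smooth_near_vec, unfold vec_lambda_beta taylor_poly_def, rule smooth_near_sum)
      fix A :: 'N and M :: "'n multiset"
      have "smooth_near (\<lambda>q. Poly_Mapping.lookup (k (fst q)) (A, M) * (monom_at 0 (count M) (snd q) * (1 / list_weight M))) (0, 0)"
        by (rule smooth_near_mult[OF 2 smooth_near_mult[OF 3 smooth_near_const]])
      then show "smooth_near (\<lambda>q. Poly_Mapping.lookup (k (fst q)) (A, M) * (monom_at 0 (count M) (snd q) / list_weight M)) (0, 0)"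
        by simp
    qed
    then show ?thesis by (simp add: G_def perturb_def case_prod_unfold)
  qed
  have "taylor_poly m (\<lambda>M. 0) u = 0" for m and u :: "real ^ 'n"
    by (simp add: taylor_poly_def)
  then have G0: "(\<lambda>u. G (0, u)) = g"
    by (simp add: G_def k_def perturb_def fun_eq_iff vec_eq_iff)
  have fam: "family c G 0"
    unfolding family_def G0 using c G germ_immersive[OF \<gamma>(1) c \<gamma>(2)] fun_cong[OF G0, of 0] \<gamma>(2)
    by (auto simp: g_def)
  have "eventually (\<lambda>h. h \<in> {-e<..<e}) (nhds (0::real))"
    using e by (intro eventually_nhds_in_open) auto
  with eventually_family[OF fam]
  have eq: "eventually (\<lambda>h. jet \<A> imm t (fgerm c G h) = \<kappa> h) (nhds 0)"
  proof eventually_elim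
    case (elim h)
    have "vchart t c (jet \<A> imm t (fgerm c G h)) = vchart t c (\<kappa> h)"
    proof (rule poly_mapping_eqI, clarify)
      fix A and M :: "'n multiset"
      obtain J where J: "mset J = M" using ex_mset by blast
      show "Poly_Mapping.lookup (vchart t c (jet \<A> imm t (fgerm c G h))) (A, M) = Poly_Mapping.lookup (vchart t c (\<kappa> h)) (A, M)"
      proof (cases "size M \<le> t")
        case True
        then have len: "length J \<le> t" using J by auto
        have "Poly_Mapping.lookup (vchart t c (jet \<A> imm t (fgerm c G h))) (A, mset J) = iter_partial J (\<lambda>u. g u $ A) 0 + Poly_Mapping.lookup (k h) (A, mset J)"
          unfolding lookup_fjet[OF elim(1) len] using iter_partial_perturb[OF g len] by (simp add: G_def)
        also have "iter_partial J (\<lambda>u. g u $ A) 0 = Poly_Mapping.lookup (vchart t c (\<kappa> 0)) (A, mset J)"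
          unfolding \<gamma>(3) g_def by (rule lookup_vchart_jet[OF \<gamma>(1) c \<gamma>(2) len, symmetric])
        finally show ?thesis by (simp add: J k_def lookup_minus)
      qed (simp add: lookup_vchart)
    qed
    then show ?case
      using vchart_inj[OF c] fjet_vdom[OF elim(1)] dom elim(2) by (meson image_subset_iff inj_onD)
  qed
  show thesis
  proof (rule that[OF fam])
    show "jet \<A> imm t (fgerm c G 0) = p" using eventually_nhds_x_imp_x[OF eq] \<kappa>(2) by simp
    fix f assume "vsmooth_at \<A> imm t p f"
    then have "v f = vector_derivative (f \<circ> \<kappa>) (at 0)" by (simp add: v)
    also have "\<dots> = vector_derivative (\<lambda>h. f (jet \<A> imm t (fgerm c G h))) (at 0)"
      by (rule vector_derivative_cong_nhds) (use eq in \<open>eventually_elim, simp\<close>)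
    finally show "v f = dir_deriv 1 (\<lambda>h. f (jet \<A> imm t (fgerm c G h))) 0"
      by (simp add: vector_derivative_dir_deriv)
  qed
qed

lemma dir_deriv_vcoord_family:
  fixes G :: "real \<times> (real ^ 'n::finite) \<Rightarrow> real ^ 'N"
  assumes fam: "family c G 0" and J: "length J \<le> t"
  shows "dir_deriv 1 (\<lambda>h. vcoord c A J (jet \<A> imm t (fgerm c G h))) 0
    = iter_partial J (\<lambda>u. dir_deriv 1 (\<lambda>h. G (h, u) $ A) 0) 0"
proof -
  have c: "c \<in> \<A>" and G: "smooth_near G (0, 0)" using fam unfolding family_def by blast+
  have "eventually (\<lambda>h. vcoord c A J (jet \<A> imm t (fgerm c G h)) = iter_partial J (\<lambda>u. G (h, u) $ A) 0) (nhds 0)"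
    using eventually_family[OF fam]
  proof eventually_elim
    case (elim h)
    then show ?case
      using vcoord_jet[OF family_germ(1)[OF elim] c family_germ(2)[OF elim] J] iter_partial_fgerm[OF elim] by simp
  qed
  then have "dir_deriv 1 (\<lambda>h. vcoord c A J (jet \<A> imm t (fgerm c G h))) 0 = dir_deriv 1 (\<lambda>h. iter_partial J (\<lambda>u. G (h, u) $ A) 0) 0"
    by (rule dir_deriv_cong_nhds)
  also have "\<dots> = iter_partial J (\<lambda>u. dir_deriv 1 (\<lambda>h. G (h, u) $ A) 0) 0"
    by (rule dir_deriv_iter_partial_slice[OF smooth_near_nth[OF G]]) simp
  finally show ?thesis .
qed

text \<open>The Jacobian of the transition map along \<open>\<gamma>\<close>: the index
  \<open>C\<close> belongs to the new chart \<open>c'\<close>, the index \<open>A\<close> to the old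
  chart \<open>c\<close>.\<close>

definition transition_matrix :: "('a, 'N) chart \<Rightarrow> ('a, 'N) chart \<Rightarrow> (real ^ 'n \<Rightarrow> 'a) \<Rightarrow> 'N \<Rightarrow> 'N \<Rightarrow> real ^ 'n \<Rightarrow> real" where
  "transition_matrix c c' \<gamma> C A u = dir_deriv (axis A 1) (\<lambda>y. transition c c' y $ C) (snd c (\<gamma> u))"

lemma smooth_near_transition_component:
  assumes "c \<in> \<A>" "c' \<in> \<A>" "x \<in> fst c" "x \<in> fst c'"
  shows "smooth_near (\<lambda>y. transition c c' y $ C) (snd c x)"
    and "smooth_near (dir_deriv (axis A 1) (\<lambda>y. transition c c' y $ C)) (snd c x)"
  using smooth_near_transition[OF assms] by (auto intro: smooth_near_nth smooth_near_dir_deriv)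

lemma smooth_near_transition_matrix:
  assumes "\<gamma> \<in> germs" "c \<in> \<A>" "c' \<in> \<A>" "\<gamma> 0 \<in> fst c" "\<gamma> 0 \<in> fst c'"
  shows "smooth_near (transition_matrix c c' \<gamma> C A) 0"
  unfolding transition_matrix_def[abs_def]
  by (rule smooth_near_compose[OF germ_smooth[OF assms(1,2,4)] smooth_near_transition_component(2)[OF assms(2-5)]])

text \<open>A curve through \<open>j\<^sup>t\<gamma>\<close> lifts to a family of germs; \<open>\<xi>\<close> is its derivative in the parameter.
Only the \<open>t\<close>-jet of the base germ matters, which allows two tangent vectors to be represented over
the same \<open>\<gamma>\<close>.\<close>

lemma tangent_vector_field:
  fixes \<gamma> :: "real ^ 'n::finite \<Rightarrow> 'a"
  assumes \<gamma>: "\<gamma> \<in> germs" and c: "c \<in> \<A>" "\<gamma> 0 \<in> fst c" and c': "c' \<in> \<A>" "\<gamma> 0 \<in> fst c'"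
    and v: "v \<in> tangent_space \<A> imm t (jet \<A> imm t \<gamma>)"
  obtains \<xi> where "\<And>B. smooth_near (\<xi> B) 0"
    "\<And>B J. length J \<le> t \<Longrightarrow> v (vcoord c B J) = iter_partial J (\<xi> B) 0"
    "\<And>B J. length J \<le> t \<Longrightarrow> v (vcoord c' B J) = iter_partial J (\<lambda>u. \<Sum>E\<in>UNIV. transition_matrix c c' \<gamma> B E u * \<xi> E u) 0"
proof -
  obtain c0 and G0 :: "real \<times> (real ^ 'n) \<Rightarrow> real ^ 'N" where fam0: "family c0 G0 0" and jet0: "jet \<A> imm t (fgerm c0 G0 0) = jet \<A> imm t \<gamma>"
    and v0: "\<And>f. vsmooth_at \<A> imm t (jet \<A> imm t \<gamma>) f \<Longrightarrow> v f = dir_deriv 1 (\<lambda>h. f (jet \<A> imm t (fgerm c0 G0 h))) 0"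
    using tangent_familyE[OF v] by blast
  have same0: "fgerm c0 G0 0 0 = \<gamma> 0" by (rule jet_eqD(1)[OF jet0 \<gamma>])
  \<comment> \<open>The lifted family comes in a chart \<open>c0\<close> of its own; it is first
    moved to \<open>c\<close>, where \<open>\<xi>\<close> is defined, and then to
    \<open>c'\<close>.\<close>
  define G where "G = (\<lambda>q. transition c0 c (G0 q))"
  have fam: "family c G 0" and ev: "eventually (\<lambda>h. jet \<A> imm t (fgerm c G h) = jet \<A> imm t (fgerm c0 G0 h)) (nhds 0)"
    using family_change_chart(1)[OF fam0 c(1)] family_change_chart(2)[OF fam0 c(1), of t] c(2) same0
    by (auto simp: G_def elim: eventually_mono)
  have Gsm: "smooth_near G (0, 0)" using fam unfolding family_def by blast
  note germ = family_germ[OF fam]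
  have jet: "jet \<A> imm t (fgerm c G 0) = jet \<A> imm t \<gamma>" using eventually_nhds_x_imp_x[OF ev] jet0 by simp
  have same: "fgerm c G 0 0 = \<gamma> 0" by (rule jet_eqD(1)[OF jet \<gamma>])
  have agree: "agree t c (fgerm c G 0) \<gamma>" by (rule jet_eqD(2)[OF jet \<gamma> c(1) germ(2)])
  have G00: "G (0, 0) = snd c (\<gamma> 0)"
    using eventually_nhds_x_imp_x[OF germ(3)] same by simp
  define G' where "G' = (\<lambda>q. transition c c' (G q))"
  have fam': "family c' G' 0" and ev': "eventually (\<lambda>h. jet \<A> imm t (fgerm c' G' h) = jet \<A> imm t (fgerm c G h)) (nhds 0)"
    using family_change_chart(1)[OF fam c'(1)] family_change_chart(2)[OF fam c'(1), of t] c'(2) same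
    by (auto simp: G'_def elim: eventually_mono)
  define \<xi> where "\<xi> = (\<lambda>B u. dir_deriv 1 (\<lambda>h. G (h, u) $ B) 0)"
  have \<xi>: "smooth_near (\<xi> B) 0" for B
  proof -
    have "smooth_near (dir_deriv (1, 0) (\<lambda>q. G q $ B)) (0, 0)"
      by (rule smooth_near_dir_deriv[OF smooth_near_nth[OF Gsm]]) (simp add: Basis_prod_def)
    from smooth_near_slice_point(2)[OF this] show ?thesis
      by (simp add: \<xi>_def[abs_def] dir_deriv_slice1)
  qed
  have vd: "jet \<A> imm t \<gamma> \<in> vdom \<A> imm t c" "jet \<A> imm t \<gamma> \<in> vdom \<A> imm t c'"
    using jet_mem_vdom[OF \<gamma>] c c' by auto
  have 1: "v (vcoord c B J) = iter_partial J (\<xi> B) 0" if "length J \<le> t" for B J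
  proof -
    have "v (vcoord c B J) = dir_deriv 1 (\<lambda>h. vcoord c B J (jet \<A> imm t (fgerm c0 G0 h))) 0"
      by (rule v0[OF vsmooth_at_vcoord[OF c(1) vd(1) that]])
    also have "\<dots> = dir_deriv 1 (\<lambda>h. vcoord c B J (jet \<A> imm t (fgerm c G h))) 0"
      by (rule dir_deriv_cong_nhds) (use ev in \<open>eventually_elim, simp\<close>)
    also have "\<dots> = iter_partial J (\<xi> B) 0"
      unfolding \<xi>_def by (rule dir_deriv_vcoord_family[OF fam that])
    finally show ?thesis .
  qed
  have 2: "v (vcoord c' B J) = iter_partial J (\<lambda>u. \<Sum>E\<in>UNIV. transition_matrix c c' \<gamma> B E u * \<xi> E u) 0"
    if J: "length J \<le> t" for B J
  proof -
    note sm = smooth_near_transition_component[OF c(1) c'(1) c(2) c'(2)]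
    have "v (vcoord c' B J) = dir_deriv 1 (\<lambda>h. vcoord c' B J (jet \<A> imm t (fgerm c0 G0 h))) 0"
      by (rule v0[OF vsmooth_at_vcoord[OF c'(1) vd(2) J]])
    also have "\<dots> = dir_deriv 1 (\<lambda>h. vcoord c' B J (jet \<A> imm t (fgerm c' G' h))) 0"
      by (rule dir_deriv_cong_nhds) (use ev ev' in \<open>eventually_elim, simp\<close>)
    also have "\<dots> = iter_partial J (\<lambda>u. dir_deriv 1 (\<lambda>h. G' (h, u) $ B) 0) 0"
      by (rule dir_deriv_vcoord_family[OF fam' J])
    also have "\<dots> = iter_partial J (\<lambda>u. \<Sum>E\<in>UNIV. dir_deriv (axis E 1) (\<lambda>y. transition c c' y $ B) (G (0, u)) * \<xi> E u) 0"
    proof (rule iter_partial_cong_nhds)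
      show "\<forall>\<^sub>F u in nhds 0. dir_deriv 1 (\<lambda>h. G' (h, u) $ B) 0
          = (\<Sum>E\<in>UNIV. dir_deriv (axis E 1) (\<lambda>y. transition c c' y $ B) (G (0, u)) * \<xi> E u)"
        unfolding G'_def \<xi>_def by (rule dir_deriv_compose_slice[OF Gsm]) (simp add: G00 sm)
    qed
    also have "\<dots> = (\<Sum>E\<in>UNIV. iter_partial J (\<lambda>u. dir_deriv (axis E 1) (\<lambda>y. transition c c' y $ B) (G (0, u)) * \<xi> E u) 0)"
      by (rule iter_partial_sum[OF finite], rule smooth_near_mult[OF _ \<xi>],
          rule smooth_near_compose[OF smooth_near_slice_point(2)[OF Gsm]]) (simp add: G00 sm)
    also have "\<dots> = (\<Sum>E\<in>UNIV. iter_partial J (\<lambda>u. transition_matrix c c' \<gamma> B E u * \<xi> E u) 0)"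
    proof (rule sum.cong[OF refl])
      fix E
      let ?m = "dir_deriv (axis E 1) (\<lambda>y. transition c c' y $ B)"
      have m1: "smooth_near (\<lambda>u. ?m (G (0, u))) 0"
        by (rule smooth_near_compose[OF smooth_near_slice_point(2)[OF Gsm]]) (simp add: G00 sm)
      have m2: "smooth_near (transition_matrix c c' \<gamma> B E) 0"
        by (rule smooth_near_transition_matrix[OF \<gamma> c(1) c'(1) c(2) c'(2)])
      \<comment> \<open>The base germ of the family only shares its \<open>t\<close>-jet with
        \<open>\<gamma>\<close>. Derivatives of the Jacobian up to order \<open>t\<close> depend on
        this jet alone, and Leibniz asks for no higher ones.\<close>
      have "iter_partial I (\<lambda>u. ?m (G (0, u))) 0 = iter_partial I (transition_matrix c c' \<gamma> B E) 0"
        if "length I \<le> t" for I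
        unfolding transition_matrix_def[abs_def]
      proof (rule iter_partial_compose_cong[OF smooth_near_slice_point(2)[OF Gsm] germ_smooth[OF \<gamma> c] _ _ that])
        show "smooth_near ?m (G (0, 0))" by (simp add: G00 sm)
        show "iter_partial K (\<lambda>u. G (0, u) $ D) 0 = iter_partial K (\<lambda>u. snd c (\<gamma> u) $ D) 0" if "length K \<le> t" for K D
          using agree that iter_partial_fgerm[OF fam] by (simp add: agree_def)
      qed
      then show "iter_partial J (\<lambda>u. ?m (G (0, u)) * \<xi> E u) 0 = iter_partial J (\<lambda>u. transition_matrix c c' \<gamma> B E u * \<xi> E u) 0"
        unfolding iter_partial_mult[OF m1 \<xi>] iter_partial_mult[OF m2 \<xi>]
        using J splits_length[of _ J] by (intro arg_cong[of _ _ sum_list] map_cong refl) fastforce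
    qed
    also have "\<dots> = iter_partial J (\<lambda>u. \<Sum>E\<in>UNIV. transition_matrix c c' \<gamma> B E u * \<xi> E u) 0"
      by (rule iter_partial_sum[OF finite, symmetric],
          rule smooth_near_mult[OF smooth_near_transition_matrix[OF \<gamma> c(1) c'(1) c(2) c'(2)] \<xi>])
    finally show ?thesis .
  qed
  show thesis by (rule that[OF \<xi> 1 2])
qed

text \<open>Counterpart of \<open>tangent_familyE\<close>: families of germs yield tangent vectors,
  on which differential forms can be evaluated.\<close>

lemma family_smooth_curve:
  fixes G :: "real \<times> (real ^ 'n::finite) \<Rightarrow> real ^ 'N"
  assumes fam: "family c G 0"
  shows "smooth_curve \<A> imm t (\<lambda>h. jet \<A> imm t (fgerm c G h))"
proof -
  have c: "c \<in> \<A>" using fam unfolding family_def by blast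
  let ?q = "\<lambda>h. vchart t c (jet \<A> imm t (fgerm c G h))"
  have lk: "smooth_near (\<lambda>h. Poly_Mapping.lookup (?q h) (vkey b)) 0" if bV: "b \<in> vbasis t" for b
  proof -
    obtain A M where b: "b = Poly_Mapping.single (A, M) 1" "size M \<le> t"
      using bV unfolding vbasis_def by blast
    obtain J where J: "mset J = M" using ex_mset by blast
    have len: "length J \<le> t" using b J by auto
    have "smooth_near (\<lambda>h. vcoord c A J (jet \<A> imm t (fgerm c G h))) 0"
      by (rule smooth_near_family[OF fam]) (use vsmooth_vcoord[OF c len] in \<open>simp add: vsmooth_def\<close>)
    moreover have "eventually (\<lambda>h. vcoord c A J (jet \<A> imm t (fgerm c G h)) = Poly_Mapping.lookup (?q h) (vkey b)) (nhds 0)"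
      using eventually_family[OF fam]
      by eventually_elim (simp add: b(1) J[symmetric] lookup_vchart_vcoord[OF fjet_vdom c len])
    ultimately show ?thesis by (rule smooth_near_cong[rotated])
  qed
  have "smooth_near (\<lambda>h. \<Sum>b\<in>vbasis t. Poly_Mapping.lookup (?q h) (vkey b) *\<^sub>R b) 0"
    by (rule smooth_near_sum, rule smooth_near_scaleR[OF lk smooth_near_const])
  moreover have "(\<lambda>h. \<Sum>b\<in>vbasis t. Poly_Mapping.lookup (?q h) (vkey b) *\<^sub>R b) = ?q"
    by (rule ext, rule vcoords_expansion[symmetric]) (simp add: lookup_vchart)
  ultimately have "smooth_near ?q 0" by simp
  then obtain U where U: "open U" "0 \<in> U" "smooth_on Basis U ?q" unfolding smooth_near_def by blast
  obtain V where V: "open V" "0 \<in> V" "\<And>h. h \<in> V \<Longrightarrow> family c G h"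
    using eventually_family[OF fam] unfolding eventually_nhds by blast
  obtain e where e: "e > 0" "ball 0 e \<subseteq> U \<inter> V"
    using open_contains_ball_eq[OF open_Int[OF U(1) V(1)]] U(2) V(2) by blast
  have sub: "{-e<..<e} \<subseteq> U \<inter> V" using e(2) by (auto simp: ball_eq_greaterThanLessThan)
  show ?thesis
    unfolding smooth_curve_def o_def
    using c e(1) sub V(3) fjet_vdom smooth_on_subset[OF U(3)] by (intro bexI[of _ c] exI[of _ e]) blast+
qed

end

section \<open>Differential equations and their Helmholtz forms\<close>

context velocity_bundle
begin

lemma local_form_vsmooth:
  "has_local_form \<A> imm s \<T> c T \<Longrightarrow> c \<in> \<A> \<Longrightarrow> vsmooth s c (T A)"
  by (simp add: has_local_form_def vsmooth_def)

text \<open>Both local forms are evaluated on the tangent vector of the translation of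
  \<open>\<gamma>\<close> in coordinate direction \<open>A\<close>. Its zeroth order components form
  a Kronecker delta in \<open>c\<close> and column \<open>A\<close> of the Jacobian in
  \<open>c'\<close>.\<close>

lemma local_form_transformation:
  fixes \<gamma> :: "real ^ 'n::finite \<Rightarrow> 'a"
  assumes \<gamma>: "\<gamma> \<in> germs" and c: "c \<in> \<A>" "\<gamma> 0 \<in> fst c" and c': "c' \<in> \<A>" "\<gamma> 0 \<in> fst c'"
    and T: "has_local_form \<A> imm s \<T> c T" and T': "has_local_form \<A> imm s \<T> c' T'"
  shows "T A (jet \<A> imm s \<gamma>) = (\<Sum>C\<in>UNIV. T' C (jet \<A> imm s \<gamma>) * transition_matrix c c' \<gamma> C A 0)"
proof -
  let ?p = "jet \<A> imm s \<gamma>"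
  define G :: "real \<times> (real ^ 'n) \<Rightarrow> real ^ 'N" where "G = (\<lambda>(h, u). snd c (\<gamma> u) + h *\<^sub>R axis A 1)"
  have "smooth_near (\<lambda>q :: real \<times> (real ^ 'n). snd c (\<gamma> (snd q)) + fst q *\<^sub>R axis A 1) (0, 0)"
  proof (rule smooth_near_add)
    show "smooth_near (\<lambda>q :: real \<times> (real ^ 'n). snd c (\<gamma> (snd q))) (0, 0)"
      by (rule smooth_near_compose[OF smooth_near_linear[OF bounded_linear_snd], of "\<lambda>u. snd c (\<gamma> u)"])
        (simp add: germ_smooth[OF \<gamma> c])
    show "smooth_near (\<lambda>q :: real \<times> (real ^ 'n). fst q *\<^sub>R (axis A 1 :: real ^ 'N)) (0, 0)"
      by (rule smooth_near_scaleR[OF smooth_near_linear[OF bounded_linear_fst] smooth_near_const])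
  qed
  then have Gsm: "smooth_near G (0, 0)" by (simp add: G_def case_prod_unfold)
  have G0: "(\<lambda>u. G (0, u)) = (\<lambda>u. snd c (\<gamma> u))" by (simp add: G_def)
  have fam: "family c G 0"
    unfolding family_def G0 using Gsm c germ_immersive[OF \<gamma> c] fun_cong[OF G0, of 0] by auto
  note germ = family_germ[OF fam]
  have "agree s c (fgerm c G 0) \<gamma>"
    unfolding agree_def iter_partial_fgerm[OF fam] G0[THEN fun_cong] by simp
  then have jet: "jet \<A> imm s (fgerm c G 0) = ?p"
    by (rule jet_eqI[OF germ(1) \<gamma> c(1) germ(2) c(2)])
  have same: "fgerm c G 0 0 = \<gamma> 0" by (rule jet_eqD(1)[OF jet \<gamma>])
  define \<kappa> where "\<kappa> = (\<lambda>h. jet \<A> imm s (fgerm c G h))"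
  define v where "v = (\<lambda>f. if vsmooth_at \<A> imm s ?p f then vector_derivative (f \<circ> \<kappa>) (at 0) else 0)"
  have v: "v \<in> tangent_space \<A> imm s ?p"
    unfolding tangent_space_def v_def using family_smooth_curve[OF fam, of s] jet \<kappa>_def by blast
  have vd: "?p \<in> vdom \<A> imm s c" "?p \<in> vdom \<A> imm s c'"
    using jet_mem_vdom[OF \<gamma>] c c' by auto
  have vv: "v f = dir_deriv 1 (\<lambda>h. f (\<kappa> h)) 0" if "vsmooth_at \<A> imm s ?p f" for f
    using that by (simp add: v_def o_def vector_derivative_dir_deriv)
  have ev': "eventually (\<lambda>h. fgerm c G h 0 \<in> fst c') (nhds 0)"
    using family_change_chart(2)[OF fam c'(1), of s] c'(2) same by (auto elim: eventually_mono)
  have Gh: "G (h, 0) = snd c (\<gamma> 0) + h *\<^sub>R axis A 1" for h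
    by (simp add: G_def)
  have 1: "v (vcoord c B []) = (if B = A then 1 else 0)" for B
  proof -
    have "v (vcoord c B []) = dir_deriv 1 (\<lambda>h. vcoord c B [] (\<kappa> h)) 0"
      by (rule vv[OF vsmooth_at_vcoord[OF c(1) vd(1)]]) simp
    also have "\<dots> = iter_partial [] (\<lambda>u. dir_deriv 1 (\<lambda>h. G (h, u) $ B) 0) 0"
      unfolding \<kappa>_def by (rule dir_deriv_vcoord_family[OF fam]) simp
    also have "\<dots> = dir_deriv 1 (\<lambda>h. snd c (\<gamma> 0) $ B + h * axis A 1 $ B) (0::real)"
      by (simp add: Gh)
    also have "\<dots> = axis A 1 $ B"
      by (rule dir_deriv_eq) (auto intro!: derivative_eq_intros simp: has_vector_derivative_def)
    finally show ?thesis by (simp add: axis_def)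
  qed
  have 2: "v (vcoord c' C []) = transition_matrix c c' \<gamma> C A 0" for C
  proof -
    have "v (vcoord c' C []) = dir_deriv 1 (\<lambda>h. vcoord c' C [] (\<kappa> h)) 0"
      by (rule vv[OF vsmooth_at_vcoord[OF c'(1) vd(2)]]) simp
    also have "\<dots> = dir_deriv 1 (\<lambda>h. transition c c' (snd c (\<gamma> 0) + h *\<^sub>R axis A 1) $ C) (0::real)"
    proof (rule dir_deriv_cong_nhds)
      show "\<forall>\<^sub>F h in nhds 0. vcoord c' C [] (\<kappa> h) = transition c c' (snd c (\<gamma> 0) + h *\<^sub>R axis A 1) $ C"
        using eventually_family[OF fam] ev'
      proof eventually_elim
        case (elim h)
        have "vcoord c' C [] (\<kappa> h) = iter_partial [] (\<lambda>u. snd c' (fgerm c G h u) $ C) 0"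
          unfolding \<kappa>_def by (rule vcoord_jet[OF family_germ(1)[OF elim(1)] c'(1) elim(2)]) simp
        then show ?case by (simp add: fgerm_def transition_def Gh)
      qed
    qed
    also have "\<dots> = transition_matrix c c' \<gamma> C A 0"
      by (simp add: transition_matrix_def dir_deriv_def)
    finally show ?thesis .
  qed
  have "T A ?p = (\<Sum>B\<in>UNIV. T B ?p * differential (vcoord c B []) v)"
    by (simp add: differential_def 1 if_distrib[of "\<lambda>x. _ * x"] cong: if_cong)
  also have "\<dots> = \<T> ?p v" using T vd(1) v by (simp add: has_local_form_def)
  also have "\<dots> = (\<Sum>C\<in>UNIV. T' C ?p * differential (vcoord c' C []) v)"
    using T' vd(2) v by (simp add: has_local_form_def)
  finally show ?thesis by (simp add: differential_def 2)
qed

text \<open>Differentiating the transformation rule of the components \<open>T\<^sub>A\<close> along a variation of the germ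
  shows that the linearized operators are related by the transition matrix, up to a zeroth order
  term which is symmetric because it contains the second derivatives of the transition map.\<close>

lemma linearization_transformation:
  fixes \<gamma> :: "real ^ 'n::finite \<Rightarrow> 'a" and \<xi> :: "'N \<Rightarrow> real ^ 'n \<Rightarrow> real"
  assumes \<gamma>: "\<gamma> \<in> germs" and c: "c \<in> \<A>" "\<gamma> 0 \<in> fst c" and c': "c' \<in> \<A>" "\<gamma> 0 \<in> fst c'"
    and T: "has_local_form \<A> imm s \<T> c T" and T': "has_local_form \<A> imm s \<T> c' T'"
    and \<xi>: "\<And>B. smooth_near (\<xi> B) 0"
  shows "(\<Sum>B\<in>UNIV. \<Sum>J | length J \<le> s. vpartial \<A> imm s c B J (T A) (jet \<A> imm s \<gamma>) * iter_partial J (\<xi> B) 0)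
    = (\<Sum>C\<in>UNIV. transition_matrix c c' \<gamma> C A 0 *
        (\<Sum>E\<in>UNIV. \<Sum>J | length J \<le> s. vpartial \<A> imm s c' E J (T' C) (jet \<A> imm s \<gamma>) *
           iter_partial J (\<lambda>u. \<Sum>B\<in>UNIV. transition_matrix c c' \<gamma> E B u * \<xi> B u) 0))
      + (\<Sum>B\<in>UNIV. (\<Sum>C\<in>UNIV. T' C (jet \<A> imm s \<gamma>) *
          dir_deriv (axis B 1) (dir_deriv (axis A 1) (\<lambda>y. transition c c' y $ C)) (snd c (\<gamma> 0))) * \<xi> B 0)"
proof -
  let ?p = "jet \<A> imm s \<gamma>"
  \<comment> \<open>The variation is affine in \<open>h\<close> in the coordinates of
    \<open>c\<close>, so its parameter derivative is exactly \<open>\<xi>\<close>; in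
    \<open>c'\<close> it is \<open>\<xi>\<close> multiplied by the transition matrix.\<close>
  define G :: "real \<times> (real ^ 'n) \<Rightarrow> real ^ 'N" where "G = (\<lambda>(h, u). snd c (\<gamma> u) + h *\<^sub>R (\<chi> B. \<xi> B u))"
  have "smooth_near (\<lambda>q :: real \<times> (real ^ 'n). snd c (\<gamma> (snd q)) + fst q *\<^sub>R (\<chi> B. \<xi> B (snd q))) (0, 0)"
  proof (rule smooth_near_add)
    show "smooth_near (\<lambda>q :: real \<times> (real ^ 'n). snd c (\<gamma> (snd q))) (0, 0)"
      by (rule smooth_near_compose[OF smooth_near_linear[OF bounded_linear_snd], of "\<lambda>u. snd c (\<gamma> u)"])
        (simp add: germ_smooth[OF \<gamma> c])
    have "smooth_near (\<lambda>q :: real \<times> (real ^ 'n). \<chi> B. \<xi> B (snd q)) (0, 0)"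
    proof (rule smooth_near_vec, unfold vec_lambda_beta)
      show "smooth_near (\<lambda>q :: real \<times> (real ^ 'n). \<xi> B (snd q)) (0, 0)" for B
        by (rule smooth_near_compose[OF smooth_near_linear[OF bounded_linear_snd], of "\<xi> B"]) (simp add: \<xi>)
    qed
    then show "smooth_near (\<lambda>q :: real \<times> (real ^ 'n). fst q *\<^sub>R (\<chi> B. \<xi> B (snd q))) (0, 0)"
      by (rule smooth_near_scaleR[OF smooth_near_linear[OF bounded_linear_fst]])
  qed
  then have Gsm: "smooth_near G (0, 0)" by (simp add: G_def case_prod_unfold)
  have G0: "(\<lambda>u. G (0, u)) = (\<lambda>u. snd c (\<gamma> u))" by (simp add: G_def)
  have G00: "G (0, 0) = snd c (\<gamma> 0)" by (simp add: G_def)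
  have dG: "dir_deriv 1 (\<lambda>h. G (h, u) $ B) 0 = \<xi> B u" for u B
    unfolding G_def by (rule dir_deriv_eq) (auto intro!: derivative_eq_intros simp: has_vector_derivative_def)
  have fam: "family c G 0"
    unfolding family_def G0 using Gsm c germ_immersive[OF \<gamma> c] fun_cong[OF G0, of 0] by auto
  note germ = family_germ[OF fam]
  have "agree s c (fgerm c G 0) \<gamma>"
    unfolding agree_def iter_partial_fgerm[OF fam] G0[THEN fun_cong] by simp
  then have jet: "jet \<A> imm s (fgerm c G 0) = ?p"
    by (rule jet_eqI[OF germ(1) \<gamma> c(1) germ(2) c(2)])
  have same: "fgerm c G 0 0 = \<gamma> 0" by (rule jet_eqD(1)[OF jet \<gamma>])
  define G' where "G' = (\<lambda>q. transition c c' (G q))"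
  have fam': "family c' G' 0"
    and ev': "eventually (\<lambda>h. fgerm c G h 0 \<in> fst c' \<and> jet \<A> imm s (fgerm c' G' h) = jet \<A> imm s (fgerm c G h)) (nhds 0)"
    using family_change_chart(1)[OF fam c'(1)] family_change_chart(2)[OF fam c'(1), of s] c'(2) same
    by (auto simp: G'_def)
  have jet': "jet \<A> imm s (fgerm c' G' 0) = ?p"
    using eventually_nhds_x_imp_x[OF ev'] jet by simp
  note sm = smooth_near_transition_component[OF c(1) c'(1) c(2) c'(2)]
  have along: "dir_deriv 1 (\<lambda>h. f (jet \<A> imm s (fgerm d F h))) 0
    = (\<Sum>B\<in>UNIV. \<Sum>J | length J \<le> s. vpartial \<A> imm s d B J f (jet \<A> imm s (fgerm d F 0)) *
        iter_partial J (\<lambda>u. dir_deriv 1 (\<lambda>h. F (h, u) $ B) 0) 0)"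
    if F: "family d F 0" and f: "vsmooth s d f" for d f and F :: "real \<times> (real ^ 'n) \<Rightarrow> real ^ 'N"
  proof -
    have Fsm: "smooth_near F (0, 0)" using F unfolding family_def by blast
    have "dir_deriv 1 (\<lambda>h. iter_partial J (\<lambda>u. F (h, u) $ B) 0) 0 = iter_partial J (\<lambda>u. dir_deriv 1 (\<lambda>h. F (h, u) $ B) 0) 0" for B J
      by (rule dir_deriv_iter_partial_slice[OF smooth_near_nth[OF Fsm]]) simp
    moreover have "dir_deriv 1 (\<lambda>h. f (jet \<A> imm s (fgerm d F h))) 0
      = (\<Sum>B\<in>UNIV. \<Sum>J | length J \<le> s. vpartial \<A> imm s d B J f (jet \<A> imm s (fgerm d F 0)) *
        dir_deriv 1 (\<lambda>h. iter_partial J (\<lambda>u. F (h, u) $ B) 0) 0)"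
      by (rule dir_deriv_family[OF F]) (use f in \<open>simp_all add: vsmooth_def\<close>)
    ultimately show ?thesis by simp
  qed
  let ?m = "\<lambda>C. dir_deriv (axis A 1) (\<lambda>y. transition c c' y $ C)"
  let ?t = "\<lambda>C h. T' C (jet \<A> imm s (fgerm c' G' h))"
  have t: "smooth_near (?t C) 0" for C
    by (rule smooth_near_family[OF fam']) (use local_form_vsmooth[OF T' c'(1)] in \<open>simp add: vsmooth_def\<close>)
  have m: "smooth_near (\<lambda>h. ?m C (G (h, 0))) 0" for C
    by (rule smooth_near_compose[OF smooth_near_slice_point(1)[OF Gsm]]) (simp add: G00 sm)
  have dm: "dir_deriv 1 (\<lambda>h. ?m C (G (h, 0))) 0 = (\<Sum>B\<in>UNIV. dir_deriv (axis B 1) (?m C) (snd c (\<gamma> 0)) * \<xi> B 0)" for C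
    using eventually_nhds_x_imp_x[OF dir_deriv_compose_slice[OF Gsm, of "?m C"]] by (simp add: G00 sm dG)
  have dG': "iter_partial J (\<lambda>u. dir_deriv 1 (\<lambda>h. G' (h, u) $ E) 0) 0
    = iter_partial J (\<lambda>u. \<Sum>B\<in>UNIV. transition_matrix c c' \<gamma> E B u * \<xi> B u) 0" for E J
  proof (rule iter_partial_cong_nhds)
    have "\<forall>\<^sub>F u in nhds 0. dir_deriv 1 (\<lambda>h. G' (h, u) $ E) 0
      = (\<Sum>B\<in>UNIV. dir_deriv (axis B 1) (\<lambda>y. transition c c' y $ E) (G (0, u)) * dir_deriv 1 (\<lambda>h. G (h, u) $ B) 0)"
      unfolding G'_def by (rule dir_deriv_compose_slice[OF Gsm]) (simp add: G00 sm)
    then show "\<forall>\<^sub>F u in nhds 0. dir_deriv 1 (\<lambda>h. G' (h, u) $ E) 0 = (\<Sum>B\<in>UNIV. transition_matrix c c' \<gamma> E B u * \<xi> B u)"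
      by eventually_elim (simp add: dG transition_matrix_def fun_cong[OF G0])
  qed
  have "(\<Sum>B\<in>UNIV. \<Sum>J | length J \<le> s. vpartial \<A> imm s c B J (T A) ?p * iter_partial J (\<xi> B) 0)
    = dir_deriv 1 (\<lambda>h. T A (jet \<A> imm s (fgerm c G h))) 0"
    unfolding along[OF fam local_form_vsmooth[OF T c(1)]] jet dG ..
  also have "\<dots> = dir_deriv 1 (\<lambda>h. \<Sum>C\<in>UNIV. ?t C h * ?m C (G (h, 0))) 0"
  proof (rule dir_deriv_cong_nhds)
    show "\<forall>\<^sub>F h in nhds 0. T A (jet \<A> imm s (fgerm c G h)) = (\<Sum>C\<in>UNIV. ?t C h * ?m C (G (h, 0)))"
      using eventually_family[OF fam] ev'
    proof eventually_elim
      case (elim h)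
      note g = family_germ[OF elim(1)]
      have "snd c (fgerm c G h 0) = G (h, 0)" by (rule eventually_nhds_x_imp_x[OF g(3)])
      then show ?case
        using local_form_transformation[OF g(1) c(1) g(2) c'(1) _ T T', of A] elim(2)
        by (simp add: transition_matrix_def)
    qed
  qed
  \<comment> \<open>Differentiating \<open>T'\<close> gives the linearization in \<open>c'\<close>;
    differentiating the transition matrix gives its second derivatives, the zeroth order
    term.\<close>
  also have "\<dots> = (\<Sum>C\<in>UNIV. dir_deriv 1 (?t C) 0 * ?m C (snd c (\<gamma> 0)) + T' C ?p * dir_deriv 1 (\<lambda>h. ?m C (G (h, 0))) 0)"
    by (subst dir_deriv_sum) (simp_all add: smooth_near_mult[OF t m] dir_deriv_mult[OF t m] G00 jet')
  also have "\<dots> = (\<Sum>C\<in>UNIV. transition_matrix c c' \<gamma> C A 0 * dir_deriv 1 (?t C) 0)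
      + (\<Sum>C\<in>UNIV. \<Sum>B\<in>UNIV. T' C ?p * dir_deriv (axis B 1) (?m C) (snd c (\<gamma> 0)) * \<xi> B 0)"
    unfolding dm by (simp add: sum.distrib transition_matrix_def sum_distrib_left mult_ac)
  also have "(\<Sum>C\<in>UNIV. \<Sum>B\<in>UNIV. T' C ?p * dir_deriv (axis B 1) (?m C) (snd c (\<gamma> 0)) * \<xi> B 0)
    = (\<Sum>B\<in>UNIV. (\<Sum>C\<in>UNIV. T' C ?p * dir_deriv (axis B 1) (?m C) (snd c (\<gamma> 0))) * \<xi> B 0)"
    by (subst sum.swap) (simp add: sum_distrib_right)
  finally show ?thesis
    unfolding along[OF fam' local_form_vsmooth[OF T' c'(1)]] jet' dG' .
qed

text \<open>The coefficients of the linearization along the germ. The default 0 beyond order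
  \<open>s\<close> gives smoothness for every \<open>J\<close>, including those longer than
  \<open>t\<close>, as the operator lemmas require.\<close>

definition lin_coeff ::
  "('a, 'N) chart \<Rightarrow> nat \<Rightarrow> nat \<Rightarrow> ('N \<Rightarrow> ('a, 'n::finite) velocity \<Rightarrow> real) \<Rightarrow> (real ^ 'n \<Rightarrow> 'a)
     \<Rightarrow> 'N \<Rightarrow> 'N \<Rightarrow> 'n list \<Rightarrow> real ^ 'n \<Rightarrow> real" where
  "lin_coeff c s t T \<gamma> A B J u = (if length J \<le> s
     then vpartial \<A> imm t c B J (T A \<circ> velocity_proj \<A> imm s) (jet \<A> imm t (shift \<gamma> u)) else 0)"

lemma lin_coeff_mset: "mset J = mset J' \<Longrightarrow> lin_coeff c s t T \<gamma> A B J = lin_coeff c s t T \<gamma> A B J'"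
  by (simp add: lin_coeff_def fun_eq_iff vpartial_mset[of J J'] mset_eq_length[of J J'])

lemma smooth_near_lin_coeff:
  assumes "\<gamma> \<in> germs" "\<gamma> 0 \<in> fst c" "c \<in> \<A>" "s \<le> t" "has_local_form \<A> imm s \<T> c T"
  shows "smooth_near (lin_coeff c s t T \<gamma> A B J) 0"
proof (cases "length J \<le> s")
  case True
  have "vsmooth t c (vpartial \<A> imm t c B J (T A \<circ> velocity_proj \<A> imm s))"
    using True assms(4) by (intro vsmooth_vpartial vsmooth_proj local_form_vsmooth[OF assms(5,3)]) auto
  from smooth_near_along_germ[OF assms(1,2) this] show ?thesis
    using True by (simp add: lin_coeff_def[abs_def])
qed (simp add: lin_coeff_def[abs_def] smooth_near_const)

text \<open>Along \<open>\<gamma>\<close> the formal derivatives in \<open>lie_euler\<close> are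
  partial derivatives of \<open>lin_coeff\<close>, which identifies the Lie-Euler sum with the
  coefficients in \<open>adj_op_expansion\<close>.\<close>

lemma helmholtz_contraction:
  fixes \<gamma> :: "real ^ 'n::finite \<Rightarrow> 'a"
  assumes \<gamma>: "\<gamma> \<in> germs" "\<gamma> 0 \<in> fst c" and c: "c \<in> \<A>" and st: "2 * s < t"
    and T: "has_local_form \<A> imm s \<T> c T" and \<xi>: "\<And>B. smooth_near (\<xi> B) 0"
  shows "(\<Sum>B\<in>UNIV. \<Sum>J | length J \<le> s. helmholtz \<A> imm t c s T J A B (jet \<A> imm t \<gamma>) * iter_partial J (\<xi> B) 0)
    = lin_op s (lin_coeff c s t T \<gamma>) \<xi> A 0 - adj_op s (lin_coeff c s t T \<gamma>) \<xi> A 0"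
proof -
  have st': "s \<le> t" using st by simp
  have lie: "lie_euler \<A> imm t c s J A (T B \<circ> velocity_proj \<A> imm s) (jet \<A> imm t \<gamma>)
    = (\<Sum>I | length I \<le> s - length J. (-1) ^ length I * real ((length J + length I) choose length J) *
       iter_partial I (lin_coeff c s t T \<gamma> B A (J @ I)) 0)" if J: "length J \<le> s" for J B
    unfolding lie_euler_def
  proof (rule sum.cong[OF refl])
    fix I :: "'n list" assume "I \<in> {I. length I \<le> s - length J}"
    then have I: "length (J @ I) \<le> s" using J by auto
    let ?f = "T B \<circ> velocity_proj \<A> imm s" and ?g = "vpartial \<A> imm t c A (J @ I) (T B \<circ> velocity_proj \<A> imm s)"
    have "vsmooth t c ?f" by (intro vsmooth_proj local_form_vsmooth[OF T c] st')
    then have "vsmooth t c ?g" by (rule vsmooth_vpartial) (use I st in auto)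
    moreover have "order_le t c s ?g"
      by (rule order_le_vpartial[OF c order_le_proj[OF c st']]) (use I st in auto)
    \<comment> \<open>Here \<open>2 * s < t\<close> enters: a function of order \<open>s\<close> is
      differentiated formally at most \<open>s\<close> times.\<close>
    moreover have "s + length I \<le> t" using I st by auto
    ultimately have "formal_derivs \<A> imm t c I ?g (jet \<A> imm t \<gamma>) = iter_partial I (\<lambda>v. ?g (jet \<A> imm t (shift \<gamma> v))) 0"
      using formal_derivs_along_germ \<gamma> by blast
    then show "(-1) ^ length I * real ((length J + length I) choose length J) * formal_derivs \<A> imm t c I ?g (jet \<A> imm t \<gamma>)
      = (-1) ^ length I * real ((length J + length I) choose length J) * iter_partial I (lin_coeff c s t T \<gamma> B A (J @ I)) 0"
      using I by (simp add: lin_coeff_def[abs_def])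
  qed
  have "adj_op s (lin_coeff c s t T \<gamma>) \<xi> A 0 = (\<Sum>B\<in>UNIV. \<Sum>J | length J \<le> s. (-1) ^ length J *
      lie_euler \<A> imm t c s J A (T B \<circ> velocity_proj \<A> imm s) (jet \<A> imm t \<gamma>) * iter_partial J (\<xi> B) 0)"
    by (subst adj_op_expansion[OF lin_coeff_mset smooth_near_lin_coeff[OF \<gamma> c st' T] \<xi>]) (simp_all add: lie)
  then show ?thesis
    unfolding lin_op_def helmholtz_def
    by (simp add: lin_coeff_def left_diff_distrib sum_subtractf)
qed

text \<open>The hypothesis of \<open>helmholtz_operator_transformation\<close> at a point
  \<open>u\<close> near 0 is \<open>linearization_transformation\<close> for the germ
  \<open>shift \<gamma> u\<close>.\<close>

lemma helmholtz_chart_change: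
  fixes \<gamma> :: "real ^ 'n::finite \<Rightarrow> 'a"
  assumes \<gamma>: "\<gamma> \<in> germs" and c: "c \<in> \<A>" "\<gamma> 0 \<in> fst c" and c': "c' \<in> \<A>" "\<gamma> 0 \<in> fst c'"
    and T: "has_local_form \<A> imm s \<T> c T" and T': "has_local_form \<A> imm s \<T> c' T'"
    and \<xi>: "\<And>B. smooth_near (\<xi> B) 0" and st: "s \<le> t"
  defines "M \<equiv> transition_matrix c c' \<gamma>"
  shows "lin_op s (lin_coeff c s t T \<gamma>) \<xi> A 0 - adj_op s (lin_coeff c s t T \<gamma>) \<xi> A 0
    = (\<Sum>C\<in>UNIV. M C A 0 * (lin_op s (lin_coeff c' s t T' \<gamma>) (\<lambda>E v. \<Sum>B\<in>UNIV. M E B v * \<xi> B v) C 0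
        - adj_op s (lin_coeff c' s t T' \<gamma>) (\<lambda>E v. \<Sum>B\<in>UNIV. M E B v * \<xi> B v) C 0))"
proof (rule helmholtz_operator_transformation[OF lin_coeff_mset lin_coeff_mset])
  define D2 where "D2 = (\<lambda>B A C. dir_deriv (axis B 1) (dir_deriv (axis A 1) (\<lambda>y. transition c c' y $ C)))"
  \<comment> \<open>The zeroth order term along the germ. It is symmetric because \<open>D2\<close>
    is built from second derivatives of the transition map, which commute.\<close>
  define S where "S = (\<lambda>A B u. \<Sum>C\<in>UNIV. T' C (jet \<A> imm s (shift \<gamma> u)) * D2 B A C (snd c (\<gamma> u)))"
  have D2: "smooth_near (D2 B A C) (snd c (\<gamma> 0))" for A B C
    unfolding D2_def by (rule smooth_near_dir_deriv[OF smooth_near_transition_component(2)[OF c(1) c'(1) c(2) c'(2)]]) simp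
  show "smooth_near (lin_coeff c' s t T' \<gamma> A B J) 0" for A B J
    by (rule smooth_near_lin_coeff[OF \<gamma> c'(2,1) st T'])
  show "smooth_near (M A B) 0" for A B
    unfolding M_def by (rule smooth_near_transition_matrix[OF \<gamma> c(1) c'(1) c(2) c'(2)])
  show "smooth_near (S A B) 0" for A B
    unfolding S_def
    by (intro smooth_near_sum smooth_near_mult smooth_near_along_germ[OF \<gamma> c'(2) local_form_vsmooth[OF T' c'(1)]]
        smooth_near_compose[OF germ_smooth[OF \<gamma> c] D2])
  show "S A B 0 = S B A 0" for A B
    unfolding S_def D2_def
    by (intro sum.cong refl arg_cong2[of _ _ _ _ "(*)"] dir_deriv_commute
        smooth_near_transition_component(1)[OF c(1) c'(1) c(2) c'(2)]) auto
  show "smooth_near (\<xi> B) 0" for B by (rule \<xi>)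
  show "\<forall>\<^sub>F u in nhds 0. \<forall>A \<xi>. (\<forall>B. smooth_near (\<xi> B) u) \<longrightarrow> lin_op s (lin_coeff c s t T \<gamma>) \<xi> A u
      = (\<Sum>C\<in>UNIV. M C A u * lin_op s (lin_coeff c' s t T' \<gamma>) (\<lambda>E v. \<Sum>B\<in>UNIV. M E B v * \<xi> B v) C u)
        + (\<Sum>B\<in>UNIV. S A B u * \<xi> B u)"
    using shift_family(2)[OF \<gamma> c(2,1)] shift_family(2)[OF \<gamma> c'(2,1)]
  proof eventually_elim
    case (elim u)
    let ?g = "shift \<gamma> u"
    have g: "?g \<in> germs" "?g 0 \<in> fst c" "?g 0 \<in> fst c'" using elim by auto
    have g0: "?g 0 = \<gamma> u" by (simp add: shift_def)
    have coeff: "lin_coeff d s t U \<gamma> A B J u = vpartial \<A> imm s d B J (U A) (jet \<A> imm s ?g)"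
      if "d \<in> \<A>" "?g 0 \<in> fst d" "length J \<le> s" for d U A B J
    proof -
      have "jet \<A> imm t ?g \<in> vdom \<A> imm t d" using jet_mem_vdom[OF g(1)] that(2) by simp
      then show ?thesis
        using that(3) vpartial_proj[OF that(1) _ st that(3)] by (simp add: lin_coeff_def velocity_proj_jet[OF g(1) st])
    qed
    show ?case
    proof (intro allI impI)
      fix A and \<eta> :: "'N \<Rightarrow> real ^ 'n \<Rightarrow> real" assume \<eta>: "\<forall>B. smooth_near (\<eta> B) u"
      have "smooth_near (\<lambda>v. \<eta> B (v + u)) 0" for B
        by (rule smooth_near_compose[of "\<lambda>v. v + u" _ "\<eta> B"])
          (use \<eta> in \<open>simp_all add: smooth_near_add smooth_near_linear[OF bounded_linear_ident] smooth_near_const\<close>)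
      note lin = linearization_transformation[OF g(1) c(1) g(2) c'(1) g(3) T T', of "\<lambda>B v. \<eta> B (v + u)", OF this, of A]
      \<comment> \<open>Quantities of the translated germ near 0 are those of
        \<open>\<gamma>\<close> near \<open>u\<close>; the test fields are translated
        accordingly.\<close>
      have M: "transition_matrix c c' ?g E B v = M E B (v + u)" for E B v
        by (simp add: M_def transition_matrix_def shift_def)
      have sh: "iter_partial J (\<lambda>v. f (v + u)) 0 = iter_partial J f u" for J and f :: "real ^ 'n \<Rightarrow> real"
        using iter_partial_shift[of J f u 0] by simp
      have "iter_partial J (\<lambda>v. \<Sum>B\<in>UNIV. M E B (v + u) * \<eta> B (v + u)) 0 = iter_partial J (\<lambda>v. \<Sum>B\<in>UNIV. M E B v * \<eta> B v) u" for E J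
        by (rule sh)
      then show "lin_op s (lin_coeff c s t T \<gamma>) \<eta> A u
        = (\<Sum>C\<in>UNIV. M C A u * lin_op s (lin_coeff c' s t T' \<gamma>) (\<lambda>E v. \<Sum>B\<in>UNIV. M E B v * \<eta> B v) C u)
          + (\<Sum>B\<in>UNIV. S A B u * \<eta> B u)"
        using lin unfolding M sh g0 by (simp add: lin_op_def coeff c c' g[unfolded g0] g0 S_def D2_def)
    qed
  qed
qed

section \<open>The Helmholtz form and its independence of the chart\<close>

definition helmholtz_form ::
  "('a, 'N) chart \<Rightarrow> nat \<Rightarrow> nat \<Rightarrow> ('N \<Rightarrow> ('a, 'n::finite) velocity \<Rightarrow> real)
     \<Rightarrow> ('a, 'n) velocity \<Rightarrow> ('a, 'n) tangent \<Rightarrow> ('a, 'n) tangent \<Rightarrow> real" where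
  "helmholtz_form c s t T p v w = (\<Sum>A\<in>UNIV. \<Sum>B\<in>UNIV. \<Sum>J | length J \<le> s.
      helmholtz \<A> imm t c s T J A B p *
      wedge (differential (vcoord c B J)) (differential (vcoord c A [])) v w)"

text \<open>The wedge product splits the sum into two contractions, each of which is
  \<open>helmholtz_contraction\<close> for one field, paired with the value at 0 of the
  other.\<close>

lemma helmholtz_form_vector_fields:
  fixes \<gamma> :: "real ^ 'n::finite \<Rightarrow> 'a"
  assumes \<gamma>: "\<gamma> \<in> germs" "\<gamma> 0 \<in> fst c" and c: "c \<in> \<A>" and st: "2 * s < t"
    and T: "has_local_form \<A> imm s \<T> c T"
    and \<xi>: "\<And>B. smooth_near (\<xi> B) 0" "\<And>B J. length J \<le> t \<Longrightarrow> v (vcoord c B J) = iter_partial J (\<xi> B) 0"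
    and \<eta>: "\<And>B. smooth_near (\<eta> B) 0" "\<And>B J. length J \<le> t \<Longrightarrow> w (vcoord c B J) = iter_partial J (\<eta> B) 0"
  defines "K \<equiv> \<lambda>\<zeta> A. lin_op s (lin_coeff c s t T \<gamma>) \<zeta> A 0 - adj_op s (lin_coeff c s t T \<gamma>) \<zeta> A 0"
  shows "helmholtz_form c s t T (jet \<A> imm t \<gamma>) v w = (\<Sum>A\<in>UNIV. K \<xi> A * \<eta> A 0 - K \<eta> A * \<xi> A 0)"
  unfolding helmholtz_form_def
proof (rule sum.cong[OF refl])
  fix A
  let ?h = "\<lambda>B J. helmholtz \<A> imm t c s T J A B (jet \<A> imm t \<gamma>)"
  have "wedge (differential (vcoord c B J)) (differential (vcoord c A [])) v w
    = iter_partial J (\<xi> B) 0 * \<eta> A 0 - iter_partial J (\<eta> B) 0 * \<xi> A 0" if "length J \<le> s" for B J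
    using that st by (simp add: wedge_def differential_def \<xi>(2) \<eta>(2))
  then have "(\<Sum>B\<in>UNIV. \<Sum>J | length J \<le> s. ?h B J * wedge (differential (vcoord c B J)) (differential (vcoord c A [])) v w)
    = (\<Sum>B\<in>UNIV. \<Sum>J | length J \<le> s. ?h B J * iter_partial J (\<xi> B) 0) * \<eta> A 0
      - (\<Sum>B\<in>UNIV. \<Sum>J | length J \<le> s. ?h B J * iter_partial J (\<eta> B) 0) * \<xi> A 0"
    by (simp add: sum_distrib_left right_diff_distrib sum_subtractf mult_ac)
  then show "(\<Sum>B\<in>UNIV. \<Sum>J | length J \<le> s. ?h B J * wedge (differential (vcoord c B J)) (differential (vcoord c A [])) v w)
    = K \<xi> A * \<eta> A 0 - K \<eta> A * \<xi> A 0"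
    unfolding K_def helmholtz_contraction[OF \<gamma> c st T \<xi>(1)] helmholtz_contraction[OF \<gamma> c st T \<eta>(1)] .
qed

text \<open>Both tangent vectors are represented by fields over the same germ. In the new chart the
  fields are multiplied by the transition matrix, while the operator acquires its transpose in the
  old one, so the pairings coincide.\<close>

lemma helmholtz_form_chart_independent:
  fixes p :: "('a, 'n::finite) velocity"
  assumes p: "p \<in> vdom \<A> imm t c" "p \<in> vdom \<A> imm t c'" and c: "c \<in> \<A>" and c': "c' \<in> \<A>" and st: "2 * s < t"
    and T: "has_local_form \<A> imm s \<T> c T" and T': "has_local_form \<A> imm s \<T> c' T'"
    and vw: "v \<in> tangent_space \<A> imm t p" "w \<in> tangent_space \<A> imm t p"
  shows "helmholtz_form c s t T p v w = helmholtz_form c' s t T' p v w"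
proof -
  obtain \<gamma> where \<gamma>: "\<gamma> \<in> germs" "\<gamma> 0 \<in> fst c" and pg: "p = jet \<A> imm t \<gamma>" using p(1) by (rule vdomE)
  have \<gamma>': "\<gamma> 0 \<in> fst c'" using p(2) jet_mem_vdom[OF \<gamma>(1)] by (simp add: pg)
  let ?M = "transition_matrix c c' \<gamma>"
  let ?t = "\<lambda>\<zeta> E v. \<Sum>B\<in>UNIV. ?M E B v * \<zeta> B v"
  obtain \<xi> where \<xi>: "\<And>B. smooth_near (\<xi> B) 0" "\<And>B J. length J \<le> t \<Longrightarrow> v (vcoord c B J) = iter_partial J (\<xi> B) 0"
    "\<And>B J. length J \<le> t \<Longrightarrow> v (vcoord c' B J) = iter_partial J (?t \<xi> B) 0"
    using tangent_vector_field[OF \<gamma>(1) c \<gamma>(2) c' \<gamma>' vw(1)[unfolded pg]] by blast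
  obtain \<eta> where \<eta>: "\<And>B. smooth_near (\<eta> B) 0" "\<And>B J. length J \<le> t \<Longrightarrow> w (vcoord c B J) = iter_partial J (\<eta> B) 0"
    "\<And>B J. length J \<le> t \<Longrightarrow> w (vcoord c' B J) = iter_partial J (?t \<eta> B) 0"
    using tangent_vector_field[OF \<gamma>(1) c \<gamma>(2) c' \<gamma>' vw(2)[unfolded pg]] by blast
  have sm: "smooth_near (?t \<zeta> E) 0" if "\<And>B. smooth_near (\<zeta> B) 0" for \<zeta> E
    by (rule smooth_near_sum, rule smooth_near_mult[OF smooth_near_transition_matrix[OF \<gamma>(1) c c' \<gamma>(2) \<gamma>'] that])
  define K where "K = (\<lambda>d U \<zeta> A. lin_op s (lin_coeff d s t U \<gamma>) \<zeta> A 0 - adj_op s (lin_coeff d s t U \<gamma>) \<zeta> A (0 :: real ^ 'n))"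
  have K: "K c T \<zeta> A = (\<Sum>C\<in>UNIV. ?M C A 0 * K c' T' (?t \<zeta>) C)" if "\<And>B. smooth_near (\<zeta> B) 0" for \<zeta> A
    unfolding K_def by (rule helmholtz_chart_change[OF \<gamma>(1) c \<gamma>(2) c' \<gamma>' T T' that]) (use st in auto)
  \<comment> \<open>The transposed matrix in front of the operator is moved to the other argument of
    the pairing.\<close>
  have pair: "(\<Sum>A\<in>UNIV. K c T \<zeta> A * \<theta> A 0) = (\<Sum>C\<in>UNIV. K c' T' (?t \<zeta>) C * ?t \<theta> C 0)"
    if "\<And>B. smooth_near (\<zeta> B) 0" for \<zeta> \<theta>
  proof -
    have "(\<Sum>A\<in>UNIV. K c T \<zeta> A * \<theta> A 0) = (\<Sum>A\<in>UNIV. \<Sum>C\<in>UNIV. K c' T' (?t \<zeta>) C * (?M C A 0 * \<theta> A 0))"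
      unfolding K[OF that] by (simp add: sum_distrib_left sum_distrib_right mult_ac)
    also have "\<dots> = (\<Sum>C\<in>UNIV. K c' T' (?t \<zeta>) C * ?t \<theta> C 0)"
      by (subst sum.swap) (simp add: sum_distrib_left)
    finally show ?thesis .
  qed
  have "helmholtz_form c s t T p v w = (\<Sum>A\<in>UNIV. K c T \<xi> A * \<eta> A 0 - K c T \<eta> A * \<xi> A 0)"
    unfolding pg K_def by (rule helmholtz_form_vector_fields[OF \<gamma> c st T \<xi>(1,2) \<eta>(1,2)])
  also have "\<dots> = (\<Sum>A\<in>UNIV. K c T \<xi> A * \<eta> A 0) - (\<Sum>A\<in>UNIV. K c T \<eta> A * \<xi> A 0)"
    by (rule sum_subtractf)
  also have "\<dots> = (\<Sum>C\<in>UNIV. K c' T' (?t \<xi>) C * ?t \<eta> C 0) - (\<Sum>C\<in>UNIV. K c' T' (?t \<eta>) C * ?t \<xi> C 0)"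
    by (rule arg_cong2[where f="(-)"]) (rule pair, rule \<xi>(1), rule pair, rule \<eta>(1))
  also have "\<dots> = (\<Sum>C\<in>UNIV. K c' T' (?t \<xi>) C * ?t \<eta> C 0 - K c' T' (?t \<eta>) C * ?t \<xi> C 0)"
    by (rule sum_subtractf[symmetric])
  also have "\<dots> = helmholtz_form c' s t T' p v w"
    unfolding pg K_def
    by (rule helmholtz_form_vector_fields[OF \<gamma>(1) \<gamma>' c' st T' sm[OF \<xi>(1)] \<xi>(3) sm[OF \<eta>(1)] \<eta>(3), symmetric])
  finally show ?thesis .
qed

lemma vsmooth_helmholtz:
  assumes c: "c \<in> \<A>" and st: "2 * s < t" and T: "has_local_form \<A> imm s \<T> c T" and J: "length J \<le> s"
  shows "vsmooth t c (helmholtz \<A> imm t c s T J A B)"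
proof -
  have st': "s \<le> t" using st by simp
  have f: "vsmooth t c (T B \<circ> velocity_proj \<A> imm s)" for B
    by (intro vsmooth_proj local_form_vsmooth[OF T c] st')
  have d: "vsmooth t c (formal_derivs \<A> imm t c I (vpartial \<A> imm t c A (J @ I) (T B \<circ> velocity_proj \<A> imm s)))"
    if "length I \<le> s - length J" for I
  proof -
    have len: "length (J @ I) \<le> t" "s + length I \<le> t" using that J st by auto
    show ?thesis
      using formal_derivs_along_germ[OF vsmooth_vpartial[OF f len(1)] order_le_vpartial[OF c order_le_proj[OF c st'] len(1)] len(2)]
      by blast
  qed
  have "vsmooth t c (\<lambda>p. vpartial \<A> imm t c B J (T A \<circ> velocity_proj \<A> imm s) p - (-1) ^ length J *
      (\<Sum>I | length I \<le> s - length J. (-1) ^ length I * real ((length J + length I) choose length J) *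
        formal_derivs \<A> imm t c I (vpartial \<A> imm t c A (J @ I) (T B \<circ> velocity_proj \<A> imm s)) p))"
    by (intro vsmooth_diff vsmooth_mult vsmooth_const vsmooth_sum c vsmooth_vpartial f d) (use J st' in auto)
  then show ?thesis
    unfolding helmholtz_def[abs_def] lie_euler_def .
qed

lemma linear_on_tangent_helmholtz_form:
  "linear_on_tangent V (\<lambda>w. helmholtz_form c s t T p v w)"
  "linear_on_tangent V (\<lambda>w. helmholtz_form c s t T p w v)"
  unfolding linear_on_tangent_def helmholtz_form_def wedge_def differential_def sum_distrib_left sum.distrib[symmetric]
  by (intro ballI allI sum.cong refl, simp add: algebra_simps)+

lemma helmholtz_form_diagonal: "helmholtz_form c s t T p v v = 0"
  by (simp add: helmholtz_form_def wedge_def)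

text \<open>\<open>two_form\<close> asks for components over all pairs of coordinates. Only pairs
  with an undifferentiated second coordinate occur, and since \<open>A\<close> now names the
  differentiated coordinate, the indices of \<open>helmholtz\<close> are exchanged.\<close>

lemma helmholtz_form_components:
  assumes "s \<le> t"
  shows "helmholtz_form c s t T p v w = (\<Sum>A\<in>UNIV. \<Sum>I | length I \<le> t. \<Sum>B\<in>UNIV. \<Sum>J | length J \<le> t.
     (if J = [] \<and> length I \<le> s then helmholtz \<A> imm t c s T I B A p else 0) *
     wedge (differential (vcoord c A I)) (differential (vcoord c B J)) v w)"
proof -
  have "(\<Sum>J | length J \<le> t. (if J = [] \<and> length I \<le> s then helmholtz \<A> imm t c s T I B A p else 0) *
       wedge (differential (vcoord c A I)) (differential (vcoord c B J)) v w)
    = (if length I \<le> s then helmholtz \<A> imm t c s T I B A p *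
        wedge (differential (vcoord c A I)) (differential (vcoord c B [])) v w else 0)" for A B I
    by (subst sum.remove[of _ "[]"]) auto
  then have "(\<Sum>A\<in>UNIV. \<Sum>I | length I \<le> t. \<Sum>B\<in>UNIV. \<Sum>J | length J \<le> t.
     (if J = [] \<and> length I \<le> s then helmholtz \<A> imm t c s T I B A p else 0) *
     wedge (differential (vcoord c A I)) (differential (vcoord c B J)) v w)
    = (\<Sum>A\<in>UNIV. \<Sum>I | length I \<le> t. \<Sum>B\<in>UNIV. if length I \<le> s then helmholtz \<A> imm t c s T I B A p *
        wedge (differential (vcoord c A I)) (differential (vcoord c B [])) v w else 0)"
    by simp
  also have "\<dots> = (\<Sum>A\<in>UNIV. \<Sum>I | length I \<le> s. \<Sum>B\<in>UNIV. helmholtz \<A> imm t c s T I B A p *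
        wedge (differential (vcoord c A I)) (differential (vcoord c B [])) v w)"
    using assms by (intro sum.cong[OF refl] sum.mono_neutral_cong_right) auto
  also have "\<dots> = (\<Sum>A\<in>UNIV. \<Sum>B\<in>UNIV. \<Sum>I | length I \<le> s. helmholtz \<A> imm t c s T I B A p *
        wedge (differential (vcoord c A I)) (differential (vcoord c B [])) v w)"
    by (intro sum.cong[OF refl] sum.swap)
  also have "\<dots> = helmholtz_form c s t T p v w"
    unfolding helmholtz_form_def by (rule sum.swap)
  finally show ?thesis ..
qed

end

theorem theorem3p16:
  fixes X :: "'a topology"
    and \<A> :: "('a, 'N::finite) chart set"
    and imm :: bool
    and s t :: nat
    and \<T> :: "('a, 'n::finite) velocity \<Rightarrow> ('a, 'n) tangent \<Rightarrow> real"
  assumes "smooth_manifold X \<A>"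
    and "CARD('n) \<le> CARD('N)"
    and "differential_equation \<A> imm s \<T>"
    and "t > 2 * s"
  shows "\<exists>\<H>. two_form \<A> imm t \<H> \<and>
    (\<forall>c\<in>\<A>. \<forall>T. has_local_form \<A> imm s \<T> c T \<longrightarrow>
      (\<forall>p \<in> vdom \<A> imm t c. \<forall>v \<in> tangent_space \<A> imm t p. \<forall>w \<in> tangent_space \<A> imm t p.
         \<H> p v w =
           (\<Sum>A\<in>UNIV. \<Sum>B\<in>UNIV. \<Sum>J | length J \<le> s.
              helmholtz \<A> imm t c s T J A B p *
              wedge (differential (vcoord c B J)) (differential (vcoord c A [])) v w)))"
proof -
  interpret velocity_bundle X \<A> imm by (unfold_locales) (rule assms(1))
  obtain T0 where T0: "\<And>c. c \<in> \<A> \<Longrightarrow> has_local_form \<A> imm s \<T> c (T0 c)"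
    using assms(3) unfolding differential_equation_def by metis
  \<comment> \<open>A chart is chosen for each velocity separately. Chart independence then
    identifies \<open>H\<close> on the whole of each \<open>vdom\<close> with the formula for any
    local components there, which also yields its smoothness.\<close>
  define ch where "ch = (\<lambda>p :: ('a, 'n) velocity. SOME c. c \<in> \<A> \<and> p \<in> vdom \<A> imm t c)"
  define H where "H = (\<lambda>p :: ('a, 'n) velocity. helmholtz_form (ch p) s t (T0 (ch p)) p)"
  have ch: "ch p \<in> \<A> \<and> p \<in> vdom \<A> imm t (ch p)" if "c \<in> \<A>" "p \<in> vdom \<A> imm t c" for c p
    unfolding ch_def by (rule someI[where P="\<lambda>c. c \<in> \<A> \<and> p \<in> vdom \<A> imm t c"]) (use that in blast)
  have H: "H p v w = helmholtz_form c s t T p v w"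
    if "c \<in> \<A>" "has_local_form \<A> imm s \<T> c T" "p \<in> vdom \<A> imm t c"
      "v \<in> tangent_space \<A> imm t p" "w \<in> tangent_space \<A> imm t p" for c T p v w
    unfolding H_def using ch[OF that(1,3)] T0 that
    by (intro helmholtz_form_chart_independent[OF _ _ _ _ assms(4)]) auto
  have "two_form \<A> imm t H"
    unfolding two_form_def
  proof (intro conjI ballI)
    show "linear_on_tangent V (H p v)" "linear_on_tangent V (\<lambda>w. H p w v)" "H p v v = 0" for V p v
      by (simp_all add: H_def linear_on_tangent_helmholtz_form helmholtz_form_diagonal)
    fix c assume c: "c \<in> \<A>"
    let ?b = "\<lambda>A I B J. if J = [] \<and> length I \<le> s then helmholtz \<A> imm t c s (T0 c) I B A else (\<lambda>_. 0)"
    have "vsmooth t c (?b A I B J)" for A I B J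
      by (cases "J = [] \<and> length I \<le> s") (simp_all add: vsmooth_helmholtz[OF c assms(4) T0[OF c]] vsmooth_const[OF c])
    then have "vsmooth_on \<A> imm t c (vdom \<A> imm t c) (?b A I B J)" for A I B J
      unfolding vsmooth_def by (rule conjunct2)
    moreover have "H p v w = (\<Sum>A\<in>UNIV. \<Sum>I | length I \<le> t. \<Sum>B\<in>UNIV. \<Sum>J | length J \<le> t.
        ?b A I B J p * wedge (differential (vcoord c A I)) (differential (vcoord c B J)) v w)"
      if "p \<in> vdom \<A> imm t c" "v \<in> tangent_space \<A> imm t p" "w \<in> tangent_space \<A> imm t p" for p v w
      unfolding H[OF c T0[OF c] that] using assms(4)
      by (subst helmholtz_form_components) (auto intro!: sum.cong)
    ultimately show "\<exists>b. (\<forall>A I B J. vsmooth_on \<A> imm t c (vdom \<A> imm t c) (b A I B J)) \<and>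
        (\<forall>p \<in> vdom \<A> imm t c. \<forall>v \<in> tangent_space \<A> imm t p. \<forall>w \<in> tangent_space \<A> imm t p.
           H p v w = (\<Sum>A\<in>UNIV. \<Sum>I | length I \<le> t. \<Sum>B\<in>UNIV. \<Sum>J | length J \<le> t.
                b A I B J p * wedge (differential (vcoord c A I)) (differential (vcoord c B J)) v w))"
      by (intro exI[of _ ?b]) blast
  qed
  then show ?thesis
    using H unfolding helmholtz_form_def by blast
qed

end
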